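(* Let $n\ge1$, let $F\colon M\to N$ be a smooth map of manifolds, let $\varpi=(\omega,\eta)\in\Omega^{n+1}(F)$ be $d_F$-closed, and assume that $H_{n+1}(N;\mathbb Z)$ and $K=\ker\bigl(F_*\colon H_n(M;\mathbb Z)\to H_n(N;\mathbb Z)\bigr)$ are finitely generated. Choose classes $S_1,\dots,S_a\in H_{n+1}(N;\mathbb Z)$ whose images generate the free quotient $H_{n+1}(N;\mathbb Z)/\mathrm{Tor}$, and classes $T_1,\dots,T_b$ generating $K$ (torsion included). Set $$r_i:=\int_{S_i}\omega\quad(1\le i\le a),\qquad r_{a+j}:=\int_S\omega-\int_{T_j}\eta\quad(1\le j\le b),$$ the second computed from a cycle representing $T_j$ and any singular chain $S$ in $N$ with $\partial S=F_*T_j$. Let $k_0\ge0$ be the unique integer with $L(\varpi)=k_0\mathbb Z$. Then: (i) $P_\varpi=\langle r_1,\dots,r_{a+b}\rangle$ is a finitely generated subgroup of $\mathbb R$; in particular the choice of the chains $S$ affects the $r_{a+j}$ only by elements of $\langle r_1,\dots,r_a\rangle$, hence not the group they generate; (ii) $k_0=0$ if and only if some $r_i$ is irrational; in that case no nonzero level admits a relative prequantization; (iii) if every $r_i$ is rational, write the nonzero ones as $p_i/q_i$ in lowest terms with $q_i\ge1$ and discard the $r_i$ that vanish; then $k_0=\operatorname{lcm}\{q_i : r_i\ne0\}$, with the convention $k_0=1$ if every $r_i=0$. In particular $k_0$ is determined by at most $a+b$ integrals followed by one arithmetic computation.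
   Context: For a smooth map $F\colon M\to N$: $\Omega^k(F)=\Omega^k(N)\oplus\Omega^{k-1}(M)$ with $d_F(\alpha,\beta)=(d\alpha,\,F^*\alpha-d\beta)$. $C_k(P)$ denotes smooth singular $k$-chains on $P$ with $\mathbb Z$ coefficients; $C_k(F)=C_k(N)\oplus C_{k-1}(M)$; $Z_k(F)$ is the group of relative cycles, i.e. pairs $(S,T)\in C_k(F)$ with $\partial S=F_*T$, $\partial T=0$. The pairing is $\langle(\alpha,\beta),(S,T)\rangle=\int_S\alpha-\int_T\beta$; $P_\varpi=\{\langle\varpi,c\rangle : c\in Z_{n+1}(F)\}\subseteq\mathbb R$; $\varpi$ is relatively integral if $P_\varpi\subseteq\mathbb Z$. The level group is $L(\varpi)=\{k\in\mathbb Z : k\varpi\text{ is relatively integral}\}=\{k : kP_\varpi\subseteq\mathbb Z\}$, which is a subgroup of $\mathbb Z$. "Level $k$ admits a relative prequantization" means that $k\varpi$ is relatively integral, i.e. $k\in L(\varpi)$. $\langle r_1,\dots,r_m\rangle$ denotes the subgroup of $\mathbb R$ generated by the $r_i$. *)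

theory Defs
  imports
    "HOL-Analysis.Analysis"
    "HOL-Homology.Homology"
    "HOL-Computational_Algebra.Group_Closure"
begin

section \<open>Smooth functions on open subsets of R^d\<close>

text \<open>
  As in \<^term>\<open>Euclidean_space d\<close> and \<^term>\<open>standard_simplex k\<close>, points and vectors of R^d are
  functions \<^typ>\<open>nat \<Rightarrow> real\<close> that vanish at all indices \<open>\<ge> d\<close>. Hence dimensions are
  ordinary natural numbers, and dimension 0 is included.
\<close>

abbreviation R_pow :: "nat \<Rightarrow> (nat \<Rightarrow> real) set" where
  "R_pow d \<equiv> topspace (Euclidean_space d)"

definition partial_deriv :: "nat \<Rightarrow> ((nat \<Rightarrow> real) \<Rightarrow> real) \<Rightarrow> (nat \<Rightarrow> real) \<Rightarrow> real" where
  "partial_deriv l f x = deriv (\<lambda>t. f (x(l := t))) (x l)"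

primrec Ck_on :: "nat \<Rightarrow> nat \<Rightarrow> (nat \<Rightarrow> real) set \<Rightarrow> ((nat \<Rightarrow> real) \<Rightarrow> real) \<Rightarrow> bool" where
  "Ck_on 0 d U f \<longleftrightarrow> continuous_map (subtopology (Euclidean_space d) U) euclideanreal f"
| "Ck_on (Suc k) d U f \<longleftrightarrow>
     continuous_map (subtopology (Euclidean_space d) U) euclideanreal f \<and>
     (\<forall>l<d. (\<forall>x\<in>U. (\<lambda>t. f (x(l := t))) differentiable (at (x l))) \<and>
            Ck_on k d U (partial_deriv l f))"

definition smooth_fun_on :: "nat \<Rightarrow> (nat \<Rightarrow> real) set \<Rightarrow> ((nat \<Rightarrow> real) \<Rightarrow> real) \<Rightarrow> bool" where
  "smooth_fun_on d U f \<longleftrightarrow> (\<forall>k. Ck_on k d U f)"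

text \<open>Directional derivative of \<open>f\<close> and differential of the vector-valued \<open>g\<close>, on R^d.\<close>

definition dir_deriv ::
    "nat \<Rightarrow> ((nat \<Rightarrow> real) \<Rightarrow> real) \<Rightarrow> (nat \<Rightarrow> real) \<Rightarrow> (nat \<Rightarrow> real) \<Rightarrow> real" where
  "dir_deriv d f x w = (\<Sum>l<d. w l * partial_deriv l f x)"

definition differential ::
    "nat \<Rightarrow> ((nat \<Rightarrow> real) \<Rightarrow> nat \<Rightarrow> real) \<Rightarrow> (nat \<Rightarrow> real) \<Rightarrow> (nat \<Rightarrow> real) \<Rightarrow> nat \<Rightarrow> real" where
  "differential d g x w = (\<lambda>i. dir_deriv d (\<lambda>y. g y i) x w)"

section \<open>Smooth manifolds and smooth maps\<close>

text \<open>
  A chart is a pair of a domain and a coordinate map (only its values on the domain matter).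
  A manifold is given by its topological space, its dimension and any smooth atlas; all notions
  below depend on the atlas only through the smooth structure it generates.
\<close>

type_synonym 'a chart = "'a set \<times> ('a \<Rightarrow> nat \<Rightarrow> real)"

record 'a mfd =
  mtop :: "'a topology"
  mdim :: nat
  atlas :: "'a chart set"

definition smooth_manifold :: "'a mfd \<Rightarrow> bool" where
  "smooth_manifold M \<longleftrightarrow>
     Hausdorff_space (mtop M) \<and> second_countable (mtop M) \<and>
     (\<Union>(U, \<phi>)\<in>atlas M. U) = topspace (mtop M) \<and>
     (\<forall>(U, \<phi>)\<in>atlas M. openin (mtop M) U \<and> openin (Euclidean_space (mdim M)) (\<phi> ` U) \<and>
        homeomorphic_map (subtopology (mtop M) U)
          (subtopology (Euclidean_space (mdim M)) (\<phi> ` U)) \<phi>) \<and>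
     (\<forall>(U, \<phi>)\<in>atlas M. \<forall>(V, \<psi>)\<in>atlas M. \<forall>i<mdim M.
        smooth_fun_on (mdim M) (\<phi> ` (U \<inter> V)) (\<lambda>x. \<psi> (inv_into U \<phi> x) i))"

definition smooth_map :: "'a mfd \<Rightarrow> 'b mfd \<Rightarrow> ('a \<Rightarrow> 'b) \<Rightarrow> bool" where
  "smooth_map M N F \<longleftrightarrow>
     continuous_map (mtop M) (mtop N) F \<and>
     (\<forall>(U, \<phi>)\<in>atlas M. \<forall>(V, \<psi>)\<in>atlas N. \<forall>i<mdim N.
        smooth_fun_on (mdim M) (\<phi> ` {p \<in> U. F p \<in> V}) (\<lambda>x. \<psi> (F (inv_into U \<phi> x)) i))"

definition euclidean_mfd :: "nat \<Rightarrow> (nat \<Rightarrow> real) set \<Rightarrow> (nat \<Rightarrow> real) mfd" where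
  "euclidean_mfd d W =
     \<lparr>mtop = subtopology (Euclidean_space d) W, mdim = d, atlas = {(W, \<lambda>x. x)}\<rparr>"

section \<open>Differential forms\<close>

text \<open>
  A \<open>k\<close>-form is a family of \<open>k\<close>-forms on the chart images that is compatible with the changes of
  coordinates: \<open>\<alpha> c x v\<close> is the value of \<open>\<alpha>\<close> in the chart \<open>c\<close>, at the coordinate point \<open>x\<close>, on the
  tangent vectors \<open>v 0, \<dots>, v (k - 1)\<close>. Values at other arguments carry no meaning; accordingly,
  \<open>form_vanishes\<close> rather than \<open>=\<close> expresses that a form is zero.
\<close>

type_synonym 'a form = "'a chart \<Rightarrow> (nat \<Rightarrow> real) \<Rightarrow> (nat \<Rightarrow> nat \<Rightarrow> real) \<Rightarrow> real"

definition alternating_multilinear :: "nat \<Rightarrow> nat \<Rightarrow> ((nat \<Rightarrow> nat \<Rightarrow> real) \<Rightarrow> real) \<Rightarrow> bool" where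
  "alternating_multilinear d k f \<longleftrightarrow>
     (\<forall>v w. (\<forall>j<k. v j \<in> R_pow d \<and> v j = w j) \<longrightarrow> f v = f w) \<and>
     (\<forall>v. \<forall>j<k. \<forall>u\<in>R_pow d. \<forall>w\<in>R_pow d. \<forall>a b. (\<forall>i<k. v i \<in> R_pow d) \<longrightarrow>
        f (v(j := (\<lambda>i. a * u i + b * w i))) = a * f (v(j := u)) + b * f (v(j := w))) \<and>
     (\<forall>v. \<forall>i<k. \<forall>j<k. (\<forall>l<k. v l \<in> R_pow d) \<and> i \<noteq> j \<and> v i = v j \<longrightarrow> f v = 0)"

definition smooth_forms :: "nat \<Rightarrow> 'a mfd \<Rightarrow> 'a form set" where
  "smooth_forms k M = {\<alpha>.
     (\<forall>(U, \<phi>)\<in>atlas M.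
        (\<forall>x\<in>\<phi> ` U. alternating_multilinear (mdim M) k (\<alpha> (U, \<phi>) x)) \<and>
        (\<forall>v. (\<forall>j<k. v j \<in> R_pow (mdim M)) \<longrightarrow>
           smooth_fun_on (mdim M) (\<phi> ` U) (\<lambda>x. \<alpha> (U, \<phi>) x v))) \<and>
     (\<forall>(U, \<phi>)\<in>atlas M. \<forall>(V, \<psi>)\<in>atlas M. \<forall>p\<in>U \<inter> V. \<forall>v. (\<forall>j<k. v j \<in> R_pow (mdim M)) \<longrightarrow>
        \<alpha> (U, \<phi>) (\<phi> p) v =
        \<alpha> (V, \<psi>) (\<psi> p) (\<lambda>j. differential (mdim M) (\<psi> \<circ> inv_into U \<phi>) (\<phi> p) (v j)))}"

definition form_vanishes :: "nat \<Rightarrow> 'a mfd \<Rightarrow> 'a form \<Rightarrow> bool" where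
  "form_vanishes k M \<alpha> \<longleftrightarrow>
     (\<forall>(U, \<phi>)\<in>atlas M. \<forall>x\<in>\<phi> ` U. \<forall>v. (\<forall>j<k. v j \<in> R_pow (mdim M)) \<longrightarrow> \<alpha> (U, \<phi>) x v = 0)"

text \<open>
  The exterior derivative of a \<open>k\<close>-form on R^d, evaluated on constant vector fields:
  the alternating sum of the derivatives along \<open>v j\<close> of \<open>\<alpha>\<close> at the remaining vectors.
\<close>

definition ext_deriv :: "nat \<Rightarrow> 'a mfd \<Rightarrow> 'a form \<Rightarrow> 'a form" where
  "ext_deriv k M \<alpha> = (\<lambda>c x v. \<Sum>j\<le>k. (-1) ^ j *
     dir_deriv (mdim M) (\<lambda>y. \<alpha> c y (\<lambda>i. if i < j then v i else v (Suc i))) x (v j))"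

text \<open>
  The pullback along a map \<open>g\<close> from an open subset of R^d to \<open>N\<close>. It is computed in some chart of
  \<open>N\<close> around \<open>g x\<close>; for forms it does not depend on which.
\<close>

definition pull_local ::
    "'b mfd \<Rightarrow> nat \<Rightarrow> ((nat \<Rightarrow> real) \<Rightarrow> 'b) \<Rightarrow> 'b form \<Rightarrow> (nat \<Rightarrow> real) \<Rightarrow> (nat \<Rightarrow> nat \<Rightarrow> real) \<Rightarrow> real" where
  "pull_local N d g \<alpha> x v =
     (let c = (SOME c. c \<in> atlas N \<and> g x \<in> fst c)
      in \<alpha> c (snd c (g x)) (\<lambda>j. differential d (snd c \<circ> g) x (v j)))"

definition pullback :: "'a mfd \<Rightarrow> 'b mfd \<Rightarrow> ('a \<Rightarrow> 'b) \<Rightarrow> 'b form \<Rightarrow> 'a form" where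
  "pullback M N F \<alpha> = (\<lambda>(U, \<phi>). pull_local N (mdim M) (F \<circ> inv_into U \<phi>) \<alpha>)"

section \<open>Smooth singular chains and homology\<close>

definition smooth_simplex :: "nat \<Rightarrow> 'a mfd \<Rightarrow> ((nat \<Rightarrow> real) \<Rightarrow> 'a) \<Rightarrow> bool" where
  "smooth_simplex k M \<sigma> \<longleftrightarrow>
     singular_simplex k (mtop M) \<sigma> \<and>
     (\<exists>W g. openin (Euclidean_space (Suc k)) W \<and> standard_simplex k \<subseteq> W \<and>
        smooth_map (euclidean_mfd (Suc k) W) M g \<and> (\<forall>x\<in>standard_simplex k. \<sigma> x = g x))"

definition smooth_chain_group :: "nat \<Rightarrow> 'a mfd \<Rightarrow> 'a chain monoid" where
  "smooth_chain_group k M = free_Abelian_group (Collect (smooth_simplex k M))"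

definition smooth_chains :: "nat \<Rightarrow> 'a mfd \<Rightarrow> 'a chain set" where
  "smooth_chains k M = carrier (smooth_chain_group k M)"

definition smooth_cycles :: "nat \<Rightarrow> 'a mfd \<Rightarrow> 'a chain set" where
  "smooth_cycles k M = {c \<in> smooth_chains k M. chain_boundary k c = 0}"

definition smooth_boundaries :: "nat \<Rightarrow> 'a mfd \<Rightarrow> 'a chain set" where
  "smooth_boundaries k M = chain_boundary (Suc k) ` smooth_chains (Suc k) M"

definition smooth_cycle_group :: "nat \<Rightarrow> 'a mfd \<Rightarrow> 'a chain monoid" where
  "smooth_cycle_group k M = subgroup_generated (smooth_chain_group k M) (smooth_cycles k M)"

definition smooth_homology_group :: "nat \<Rightarrow> 'a mfd \<Rightarrow> 'a chain set monoid" where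
  "smooth_homology_group k M = smooth_cycle_group k M Mod smooth_boundaries k M"

definition smooth_hom_induced ::
    "nat \<Rightarrow> 'b mfd \<Rightarrow> ('a \<Rightarrow> 'b) \<Rightarrow> 'a chain set \<Rightarrow> 'b chain set" where
  "smooth_hom_induced k N F C =
     the_elem ((\<lambda>c. smooth_boundaries k N #>\<^bsub>smooth_cycle_group k N\<^esub> chain_map k F c) ` C)"

definition torsion_subgroup :: "('a, 'b) monoid_scheme \<Rightarrow> 'a set" where
  "torsion_subgroup G = {x \<in> carrier G. \<exists>m::nat. m > 0 \<and> x [^]\<^bsub>G\<^esub> m = \<one>\<^bsub>G\<^esub>}"

definition fin_gen_group :: "('a, 'b) monoid_scheme \<Rightarrow> bool" where
  "fin_gen_group G \<longleftrightarrow> (\<exists>A. finite A \<and> A \<subseteq> carrier G \<and> generate G A = carrier G)"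

section \<open>Integration over smooth chains\<close>

text \<open>
  The affine parametrisation of \<^term>\<open>standard_simplex k\<close> by the simplex
  \<open>{t. t\<^sub>j \<ge> 0, \<Sum>\<^sub>j t\<^sub>j \<le> 1}\<close> in R^k, sending the origin to vertex 0 and the \<open>j\<close>-th unit vector
  (counted from 0) to vertex \<open>j + 1\<close>; it fixes the orientation. It only reads the coordinates
  \<open>< k\<close>, so it can be applied to points of the product space \<^term>\<open>PiM {..<k} (\<lambda>_. lborel)\<close>,
  which are \<^term>\<open>undefined\<close> (not 0) at the indices \<open>\<ge> k\<close>.
\<close>

definition simplex_param :: "nat \<Rightarrow> (nat \<Rightarrow> real) \<Rightarrow> nat \<Rightarrow> real" where
  "simplex_param k t =
     (\<lambda>i. if i = 0 then 1 - (\<Sum>j<k. t j) else if i \<le> k then t (i - 1) else 0)"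

text \<open>
  The integral of the pullback, evaluated on the standard frame, over the interior of the simplex:
  there the partial derivatives of the composite with \<open>\<sigma>\<close> do not depend on an extension of \<open>\<sigma>\<close>,
  and the boundary is a null set.
\<close>

definition simplex_integral :: "nat \<Rightarrow> 'a mfd \<Rightarrow> 'a form \<Rightarrow> ((nat \<Rightarrow> real) \<Rightarrow> 'a) \<Rightarrow> real" where
  "simplex_integral k M \<alpha> \<sigma> =
     (LINT t:{t. (\<forall>j<k. 0 < t j) \<and> (\<Sum>j<k. t j) < 1}|PiM {..<k} (\<lambda>_. lborel).
        pull_local M k (\<sigma> \<circ> simplex_param k) \<alpha> t (\<lambda>j i. if i = j then 1 else 0))"

definition chain_integral :: "nat \<Rightarrow> 'a mfd \<Rightarrow> 'a form \<Rightarrow> 'a chain \<Rightarrow> real" where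
  "chain_integral k M \<alpha> c =
     (\<Sum>\<sigma>\<in>Poly_Mapping.keys c. of_int (Poly_Mapping.lookup c \<sigma>) * simplex_integral k M \<alpha> \<sigma>)"

section \<open>Relative forms, relative cycles and their pairing\<close>

text \<open>
  Throughout, \<open>F\<close> is a map from \<open>M\<close> to \<open>N\<close>; relative forms and chains of degree \<open>k \<ge> 1\<close> are
  pairs consisting of a component of degree \<open>k\<close> on \<open>N\<close> and one of degree \<open>k - 1\<close> on \<open>M\<close>.
\<close>

type_synonym ('a, 'b) rel_form = "'b form \<times> 'a form"

definition rel_forms :: "nat \<Rightarrow> 'a mfd \<Rightarrow> 'b mfd \<Rightarrow> ('a, 'b) rel_form set" where
  "rel_forms k M N = smooth_forms k N \<times> smooth_forms (k - 1) M"

definition rel_ext_deriv ::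
    "nat \<Rightarrow> 'a mfd \<Rightarrow> 'b mfd \<Rightarrow> ('a \<Rightarrow> 'b) \<Rightarrow> ('a, 'b) rel_form \<Rightarrow> ('a, 'b) rel_form" where
  "rel_ext_deriv k M N F = (\<lambda>(\<alpha>, \<beta>).
     (ext_deriv k N \<alpha>, \<lambda>c x v. pullback M N F \<alpha> c x v - ext_deriv (k - 1) M \<beta> c x v))"

definition rel_closed :: "nat \<Rightarrow> 'a mfd \<Rightarrow> 'b mfd \<Rightarrow> ('a \<Rightarrow> 'b) \<Rightarrow> ('a, 'b) rel_form \<Rightarrow> bool" where
  "rel_closed k M N F \<theta> \<longleftrightarrow>
     form_vanishes (k + 1) N (fst (rel_ext_deriv k M N F \<theta>)) \<and>
     form_vanishes k M (snd (rel_ext_deriv k M N F \<theta>))"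

definition rel_scale :: "real \<Rightarrow> ('a, 'b) rel_form \<Rightarrow> ('a, 'b) rel_form" where
  "rel_scale a = (\<lambda>(\<alpha>, \<beta>). (\<lambda>c x v. a * \<alpha> c x v, \<lambda>c x v. a * \<beta> c x v))"

definition rel_cycles ::
    "nat \<Rightarrow> 'a mfd \<Rightarrow> 'b mfd \<Rightarrow> ('a \<Rightarrow> 'b) \<Rightarrow> ('b chain \<times> 'a chain) set" where
  "rel_cycles k M N F =
     {(S, T). S \<in> smooth_chains k N \<and> T \<in> smooth_chains (k - 1) M \<and>
        chain_boundary k S = chain_map (k - 1) F T \<and> chain_boundary (k - 1) T = 0}"

definition rel_pairing ::
    "nat \<Rightarrow> 'a mfd \<Rightarrow> 'b mfd \<Rightarrow> ('a, 'b) rel_form \<Rightarrow> 'b chain \<times> 'a chain \<Rightarrow> real" where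
  "rel_pairing k M N = (\<lambda>(\<alpha>, \<beta>) (S, T).
     chain_integral k N \<alpha> S - chain_integral (k - 1) M \<beta> T)"

definition rel_periods ::
    "nat \<Rightarrow> 'a mfd \<Rightarrow> 'b mfd \<Rightarrow> ('a \<Rightarrow> 'b) \<Rightarrow> ('a, 'b) rel_form \<Rightarrow> real set" where
  "rel_periods k M N F \<theta> = rel_pairing k M N \<theta> ` rel_cycles k M N F"

definition rel_integral ::
    "nat \<Rightarrow> 'a mfd \<Rightarrow> 'b mfd \<Rightarrow> ('a \<Rightarrow> 'b) \<Rightarrow> ('a, 'b) rel_form \<Rightarrow> bool" where
  "rel_integral k M N F \<theta> \<longleftrightarrow> rel_periods k M N F \<theta> \<subseteq> \<int>"

text \<open>The integers \<open>m\<close> in the level group are the levels that admit a relative prequantization.\<close>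

definition level_group ::
    "nat \<Rightarrow> 'a mfd \<Rightarrow> 'b mfd \<Rightarrow> ('a \<Rightarrow> 'b) \<Rightarrow> ('a, 'b) rel_form \<Rightarrow> int set" where
  "level_group k M N F \<theta> = {m. rel_integral k M N F (rel_scale (of_int m) \<theta>)}"

end

theory Submission
  imports Defs
begin

text \<open>
  Why the theorem holds. Let \<open>(S, T)\<close> be a relative cycle. The class of \<open>T\<close> lies in the kernel
  \<open>K\<close>, because \<open>F\<^sub>* T = \<partial>S\<close>. Writing that class in the generators gives
  \<open>T = \<Sum> m\<^sub>j t\<^sub>j + \<partial>U\<close>, and then \<open>S - \<Sum> m\<^sub>j c\<^sub>j - F\<^sub>* U\<close> is an absolute cycle of \<open>N\<close>; modulo a torsion
  cycle it is homologous to a combination of the \<open>s\<^sub>i\<close>. Hence the pairing with \<open>(S, T)\<close> is an integral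
  combination of the \<open>r\<^sub>i\<close> as soon as two facts are available:

  \<^item> \<open>\<omega>\<close> integrates to 0 over boundaries, hence also over torsion cycles, since a real number with a
    vanishing multiple vanishes. This is Stokes' theorem together with \<open>d\<omega> = 0\<close>.
  \<^item> \<open>(F\<^sub>* U, \<partial>U)\<close> pairs to 0 with \<open>(\<omega>, \<eta>)\<close>. Indeed the integral of \<open>\<omega>\<close> over \<open>F\<^sub>* U\<close> is the integral over \<open>U\<close>
    of \<open>F\<^sup>* \<omega> = d\<eta>\<close>, which by Stokes' theorem is the integral of \<open>\<eta>\<close> over \<open>\<partial>U\<close>.

  So the bulk of the work is Stokes' theorem for smooth singular chains (\<open>stokes\<close>) and the naturality
  of the integral (\<open>chain_integral_chain_map\<close>). Both are reduced to a smooth map \<open>g\<close> from an open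
  neighbourhood of the solid simplex of R^k into the manifold. The pullback of a form along \<open>g\<close> is
  chart independent (\<open>pull_local_in_chart\<close>) and commutes with the exterior derivative
  (\<open>pull_local_ext_deriv\<close>), so only forms on R^k have to be integrated. For those, Stokes' theorem is
  the fundamental theorem of calculus in one coordinate combined with Fubini
  (\<open>simplex_int_partial_deriv\<close>); the slanted face requires in addition that the integral over it does
  not depend on which coordinate is eliminated (\<open>simplex_int_slanted_face\<close>).

  Once the periods are known to form the group generated by the \<open>r\<^sub>i\<close>, a level \<open>m\<close> is admissible iff
  \<open>m r\<^sub>i\<close> is an integer for every \<open>i\<close>, that is, iff every \<open>r\<^sub>i\<close> is rational with denominator dividing
  \<open>m\<close>, or \<open>m = 0\<close>. The statements on \<open>k\<^sub>0\<close> follow (\<open>denominators_level\<close>).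
\<close>

section \<open>Open subsets of R^d\<close>

lemma R_pow_iff: "x \<in> R_pow d \<longleftrightarrow> (\<forall>i\<ge>d. x i = 0)"
  by (simp add: topspace_Euclidean_space)

lemma fun_upd_in_R_pow: "x \<in> R_pow d \<Longrightarrow> l < d \<Longrightarrow> x(l := s) \<in> R_pow d"
  by (auto simp: R_pow_iff)

lemma Euclidean_space_eq_top_of_set: "Euclidean_space d = top_of_set (R_pow d)"
  unfolding topspace_Euclidean_space by (simp add: Euclidean_space_def euclidean_product_topology)

lemma openin_Euclidean_space_iff: "openin (Euclidean_space d) U \<longleftrightarrow> openin (top_of_set (R_pow d)) U"
  by (subst Euclidean_space_eq_top_of_set) (rule refl)

lemma subtopology_Euclidean_space_eq:
  "U \<subseteq> R_pow d \<Longrightarrow> subtopology (Euclidean_space d) U = top_of_set U"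
  by (subst Euclidean_space_eq_top_of_set) (simp add: subtopology_subtopology Int_absorb1)

lemma openin_Euclidean_subset: "openin (Euclidean_space d) U \<Longrightarrow> U \<subseteq> R_pow d"
  by (rule openin_subset)

text \<open>
  The type of points carries the product topology and no norm, so boxes in the first \<open>d\<close> coordinates
  play the role of balls. They suffice because the remaining coordinates of points of R^d vanish.
\<close>

lemma openin_Euclidean_box:
  assumes U: "openin (Euclidean_space d) U" and x: "x \<in> U"
  obtains e where "e > 0" "\<And>y. y \<in> R_pow d \<Longrightarrow> (\<And>l. l < d \<Longrightarrow> \<bar>y l - x l\<bar> < e) \<Longrightarrow> y \<in> U"
proof -
  obtain T where T: "open T" "U = R_pow d \<inter> T"
    using U by (auto simp: openin_Euclidean_space_iff openin_open)
  have "openin (powertop_real UNIV) T"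
    using T(1) by (simp add: euclidean_product_topology)
  then obtain X where X: "x \<in> Pi\<^sub>E UNIV X" "\<And>i. open (X i)" "Pi\<^sub>E UNIV X \<subseteq> T"
    using product_topology_open_contains_basis[of "\<lambda>_. euclideanreal" UNIV T x] x T(2) by auto
  have "\<forall>l. \<exists>e>0. ball (x l) e \<subseteq> X l"
    using X(1,2) by (auto simp: open_contains_ball)
  then obtain E where E: "\<And>l. E l > 0" "\<And>l. ball (x l) (E l) \<subseteq> X l"
    by metis
  define e where "e = Min (insert 1 (E ` {..<d}))"
  show thesis
  proof
    show "e > 0" by (auto simp: e_def E(1))
    fix y assume y: "y \<in> R_pow d" "\<And>l. l < d \<Longrightarrow> \<bar>y l - x l\<bar> < e"
    have "y l \<in> X l" for l
    proof (cases "l < d")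
      case True
      then have "e \<le> E l" by (auto simp: e_def)
      with y(2)[OF True] have "y l \<in> ball (x l) (E l)" by (simp add: dist_real_def abs_minus_commute)
      then show ?thesis using E(2) by blast
    next
      case False
      with y(1) x T(2) have "y l = x l" by (simp add: R_pow_iff)
      then show ?thesis using X(1) by auto
    qed
    then show "y \<in> U" using X(3) T(2) y(1) by blast
  qed
qed

lemma continuous_on_box:
  assumes U: "openin (Euclidean_space d) U" and x: "x \<in> U" and f: "continuous_on U f" and "(0::real) < e"
  obtains r where "r > 0"
    "\<And>y. y \<in> R_pow d \<Longrightarrow> (\<And>l. l < d \<Longrightarrow> \<bar>y l - x l\<bar> < r) \<Longrightarrow> y \<in> U \<and> \<bar>f y - f x\<bar> < (e::real)"
proof -
  have "openin (top_of_set U) (U \<inter> f -` ball (f x) e)"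
    using f by (rule continuous_openin_preimage_gen) simp
  then have "openin (Euclidean_space d) (U \<inter> f -` ball (f x) e)"
    using U by (metis openin_Euclidean_space_iff openin_trans)
  then obtain r where "r > 0"
    "\<And>y. y \<in> R_pow d \<Longrightarrow> (\<And>l. l < d \<Longrightarrow> \<bar>y l - x l\<bar> < r) \<Longrightarrow> y \<in> U \<inter> f -` ball (f x) e"
    by (rule openin_Euclidean_box) (use x assms in auto)
  then show thesis
    by (intro that[of r]) (auto simp: dist_real_def abs_minus_commute)
qed

lemma eventually_path_in_open:
  assumes U: "openin (Euclidean_space d) U" and x: "\<gamma> s0 \<in> U"
    and R: "\<forall>\<^sub>F s in nhds s0. \<gamma> s \<in> R_pow d"
    and c: "\<And>l. l < d \<Longrightarrow> isCont (\<lambda>s. \<gamma> s l) (s0::real)"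
  shows "\<forall>\<^sub>F s in nhds s0. \<gamma> s \<in> U"
proof -
  obtain e where e: "e > 0" "\<And>y. y \<in> R_pow d \<Longrightarrow> (\<And>l. l < d \<Longrightarrow> \<bar>y l - \<gamma> s0 l\<bar> < e) \<Longrightarrow> y \<in> U"
    using openin_Euclidean_box[OF U x] by blast
  have "\<forall>\<^sub>F s in nhds s0. \<forall>l\<in>{..<d}. \<bar>\<gamma> s l - \<gamma> s0 l\<bar> < e"
    unfolding eventually_ball_finite_distrib[OF finite_lessThan]
  proof
    fix l assume "l \<in> {..<d}"
    then have "((\<lambda>s. \<gamma> s l) \<longlongrightarrow> \<gamma> s0 l) (nhds s0)"
      using c[of l] tendsto_at_iff_tendsto_nhds[of "\<lambda>s. \<gamma> s l" s0] by (simp add: isCont_def)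
    then have "\<forall>\<^sub>F s in nhds s0. dist (\<gamma> s l) (\<gamma> s0 l) < e"
      using e(1) by (rule tendstoD)
    then show "\<forall>\<^sub>F s in nhds s0. \<bar>\<gamma> s l - \<gamma> s0 l\<bar> < e"
      by (simp add: dist_real_def)
  qed
  with R show ?thesis
    by eventually_elim (use e(2) in auto)
qed

lemma eventually_fun_upd_in_open:
  assumes "openin (Euclidean_space d) U" "x \<in> U" "l < d"
  shows "\<forall>\<^sub>F s in nhds (x l). x(l := s) \<in> U"
proof (rule eventually_path_in_open[OF assms(1)])
  have x: "x \<in> R_pow d" using assms openin_Euclidean_subset by blast
  then show "\<forall>\<^sub>F s in nhds (x l). x(l := s) \<in> R_pow d"
    using assms(3) by (intro always_eventually) (simp add: fun_upd_in_R_pow)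
  show "isCont (\<lambda>s. (x(l := s)) k) (x l)" for k
    by (cases "k = l") auto
qed (use assms in auto)

section \<open>Partial derivatives\<close>

lemma partial_deriv_eqI:
  "((\<lambda>t. f (x(l := t))) has_real_derivative D) (at (x l)) \<Longrightarrow> partial_deriv l f x = D"
  by (simp add: partial_deriv_def DERIV_imp_deriv)

lemma partial_deriv_cong:
  assumes "openin (Euclidean_space d) U" "x \<in> U" "l < d" "\<And>y. y \<in> U \<Longrightarrow> f y = g y"
  shows "partial_deriv l f x = partial_deriv l g x"
  unfolding partial_deriv_def
  by (rule deriv_cong_ev[OF _ refl]) (use eventually_fun_upd_in_open[OF assms(1-3)] assms(4) in \<open>auto elim: eventually_mono\<close>)

lemma Ck_on_0_iff: "U \<subseteq> R_pow d \<Longrightarrow> Ck_on 0 d U f \<longleftrightarrow> continuous_on U f"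
  by (simp add: subtopology_Euclidean_space_eq)

lemma Ck_on_Suc_iff:
  "U \<subseteq> R_pow d \<Longrightarrow> Ck_on (Suc k) d U f \<longleftrightarrow> continuous_on U f \<and>
     (\<forall>l<d. (\<forall>x\<in>U. ((\<lambda>t. f (x(l := t))) has_real_derivative partial_deriv l f x) (at (x l))) \<and>
        Ck_on k d U (partial_deriv l f))"
  by (simp add: subtopology_Euclidean_space_eq partial_deriv_def DERIV_deriv_iff_real_differentiable)

declare Ck_on.simps [simp del]

lemma Ck_on_imp_continuous: "U \<subseteq> R_pow d \<Longrightarrow> Ck_on k d U f \<Longrightarrow> continuous_on U f"
  by (cases k) (auto simp: Ck_on_0_iff Ck_on_Suc_iff)

lemma Ck_on_Suc_imp: "U \<subseteq> R_pow d \<Longrightarrow> Ck_on (Suc k) d U f \<Longrightarrow> Ck_on k d U f"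
proof (induction k arbitrary: f)
  case (Suc k)
  then show ?case by (subst Ck_on_Suc_iff) (auto simp: Ck_on_Suc_iff[of U d "Suc k"])
qed (auto simp: Ck_on_0_iff Ck_on_Suc_iff)

lemma Ck_on_mono: "U \<subseteq> R_pow d \<Longrightarrow> Ck_on k d U f \<Longrightarrow> j \<le> k \<Longrightarrow> Ck_on j d U f"
  by (induction k) (auto simp: le_Suc_eq dest: Ck_on_Suc_imp)

lemma Ck_on_subset: "U \<subseteq> R_pow d \<Longrightarrow> Ck_on k d U f \<Longrightarrow> V \<subseteq> U \<Longrightarrow> Ck_on k d V f"
proof (induction k arbitrary: f)
  case 0 then show ?case by (auto simp: Ck_on_0_iff intro: continuous_on_subset)
next
  case (Suc k)
  then have "V \<subseteq> R_pow d" by blast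
  with Suc show ?case by (auto simp: Ck_on_Suc_iff intro: continuous_on_subset)
qed

lemma Ck_on_cong:
  assumes U: "openin (Euclidean_space d) U" and eq: "\<And>x. x \<in> U \<Longrightarrow> f x = g x" and f: "Ck_on k d U f"
  shows "Ck_on k d U g"
  using eq f
proof (induction k arbitrary: f g)
  case 0 then show ?case
    by (auto simp: Ck_on_0_iff openin_Euclidean_subset[OF U] cong: continuous_on_cong_simp)
next
  case (Suc k)
  note [simp] = Ck_on_Suc_iff[OF openin_Euclidean_subset[OF U]]
  have f: "continuous_on U f" "\<And>l x. l < d \<Longrightarrow> x \<in> U \<Longrightarrow> ((\<lambda>t. f (x(l := t))) has_real_derivative partial_deriv l f x) (at (x l))"
      "\<And>l. l < d \<Longrightarrow> Ck_on k d U (partial_deriv l f)"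
    using Suc.prems(2) by auto
  have p: "partial_deriv l f x = partial_deriv l g x" if "l < d" "x \<in> U" for l x
    using partial_deriv_cong[OF U that(2,1) Suc.prems(1)] .
  show ?case
  proof (simp, intro conjI allI impI ballI)
    show "continuous_on U g" using f(1) Suc.prems(1) by (simp cong: continuous_on_cong_simp)
    fix l assume l: "l < d"
    show "Ck_on k d U (partial_deriv l g)"
      by (rule Suc.IH[OF p[OF l] f(3)[OF l]])
    fix x assume x: "x \<in> U"
    have "\<forall>\<^sub>F t in nhds (x l). f (x(l := t)) = g (x(l := t))"
      using eventually_fun_upd_in_open[OF U x l] by eventually_elim (rule Suc.prems(1))
    then have "((\<lambda>t. g (x(l := t))) has_real_derivative partial_deriv l f x) (at (x l))"
      using f(2)[OF l x] by (rule DERIV_cong_ev[OF refl _ refl, THEN iffD1])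
    then show "((\<lambda>t. g (x(l := t))) has_real_derivative partial_deriv l g x) (at (x l))"
      using p[OF l x] by simp
  qed
qed

lemma continuous_on_local:
  assumes U: "U \<subseteq> R_pow d"
    and loc: "\<And>x. x \<in> U \<Longrightarrow> \<exists>V. openin (Euclidean_space d) V \<and> x \<in> V \<and> V \<subseteq> U \<and> continuous_on V f"
  shows "continuous_on U f"
  unfolding continuous_on_eq_continuous_within
proof
  fix x assume x: "x \<in> U"
  then obtain V where V: "openin (Euclidean_space d) V" "x \<in> V" "V \<subseteq> U" "continuous_on V f"
    using loc by blast
  obtain W where W: "open W" "V = R_pow d \<inter> W"
    using V(1) by (auto simp: openin_Euclidean_space_iff openin_open)
  have "at x within U = at x within V"
    by (rule at_within_nhd[where S = W]) (use V W U x in auto)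
  then show "continuous (at x within U) f"
    using V(2,4) by (simp add: continuous_on_eq_continuous_within)
qed

text \<open>
  Smoothness of a map into a manifold can be tested only in charts, hence only near each point; this
  lemma assembles the local information.
\<close>

lemma Ck_on_local:
  assumes U: "U \<subseteq> R_pow d"
    and loc: "\<And>x. x \<in> U \<Longrightarrow> \<exists>V. openin (Euclidean_space d) V \<and> x \<in> V \<and> V \<subseteq> U \<and> Ck_on k d V f"
  shows "Ck_on k d U f"
  using loc
proof (induction k arbitrary: f)
  case 0
  then show ?case
    by (simp add: Ck_on_0_iff U) (metis Ck_on_0_iff continuous_on_local U openin_Euclidean_subset)
next
  case (Suc k)
  have "\<exists>V. openin (Euclidean_space d) V \<and> x \<in> V \<and> V \<subseteq> U \<and> continuous_on V f" if "x \<in> U" for x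
    using Suc.prems[OF that] Ck_on_imp_continuous openin_Euclidean_subset by meson
  then have C: "continuous_on U f" by (rule continuous_on_local[OF U])
  have D: "((\<lambda>t. f (x(l := t))) has_real_derivative partial_deriv l f x) (at (x l))" if l: "l < d" and x: "x \<in> U" for l x
  proof -
    from Suc.prems[OF x] obtain V where V: "openin (Euclidean_space d) V" "x \<in> V" "Ck_on (Suc k) d V f"
      by blast
    from V(3) show ?thesis
      using V(2) l by (simp add: Ck_on_Suc_iff[OF openin_Euclidean_subset[OF V(1)]])
  qed
  have E: "Ck_on k d U (partial_deriv l f)" if l: "l < d" for l
  proof (rule Suc.IH)
    fix x assume "x \<in> U"
    from Suc.prems[OF this] obtain V where V: "openin (Euclidean_space d) V" "x \<in> V" "V \<subseteq> U" "Ck_on (Suc k) d V f"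
      by blast
    from V(4) have "Ck_on k d V (partial_deriv l f)"
      using l by (simp add: Ck_on_Suc_iff[OF openin_Euclidean_subset[OF V(1)]])
    with V show "\<exists>V. openin (Euclidean_space d) V \<and> x \<in> V \<and> V \<subseteq> U \<and> Ck_on k d V (partial_deriv l f)" by blast
  qed
  show ?case
    using C D E by (simp add: Ck_on_Suc_iff U)
qed

section \<open>Total derivatives and the chain rule\<close>

text \<open>
  Continuity of the partial derivatives turns them into a total derivative. Moving from \<open>x\<close> to \<open>y\<close>
  along the coordinate axes, the mean value inequality controls each of the \<open>d\<close> increments.
\<close>

lemma C1_first_order_approximation:
  assumes U: "openin (Euclidean_space d) U" and f: "Ck_on (Suc 0) d U f" and x: "x \<in> U" and e: "0 < e"
  obtains r where "r > 0"
    "\<And>y. y \<in> R_pow d \<Longrightarrow> (\<And>l. l < d \<Longrightarrow> \<bar>y l - x l\<bar> < r) \<Longrightarrow>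
       \<bar>f y - f x - (\<Sum>l<d. partial_deriv l f x * (y l - x l))\<bar> \<le> e * (\<Sum>l<d. \<bar>y l - x l\<bar>)"
proof -
  note UR = openin_Euclidean_subset[OF U]
  have xR: "x \<in> R_pow d" using x UR by blast
  have der: "((\<lambda>t. f (z(l := t))) has_real_derivative partial_deriv l f z) (at (z l))"
    and cont: "continuous_on U (partial_deriv l f)" if "l < d" "z \<in> U" for l z
    using f that by (auto simp: Ck_on_Suc_iff[OF UR] Ck_on_0_iff[OF UR])
  obtain r0 where r0: "r0 > 0" "\<And>y. y \<in> R_pow d \<Longrightarrow> (\<And>l. l < d \<Longrightarrow> \<bar>y l - x l\<bar> < r0) \<Longrightarrow> y \<in> U"
    using openin_Euclidean_box[OF U x] by blast
  have "\<exists>r>0. \<forall>y. y \<in> R_pow d \<longrightarrow> (\<forall>j<d. \<bar>y j - x j\<bar> < r) \<longrightarrow> \<bar>partial_deriv l f y - partial_deriv l f x\<bar> < e"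
    if "l < d" for l
    using continuous_on_box[OF U x cont[OF that x] e] by metis
  then obtain R where R: "\<And>l. l < d \<Longrightarrow> R l > 0"
    "\<And>l y. l < d \<Longrightarrow> y \<in> R_pow d \<Longrightarrow> (\<And>j. j < d \<Longrightarrow> \<bar>y j - x j\<bar> < R l) \<Longrightarrow> \<bar>partial_deriv l f y - partial_deriv l f x\<bar> < e"
    by metis
  define r where "r = Min (insert r0 (R ` {..<d}))"
  have rle: "r \<le> r0" "\<And>l. l < d \<Longrightarrow> r \<le> R l" by (auto simp: r_def)
  show thesis
  proof
    show "r > 0" using r0(1) R(1) by (auto simp: r_def)
    fix y assume yR: "y \<in> R_pow d" and y: "\<And>l. l < d \<Longrightarrow> \<bar>y l - x l\<bar> < r"
    \<comment> \<open>pass from \<open>x\<close> to \<open>y\<close> by replacing one coordinate at a time\<close>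
    define z where "z = (\<lambda>j i. if i < j then y i else x i)"
    have z0: "z 0 = x" by (simp add: z_def)
    have zd: "z d = y" using xR yR by (auto simp: z_def R_pow_iff fun_eq_iff)
    have step: "\<bar>f (z (Suc l)) - f (z l) - partial_deriv l f x * (y l - x l)\<bar> \<le> e * \<bar>y l - x l\<bar>" if l: "l < d" for l
    proof -
      define S where "S = closed_segment (x l) (y l)"
      have zu: "(z l)(l := s) \<in> U" "\<bar>partial_deriv l f ((z l)(l := s)) - partial_deriv l f x\<bar> < e" if s: "s \<in> S" for s
      proof -
        have "\<bar>s - x l\<bar> \<le> \<bar>y l - x l\<bar>"
          using s by (auto simp: S_def closed_segment_eq_real_ivl split: if_splits)
        then have b: "\<bar>((z l)(l := s)) j - x j\<bar> < r" if "j < d" for j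
          using y[of j] y[of l] that l r0 R \<open>r > 0\<close> by (auto simp: z_def)
        have zR: "(z l)(l := s) \<in> R_pow d"
          using xR yR l by (auto simp: z_def R_pow_iff)
        show "(z l)(l := s) \<in> U"
          by (rule r0(2)[OF zR]) (use b rle(1) in force)
        show "\<bar>partial_deriv l f ((z l)(l := s)) - partial_deriv l f x\<bar> < e"
          by (rule R(2)[OF l zR]) (use b rle(2)[OF l] in force)
      qed
      define h where "h = (\<lambda>s. f ((z l)(l := s)) - partial_deriv l f x * s)"
      have "norm (h (y l) - h (x l)) \<le> e * norm (y l - x l)"
      proof (rule field_differentiable_bound[where S = S])
        show "convex S" by (simp add: S_def)
        show "(h has_field_derivative partial_deriv l f ((z l)(l := s)) - partial_deriv l f x) (at s within S)" if "s \<in> S" for s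
        proof -
          have "((\<lambda>t. f ((z l)(l := t))) has_real_derivative partial_deriv l f ((z l)(l := s))) (at s)"
            using der[OF l zu(1)[OF that]] by simp
          from DERIV_diff[OF this DERIV_cmult[OF DERIV_ident]]
          show ?thesis unfolding h_def by (auto intro: has_field_derivative_at_within)
        qed
        show "norm (partial_deriv l f ((z l)(l := s)) - partial_deriv l f x) \<le> e" if "s \<in> S" for s
          using zu(2)[OF that] by simp
      qed (auto simp: S_def)
      moreover have "(z l)(l := y l) = z (Suc l)" "(z l)(l := x l) = z l"
        by (auto simp: z_def fun_eq_iff less_Suc_eq)
      ultimately show ?thesis by (simp add: h_def algebra_simps)
    qed
    have "f y - f x = (\<Sum>l<d. f (z (Suc l)) - f (z l))"
      by (subst sum_lessThan_telescope) (simp add: z0 zd)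
    then have "\<bar>f y - f x - (\<Sum>l<d. partial_deriv l f x * (y l - x l))\<bar>
        = \<bar>\<Sum>l<d. f (z (Suc l)) - f (z l) - partial_deriv l f x * (y l - x l)\<bar>"
      by (simp add: sum_subtractf)
    also have "\<dots> \<le> (\<Sum>l<d. e * \<bar>y l - x l\<bar>)"
      by (rule order_trans[OF sum_abs sum_mono]) (use step in auto)
    finally show "\<bar>f y - f x - (\<Sum>l<d. partial_deriv l f x * (y l - x l))\<bar> \<le> e * (\<Sum>l<d. \<bar>y l - x l\<bar>)"
      by (simp add: sum_distrib_left)
  qed
qed

text \<open>
  All derivatives in the definitions are derivatives along lines, so the chain rule is needed only
  for paths.
\<close>

lemma C1_chain_rule:
  assumes U: "openin (Euclidean_space d) U" and f: "Ck_on (Suc 0) d U f" and x: "\<gamma> s0 \<in> U"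
    and R: "\<forall>\<^sub>F s in nhds s0. \<gamma> s \<in> R_pow d"
    and g: "\<And>l. l < d \<Longrightarrow> ((\<lambda>s. \<gamma> s l) has_real_derivative D l) (at s0)"
  shows "((\<lambda>s. f (\<gamma> s)) has_real_derivative dir_deriv d f (\<gamma> s0) D) (at s0)"
proof -
  let ?q = "\<lambda>l s. (\<gamma> s l - \<gamma> s0 l) / (s - s0)"
  have q: "?q l \<midarrow>s0\<rightarrow> D l" if "l < d" for l
    using g[OF that] by (simp add: has_field_derivative_iff)
  let ?E = "\<lambda>s. (f (\<gamma> s) - f (\<gamma> s0) - (\<Sum>l<d. partial_deriv l f (\<gamma> s0) * (\<gamma> s l - \<gamma> s0 l))) / (s - s0)"
  have E: "(?E \<longlongrightarrow> 0) (at s0)"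
  proof (rule tendstoI)
    fix e :: real assume e: "0 < e"
    define B where "B = (\<Sum>l<d. \<bar>D l\<bar> + 1)"
    have B: "B \<ge> 0" by (simp add: B_def sum_nonneg)
    define e' where "e' = e / (B + 1)"
    have e': "e' > 0" using e B by (simp add: e'_def)
    obtain r where r: "r > 0"
      "\<And>y. y \<in> R_pow d \<Longrightarrow> (\<And>l. l < d \<Longrightarrow> \<bar>y l - \<gamma> s0 l\<bar> < r) \<Longrightarrow>
       \<bar>f y - f (\<gamma> s0) - (\<Sum>l<d. partial_deriv l f (\<gamma> s0) * (y l - \<gamma> s0 l))\<bar> \<le> e' * (\<Sum>l<d. \<bar>y l - \<gamma> s0 l\<bar>)"
      using C1_first_order_approximation[OF U f x e'] by blast
    have "\<forall>\<^sub>F s in at s0. \<forall>l\<in>{..<d}. \<bar>?q l s\<bar> < \<bar>D l\<bar> + 1 \<and> \<bar>\<gamma> s l - \<gamma> s0 l\<bar> < r"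
      unfolding eventually_ball_finite_distrib[OF finite_lessThan]
    proof (intro ballI eventually_conj)
      fix l assume "l \<in> {..<d}" then have l: "l < d" by simp
      show "\<forall>\<^sub>F s in at s0. \<bar>?q l s\<bar> < \<bar>D l\<bar> + 1"
        using tendsto_rabs[OF q[OF l]] by (rule order_tendstoD) simp
      have "(\<lambda>s. \<gamma> s l) \<midarrow>s0\<rightarrow> \<gamma> s0 l"
        using g[OF l] DERIV_isCont isCont_def by blast
      from tendstoD[OF this r(1)] show "\<forall>\<^sub>F s in at s0. \<bar>\<gamma> s l - \<gamma> s0 l\<bar> < r"
        by (simp add: dist_real_def)
    qed
    moreover have "\<forall>\<^sub>F s in at s0. \<gamma> s \<in> R_pow d"
      using R by (simp add: eventually_nhds_conv_at)
    moreover have "\<forall>\<^sub>F s in at s0. s \<noteq> s0"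
      by (simp add: eventually_at_filter)
    ultimately show "\<forall>\<^sub>F s in at s0. dist (?E s) 0 < e"
    proof eventually_elim
      case (elim s)
      let ?N = "f (\<gamma> s) - f (\<gamma> s0) - (\<Sum>l<d. partial_deriv l f (\<gamma> s0) * (\<gamma> s l - \<gamma> s0 l))"
      have "\<bar>?N\<bar> \<le> e' * (\<Sum>l<d. \<bar>\<gamma> s l - \<gamma> s0 l\<bar>)"
        by (rule r(2)) (use elim in auto)
      also have "\<dots> = e' * ((\<Sum>l<d. \<bar>?q l s\<bar>) * \<bar>s - s0\<bar>)"
        using elim(3) by (simp add: sum_distrib_right abs_divide)
      also have "\<dots> \<le> e' * (B * \<bar>s - s0\<bar>)"
        unfolding B_def using e' elim(1) by (intro mult_left_mono mult_right_mono sum_mono) force+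
      finally have "\<bar>?N\<bar> / \<bar>s - s0\<bar> \<le> e' * B"
        using elim(3) by (simp add: field_simps)
      also have "\<dots> < e"
        using e B by (simp add: e'_def field_simps)
      finally show ?case by (simp add: abs_divide)
    qed
  qed
  have L: "((\<lambda>s. \<Sum>l<d. partial_deriv l f (\<gamma> s0) * ?q l s) \<longlongrightarrow> (\<Sum>l<d. partial_deriv l f (\<gamma> s0) * D l)) (at s0)"
    by (intro tendsto_sum tendsto_mult tendsto_const) (use q in auto)
  have "((\<lambda>s. ?E s + (\<Sum>l<d. partial_deriv l f (\<gamma> s0) * ?q l s)) \<longlongrightarrow> dir_deriv d f (\<gamma> s0) D) (at s0)"
    using tendsto_add[OF E L] by (simp add: dir_deriv_def mult.commute)
  moreover have "?E s + (\<Sum>l<d. partial_deriv l f (\<gamma> s0) * ?q l s) = (f (\<gamma> s) - f (\<gamma> s0)) / (s - s0)" for s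
  proof -
    have "(\<Sum>l<d. partial_deriv l f (\<gamma> s0) * ?q l s) = (\<Sum>l<d. partial_deriv l f (\<gamma> s0) * (\<gamma> s l - \<gamma> s0 l)) / (s - s0)"
      by (simp add: sum_divide_distrib)
    then show ?thesis by (simp add: diff_divide_distrib)
  qed
  ultimately show ?thesis
    by (simp add: has_field_derivative_iff)
qed

section \<open>Closure properties of smooth functions\<close>

lemma partial_deriv_const [simp]: "partial_deriv l (\<lambda>x. c) = (\<lambda>x. 0)"
  by (auto simp: partial_deriv_def fun_eq_iff)

lemma partial_deriv_coord [simp]: "partial_deriv l (\<lambda>x. x j) = (\<lambda>x. if j = l then 1 else 0)"
  by (auto simp: partial_deriv_def)

lemma Ck_on_const: "U \<subseteq> R_pow d \<Longrightarrow> Ck_on k d U (\<lambda>x. c)"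
  by (induction k arbitrary: c) (auto simp: Ck_on_0_iff Ck_on_Suc_iff)

lemma Ck_on_coord: 
  assumes "U \<subseteq> R_pow d" shows "Ck_on k d U (\<lambda>x. x j)"
proof -
  have c: "continuous_on U (\<lambda>x. x j :: real)"
    using continuous_on_product_coordinates by (rule continuous_on_subset) simp
  show ?thesis
  proof (cases k)
    case (Suc k')
    have "((\<lambda>t. (x(l := t)) j) has_real_derivative (if j = l then 1 else 0)) (at (x l))" for x :: "nat \<Rightarrow> real" and l
      by (cases "j = l") (auto intro!: derivative_eq_intros)
    then show ?thesis using c assms by (simp add: Suc Ck_on_Suc_iff Ck_on_const)
  qed (use c assms in \<open>simp add: Ck_on_0_iff\<close>)
qed

lemma Ck_on_add:
  assumes U: "openin (Euclidean_space d) U"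
  shows "Ck_on k d U f \<Longrightarrow> Ck_on k d U g \<Longrightarrow> Ck_on k d U (\<lambda>x. f x + g x)"
proof (induction k arbitrary: f g)
  case 0 then show ?case
    using openin_Euclidean_subset[OF U] by (auto simp: Ck_on_0_iff intro!: continuous_intros)
next
  case (Suc k)
  note [simp] = Ck_on_Suc_iff[OF openin_Euclidean_subset[OF U]]
  have der: "((\<lambda>t. f (x(l := t)) + g (x(l := t))) has_real_derivative partial_deriv l f x + partial_deriv l g x) (at (x l))"
    if "l < d" "x \<in> U" for l x
    using Suc.prems that by (auto intro!: derivative_intros)
  have p: "partial_deriv l f x + partial_deriv l g x = partial_deriv l (\<lambda>x. f x + g x) x" if "l < d" "x \<in> U" for l x
    using partial_deriv_eqI[OF der[OF that]] by simp
  have "Ck_on k d U (partial_deriv l (\<lambda>x. f x + g x))" if "l < d" for l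
    by (rule Ck_on_cong[OF U p[OF that]]) (use Suc that in auto)
  with Suc.prems der p show ?case by (auto intro!: continuous_intros)
qed

lemma Ck_on_mult:
  assumes U: "openin (Euclidean_space d) U"
  shows "Ck_on k d U f \<Longrightarrow> Ck_on k d U g \<Longrightarrow> Ck_on k d U (\<lambda>x. f x * g x)"
proof (induction k arbitrary: f g)
  case 0 then show ?case
    using openin_Euclidean_subset[OF U] by (auto simp: Ck_on_0_iff intro!: continuous_intros)
next
  case (Suc k)
  note UR = openin_Euclidean_subset[OF U]
  note S = Ck_on_Suc_iff[OF UR]
  have lower: "Ck_on k d U f" "Ck_on k d U g" using Suc.prems Ck_on_Suc_imp[OF UR] by blast+
  have der: "((\<lambda>t. f (x(l := t)) * g (x(l := t))) has_real_derivative
      partial_deriv l f x * g x + partial_deriv l g x * f x) (at (x l))"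
    if "l < d" "x \<in> U" for l x
    using DERIV_mult[of "\<lambda>t. f (x(l := t))" _ "x l" UNIV "\<lambda>t. g (x(l := t))"] Suc.prems that by (simp add: S)
  have p: "partial_deriv l f x * g x + partial_deriv l g x * f x = partial_deriv l (\<lambda>x. f x * g x) x" if "l < d" "x \<in> U" for l x
    using partial_deriv_eqI[OF der[OF that]] by simp
  have "Ck_on k d U (partial_deriv l (\<lambda>x. f x * g x))" if "l < d" for l
    by (rule Ck_on_cong[OF U p[OF that]], assumption, rule Ck_on_add[OF U])
       (use Suc lower that in \<open>auto simp: S intro!: Suc.IH\<close>)
  with Suc.prems der p show ?case by (auto simp: S intro!: continuous_intros)
qed

lemma Ck_on_sum:
  assumes U: "openin (Euclidean_space d) U"
  shows "(\<And>i. i \<in> I \<Longrightarrow> Ck_on k d U (f i)) \<Longrightarrow> Ck_on k d U (\<lambda>x. \<Sum>i\<in>I. f i x)"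
  by (induction I rule: infinite_finite_induct)
     (auto intro: Ck_on_const[OF openin_Euclidean_subset[OF U]] Ck_on_add[OF U])

lemma Ck_on_prod:
  assumes U: "openin (Euclidean_space d) U"
  shows "(\<And>i. i \<in> I \<Longrightarrow> Ck_on k d U (f i)) \<Longrightarrow> Ck_on k d U (\<lambda>x. \<Prod>i\<in>I. f i x)"
  by (induction I rule: infinite_finite_induct)
     (auto intro: Ck_on_const[OF openin_Euclidean_subset[OF U]] Ck_on_mult[OF U])

lemma has_partial_deriv_compose:
  assumes U: "openin (Euclidean_space d) U" and V: "openin (Euclidean_space m) V"
    and f: "Ck_on (Suc 0) m V f" and g: "\<And>j. j < m \<Longrightarrow> Ck_on (Suc 0) d U (\<lambda>x. g x j)"
    and gV: "\<And>x. x \<in> U \<Longrightarrow> g x \<in> V" and l: "l < d" and x: "x \<in> U"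
  shows "((\<lambda>t. f (g (x(l := t)))) has_real_derivative
      (\<Sum>j<m. partial_deriv l (\<lambda>x. g x j) x * partial_deriv j f (g x))) (at (x l))"
proof -
  have "((\<lambda>t. f (g (x(l := t)))) has_real_derivative
      dir_deriv m f (g (x(l := x l))) (\<lambda>j. partial_deriv l (\<lambda>x. g x j) x)) (at (x l))"
  proof (rule C1_chain_rule[OF V f])
    show "\<forall>\<^sub>F s in nhds (x l). g (x(l := s)) \<in> R_pow m"
      using eventually_fun_upd_in_open[OF U x l]
      by eventually_elim (use gV openin_Euclidean_subset[OF V] in blast)
    show "((\<lambda>s. g (x(l := s)) j) has_real_derivative partial_deriv l (\<lambda>x. g x j) x) (at (x l))" if "j < m" for j
      using g[OF that] l x by (simp add: Ck_on_Suc_iff openin_Euclidean_subset[OF U])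
  qed (use gV x in auto)
  then show ?thesis by (simp add: dir_deriv_def)
qed

text \<open>
  Induction on \<open>k\<close>: by the chain rule, the partial derivatives of the composite are sums of products
  of functions to which the induction hypothesis applies.
\<close>

lemma Ck_on_compose:
  assumes U: "openin (Euclidean_space d) U" and V: "openin (Euclidean_space m) V"
    and f: "Ck_on k m V f" and g: "\<And>j. j < m \<Longrightarrow> Ck_on k d U (\<lambda>x. g x j)"
    and gV: "\<And>x. x \<in> U \<Longrightarrow> g x \<in> V"
  shows "Ck_on k d U (\<lambda>x. f (g x))"
  using f g
proof (induction k arbitrary: f)
  note UR = openin_Euclidean_subset[OF U] and VR = openin_Euclidean_subset[OF V]
  have cont: "continuous_on U (\<lambda>x. f (g x))"
    if "continuous_on V f" "\<And>j. j < m \<Longrightarrow> continuous_on U (\<lambda>x. g x j)" for f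
  proof (rule continuous_on_compose2[OF that(1)])
    show "continuous_on U g"
    proof (rule continuous_on_coordinatewise_then_product)
      fix j show "continuous_on U (\<lambda>x. g x j)"
      proof (cases "j < m")
        case False
        then have "g x j = 0" if "x \<in> U" for x using gV[OF that] VR by (auto simp: R_pow_iff)
        then show ?thesis by (simp cong: continuous_on_cong_simp)
      qed (use that in auto)
    qed
  qed (use gV in auto)
  {
    case 0
    show ?case using cont[of f] 0 by (simp add: Ck_on_0_iff UR VR)
  next
    case (Suc k)
    have f1: "Ck_on (Suc 0) m V f" using Suc.prems(1) by (rule Ck_on_mono[OF VR]) simp
    have g1: "Ck_on (Suc 0) d U (\<lambda>x. g x j)" if "j < m" for j
      using Suc.prems(2)[OF that] by (rule Ck_on_mono[OF UR]) simp
    note der = has_partial_deriv_compose[OF U V f1 g1 gV]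
    have p: "(\<Sum>j<m. partial_deriv l (\<lambda>x. g x j) x * partial_deriv j f (g x)) = partial_deriv l (\<lambda>x. f (g x)) x"
      if "l < d" "x \<in> U" for l x
      using partial_deriv_eqI[OF der[OF _ _ that]] by simp
    have lower: "Ck_on k d U (\<lambda>x. g x j)" if "j < m" for j
      by (rule Ck_on_Suc_imp[OF UR Suc.prems(2)[OF that]])
    have "Ck_on k d U (partial_deriv l (\<lambda>x. f (g x)))" if "l < d" for l
    proof (rule Ck_on_cong[OF U p[OF that]], assumption, rule Ck_on_sum[OF U], rule Ck_on_mult[OF U])
      fix j assume "j \<in> {..<m}"
      then have j: "j < m" by simp
      show "Ck_on k d U (partial_deriv l (\<lambda>x. g x j))"
        using Suc.prems(2)[OF j] that by (simp add: Ck_on_Suc_iff UR)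
      show "Ck_on k d U (\<lambda>x. partial_deriv j f (g x))"
        by (rule Suc.IH[OF _ lower]) (use Suc.prems(1) j in \<open>auto simp: Ck_on_Suc_iff VR\<close>)
    qed
    moreover have "continuous_on U (\<lambda>x. f (g x))"
      by (rule cont) (use Suc.prems Ck_on_imp_continuous UR VR in blast)+
    ultimately show ?case
      using der p by (simp add: Ck_on_Suc_iff UR)
  }
qed

lemma dir_deriv_compose:
  assumes U: "openin (Euclidean_space d) U" and V: "openin (Euclidean_space m) V"
    and f: "Ck_on (Suc 0) m V f" and g: "\<And>j. j < m \<Longrightarrow> Ck_on (Suc 0) d U (\<lambda>x. g x j)"
    and gV: "\<And>x. x \<in> U \<Longrightarrow> g x \<in> V" and x: "x \<in> U"
  shows "dir_deriv d (\<lambda>x. f (g x)) x w = dir_deriv m f (g x) (differential d g x w)"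
proof -
  have "dir_deriv d (\<lambda>x. f (g x)) x w
      = (\<Sum>l<d. w l * (\<Sum>j<m. partial_deriv l (\<lambda>x. g x j) x * partial_deriv j f (g x)))"
    unfolding dir_deriv_def
    by (intro sum.cong refl) (simp add: partial_deriv_eqI[OF has_partial_deriv_compose[OF U V f g gV _ x]])
  also have "\<dots> = (\<Sum>j<m. \<Sum>l<d. w l * (partial_deriv l (\<lambda>x. g x j) x * partial_deriv j f (g x)))"
    by (subst sum.swap) (simp add: sum_distrib_left)
  also have "\<dots> = dir_deriv m f (g x) (differential d g x w)"
    by (simp add: dir_deriv_def differential_def sum_distrib_right mult.assoc)
  finally show ?thesis .
qed

section \<open>Symmetry of second derivatives\<close>

lemma partial_deriv_commute:
  assumes U: "openin (Euclidean_space d) U" and f: "Ck_on (Suc (Suc 0)) d U f"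
    and i: "i < d" and j: "j < d" and x: "x \<in> U"
  shows "partial_deriv i (partial_deriv j f) x = partial_deriv j (partial_deriv i f) x"
proof (cases "i = j")
  case False
  note UR = openin_Euclidean_subset[OF U]
  have xR: "x \<in> R_pow d" using x UR by blast
  \<comment> \<open>the second difference over a small square is a mixed derivative at a nearby point,
     in either order of differentiation\<close>
  define Q where "Q = (\<lambda>h. f (x(i := x i + h, j := x j + h)) - f (x(i := x i + h, j := x j))
      - f (x(i := x i, j := x j + h)) + f (x(i := x i, j := x j)))"
  have diffQ: "\<exists>\<xi>. \<xi> \<in> R_pow d \<and> (\<forall>l<d. \<bar>\<xi> l - x l\<bar> < r) \<and>
      f (x(p := x p + h, q := x q + h)) - f (x(p := x p + h, q := x q))
      - f (x(p := x p, q := x q + h)) + f (x(p := x p, q := x q)) = h * h * partial_deriv q (partial_deriv p f) \<xi>"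
    if pq: "p < d" "q < d" "p \<noteq> q" and h: "0 < h" "h < r" 
      and r: "\<And>y. y \<in> R_pow d \<Longrightarrow> (\<And>l. l < d \<Longrightarrow> \<bar>y l - x l\<bar> < r) \<Longrightarrow> y \<in> U" for p q h r
  proof -
    have inU: "x(p := u, q := v) \<in> U" if "x p \<le> u" "u \<le> x p + h" "x q \<le> v" "v \<le> x q + h" for u v
      by (rule r) (use that h pq xR in \<open>auto simp: R_pow_iff\<close>)
    have d1: "((\<lambda>u. f (x(p := u, q := v))) has_real_derivative partial_deriv p f (x(p := u, q := v))) (at u)"
      if "x(p := u, q := v) \<in> U" for u v
    proof -
      have "((\<lambda>t. f ((x(p := u, q := v))(p := t))) has_real_derivative partial_deriv p f (x(p := u, q := v))) (at ((x(p := u, q := v)) p))"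
        using f that pq unfolding Ck_on_Suc_iff[OF UR] by blast
      moreover have "(\<lambda>t. f ((x(p := u, q := v))(p := t))) = (\<lambda>t. f (x(p := t, q := v)))"
        by (intro ext arg_cong[where f = f]) (use pq in \<open>auto simp: fun_eq_iff\<close>)
      moreover have "(x(p := u, q := v)) p = u" using pq by simp
      ultimately show ?thesis by (simp only:)
    qed
    have d2: "((\<lambda>v. partial_deriv p f (x(p := u, q := v))) has_real_derivative partial_deriv q (partial_deriv p f) (x(p := u, q := v))) (at v)"
      if "x(p := u, q := v) \<in> U" for u v
    proof -
      have "((\<lambda>t. partial_deriv p f ((x(p := u, q := v))(q := t))) has_real_derivative partial_deriv q (partial_deriv p f) (x(p := u, q := v))) (at ((x(p := u, q := v)) q))"
        using f that pq unfolding Ck_on_Suc_iff[OF UR] by blast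
      then show ?thesis by simp
    qed
    let ?\<phi> = "\<lambda>u. f (x(p := u, q := x q + h)) - f (x(p := u, q := x q))"
    have "\<exists>u>x p. u < x p + h \<and> ?\<phi> (x p + h) - ?\<phi> (x p) = (x p + h - x p) *
        (partial_deriv p f (x(p := u, q := x q + h)) - partial_deriv p f (x(p := u, q := x q)))"
      using h by (intro MVT2 DERIV_diff d1 inU) linarith+
    then obtain u where u: "x p < u" "u < x p + h" "?\<phi> (x p + h) - ?\<phi> (x p) = h *
        (partial_deriv p f (x(p := u, q := x q + h)) - partial_deriv p f (x(p := u, q := x q)))" by auto
    have "\<exists>v>x q. v < x q + h \<and> partial_deriv p f (x(p := u, q := x q + h)) - partial_deriv p f (x(p := u, q := x q))
        = (x q + h - x q) * partial_deriv q (partial_deriv p f) (x(p := u, q := v))"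
      using h u by (intro MVT2 d2 inU) linarith+
    then obtain v where v: "x q < v" "v < x q + h" 
        "partial_deriv p f (x(p := u, q := x q + h)) - partial_deriv p f (x(p := u, q := x q))
        = h * partial_deriv q (partial_deriv p f) (x(p := u, q := v))" by auto
    show ?thesis
    proof (intro exI conjI)
      show "x(p := u, q := v) \<in> R_pow d" using inU[of u v] u v UR by auto
      show "\<forall>l<d. \<bar>(x(p := u, q := v)) l - x l\<bar> < r" using u v h by auto
    qed (use u(3) v(3) in simp)
  qed
  have cont: "continuous_on U (partial_deriv i (partial_deriv j f))" "continuous_on U (partial_deriv j (partial_deriv i f))"
    using f i j unfolding Ck_on_Suc_iff[OF UR] Ck_on_0_iff[OF UR] by blast+
  have "\<bar>partial_deriv i (partial_deriv j f) x - partial_deriv j (partial_deriv i f) x\<bar> \<le> 0 + e" if e: "e > 0" for e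
  proof -
    have e2: "e / 2 > 0" using e by simp
    obtain r1 where r1: "r1 > 0" "\<And>y. y \<in> R_pow d \<Longrightarrow> (\<And>l. l < d \<Longrightarrow> \<bar>y l - x l\<bar> < r1) \<Longrightarrow>
        y \<in> U \<and> \<bar>partial_deriv i (partial_deriv j f) y - partial_deriv i (partial_deriv j f) x\<bar> < e / 2"
      using continuous_on_box[OF U x cont(1) e2] by blast
    obtain r2 where r2: "r2 > 0" "\<And>y. y \<in> R_pow d \<Longrightarrow> (\<And>l. l < d \<Longrightarrow> \<bar>y l - x l\<bar> < r2) \<Longrightarrow>
        y \<in> U \<and> \<bar>partial_deriv j (partial_deriv i f) y - partial_deriv j (partial_deriv i f) x\<bar> < e / 2"
      using continuous_on_box[OF U x cont(2) e2] by blast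
    define r where "r = min r1 r2"
    define h where "h = r / 2"
    have h: "0 < h" "h < r" using r1(1) r2(1) by (auto simp: h_def r_def)
    have rU: "\<And>y. y \<in> R_pow d \<Longrightarrow> (\<And>l. l < d \<Longrightarrow> \<bar>y l - x l\<bar> < r) \<Longrightarrow> y \<in> U"
      using r1(2) by (simp add: r_def)
    obtain \<xi> where \<xi>: "\<xi> \<in> R_pow d" "\<forall>l<d. \<bar>\<xi> l - x l\<bar> < r" "Q h = h * h * partial_deriv j (partial_deriv i f) \<xi>"
      using diffQ[OF i j False h rU] unfolding Q_def by blast
    obtain \<zeta> where \<zeta>: "\<zeta> \<in> R_pow d" "\<forall>l<d. \<bar>\<zeta> l - x l\<bar> < r" "Q h = h * h * partial_deriv i (partial_deriv j f) \<zeta>"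
    proof -
      have "Q h = f (x(j := x j + h, i := x i + h)) - f (x(j := x j + h, i := x i))
          - f (x(j := x j, i := x i + h)) + f (x(j := x j, i := x i))"
        using False by (simp add: Q_def fun_upd_twist)
      then show ?thesis using diffQ[OF j i _ h rU] False that by metis
    qed
    have "partial_deriv j (partial_deriv i f) \<xi> = partial_deriv i (partial_deriv j f) \<zeta>"
      using \<xi>(3) \<zeta>(3) h by simp
    moreover have "\<bar>partial_deriv i (partial_deriv j f) \<zeta> - partial_deriv i (partial_deriv j f) x\<bar> < e / 2"
      using r1(2)[OF \<zeta>(1)] \<zeta>(2) by (simp add: r_def)
    moreover have "\<bar>partial_deriv j (partial_deriv i f) \<xi> - partial_deriv j (partial_deriv i f) x\<bar> < e / 2"
      using r2(2)[OF \<xi>(1)] \<xi>(2) by (simp add: r_def)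
    ultimately show ?thesis by linarith
  qed
  then have "\<bar>partial_deriv i (partial_deriv j f) x - partial_deriv j (partial_deriv i f) x\<bar> \<le> 0"
    by (rule field_le_epsilon)
  then show ?thesis by simp
qed simp

section \<open>Rules for directional derivatives\<close>

lemma Ck_on_partial: "U \<subseteq> R_pow d \<Longrightarrow> Ck_on (Suc k) d U f \<Longrightarrow> l < d \<Longrightarrow> Ck_on k d U (partial_deriv l f)"
  by (simp add: Ck_on_Suc_iff)

lemma Ck_on_dir_deriv:
  assumes U: "openin (Euclidean_space d) U" and f: "Ck_on (Suc k) d U f"
  shows "Ck_on k d U (\<lambda>x. dir_deriv d f x w)"
  unfolding dir_deriv_def
  using Ck_on_partial[OF openin_Euclidean_subset[OF U] f]
  by (intro Ck_on_sum[OF U] Ck_on_mult[OF U] Ck_on_const openin_Euclidean_subset[OF U]) auto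

lemma dir_deriv_cong:
  assumes "openin (Euclidean_space d) U" "x \<in> U" "\<And>y. y \<in> U \<Longrightarrow> f y = g y"
  shows "dir_deriv d f x w = dir_deriv d g x w"
  unfolding dir_deriv_def using partial_deriv_cong[OF assms(1,2) _ assms(3)] by simp

lemma dir_deriv_const [simp]: "dir_deriv d (\<lambda>x. c) x w = 0"
  by (simp add: dir_deriv_def)

lemma dir_deriv_add:
  assumes U: "openin (Euclidean_space d) U" and f: "Ck_on (Suc 0) d U f" "Ck_on (Suc 0) d U g" and x: "x \<in> U"
  shows "dir_deriv d (\<lambda>x. f x + g x) x w = dir_deriv d f x w + dir_deriv d g x w"
proof -
  have "partial_deriv l (\<lambda>x. f x + g x) x = partial_deriv l f x + partial_deriv l g x" if "l < d" for l
    using f x that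
    by (intro partial_deriv_eqI DERIV_add) (auto simp: Ck_on_Suc_iff openin_Euclidean_subset[OF U])
  then show ?thesis
    by (simp add: dir_deriv_def distrib_left sum.distrib)
qed

lemma dir_deriv_mult:
  assumes U: "openin (Euclidean_space d) U" and f: "Ck_on (Suc 0) d U f" "Ck_on (Suc 0) d U g" and x: "x \<in> U"
  shows "dir_deriv d (\<lambda>x. f x * g x) x w = dir_deriv d f x w * g x + f x * dir_deriv d g x w"
proof -
  have "partial_deriv l (\<lambda>x. f x * g x) x = partial_deriv l f x * g x + partial_deriv l g x * f x" if "l < d" for l
    using f x that DERIV_mult[of "\<lambda>t. f (x(l := t))" "partial_deriv l f x" "x l" UNIV "\<lambda>t. g (x(l := t))" "partial_deriv l g x"]
    by (intro partial_deriv_eqI) (auto simp: Ck_on_Suc_iff openin_Euclidean_subset[OF U])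
  then have "dir_deriv d (\<lambda>x. f x * g x) x w = (\<Sum>l<d. w l * partial_deriv l f x * g x + f x * (w l * partial_deriv l g x))"
    unfolding dir_deriv_def by (intro sum.cong refl) (simp add: algebra_simps)
  then show ?thesis
    by (simp add: dir_deriv_def sum.distrib sum_distrib_right sum_distrib_left)
qed

lemma dir_deriv_cmult:
  assumes "openin (Euclidean_space d) U" "Ck_on (Suc 0) d U f" "x \<in> U"
  shows "dir_deriv d (\<lambda>x. c * f x) x w = c * dir_deriv d f x w"
  using dir_deriv_mult[OF assms(1) Ck_on_const assms(2,3)] openin_Euclidean_subset[OF assms(1)] by simp

lemma dir_deriv_sum:
  assumes U: "openin (Euclidean_space d) U" and x: "x \<in> U" and f: "\<And>i. i \<in> I \<Longrightarrow> Ck_on (Suc 0) d U (f i)"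
  shows "dir_deriv d (\<lambda>x. \<Sum>i\<in>I. f i x) x w = (\<Sum>i\<in>I. dir_deriv d (f i) x w)"
  using f
proof (induction I rule: infinite_finite_induct)
  case (insert i I)
  then show ?case
    using dir_deriv_add[OF U _ Ck_on_sum[OF U] x, of "f i" I f] by simp
qed auto

lemma dir_deriv_prod:
  assumes U: "openin (Euclidean_space d) U" and x: "x \<in> U" and I: "finite I"
    and f: "\<And>i. i \<in> I \<Longrightarrow> Ck_on (Suc 0) d U (f i)"
  shows "dir_deriv d (\<lambda>x. \<Prod>i\<in>I. f i x) x w = (\<Sum>i\<in>I. dir_deriv d (f i) x w * (\<Prod>j\<in>I - {i}. f j x))"
  using I f
proof (induction I rule: finite_induct)
  case (insert i I)
  have "dir_deriv d (\<lambda>x. \<Prod>i\<in>insert i I. f i x) x w = dir_deriv d (\<lambda>x. f i x * (\<Prod>i\<in>I. f i x)) x w"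
    using insert.hyps by simp
  also have "\<dots> = dir_deriv d (f i) x w * (\<Prod>i\<in>I. f i x) + f i x * (\<Sum>i\<in>I. dir_deriv d (f i) x w * (\<Prod>j\<in>I - {i}. f j x))"
    by (subst dir_deriv_mult[OF U _ Ck_on_prod[OF U] x]) (use insert in auto)
  also have "f i x * (\<Sum>q\<in>I. dir_deriv d (f q) x w * (\<Prod>j\<in>I - {q}. f j x))
      = (\<Sum>q\<in>I. dir_deriv d (f q) x w * (\<Prod>j\<in>insert i I - {q}. f j x))"
    unfolding sum_distrib_left
  proof (intro sum.cong refl)
    fix q assume "q \<in> I"
    with insert.hyps have "insert i I - {q} = insert i (I - {q})" "i \<notin> I - {q}" by auto
    then show "f i x * (dir_deriv d (f q) x w * (\<Prod>j\<in>I - {q}. f j x)) = dir_deriv d (f q) x w * (\<Prod>j\<in>insert i I - {q}. f j x)"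
      using insert.hyps by simp
  qed
  finally show ?case
    using insert.hyps by (simp add: insert_Diff_if)
qed auto

lemma dir_deriv_commute:
  assumes U: "openin (Euclidean_space d) U" and f: "Ck_on (Suc (Suc 0)) d U f" and x: "x \<in> U"
  shows "dir_deriv d (\<lambda>y. dir_deriv d f y v) x u = dir_deriv d (\<lambda>y. dir_deriv d f y u) x v"
proof -
  have D: "dir_deriv d (\<lambda>y. dir_deriv d f y v) x u = (\<Sum>l<d. \<Sum>a<d. u l * v a * partial_deriv l (partial_deriv a f) x)" for u v
  proof -
    have "dir_deriv d (\<lambda>y. dir_deriv d f y v) x u = (\<Sum>a<d. dir_deriv d (\<lambda>y. v a * partial_deriv a f y) x u)"
      unfolding dir_deriv_def[of d f]
      by (rule dir_deriv_sum[OF U x])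
         (use Ck_on_partial[OF openin_Euclidean_subset[OF U] f] in
          \<open>auto intro!: Ck_on_mult[OF U] Ck_on_const openin_Euclidean_subset[OF U]\<close>)
    also have "\<dots> = (\<Sum>a<d. v a * dir_deriv d (partial_deriv a f) x u)"
      using Ck_on_partial[OF openin_Euclidean_subset[OF U] f]
      by (intro sum.cong refl dir_deriv_cmult[OF U _ x]) auto
    also have "\<dots> = (\<Sum>l<d. \<Sum>a<d. u l * v a * partial_deriv l (partial_deriv a f) x)"
      unfolding dir_deriv_def sum_distrib_left by (subst sum.swap) (simp add: mult_ac)
    finally show ?thesis .
  qed
  have "(\<Sum>l<d. \<Sum>a<d. u l * v a * partial_deriv l (partial_deriv a f) x) = (\<Sum>a<d. \<Sum>l<d. v a * u l * partial_deriv a (partial_deriv l f) x)"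
    by (subst sum.swap) (intro sum.cong refl, simp add: partial_deriv_commute[OF U f _ _ x])
  then show ?thesis unfolding D .
qed

section \<open>Alternating forms\<close>

definition unit_vec :: "nat \<Rightarrow> nat \<Rightarrow> real" where
  "unit_vec l = (\<lambda>i. if i = l then 1 else 0)"

text \<open>The argument list on which the \<open>j\<close>-th summand of \<^const>\<open>ext_deriv\<close> evaluates the form.\<close>

definition omit :: "nat \<Rightarrow> (nat \<Rightarrow> 'a) \<Rightarrow> nat \<Rightarrow> 'a" where
  "omit j v = (\<lambda>i. if i < j then v i else v (Suc i))"

lemma unit_vec_in_R_pow [simp]: "l < d \<Longrightarrow> unit_vec l \<in> R_pow d"
  by (auto simp: unit_vec_def R_pow_iff)

lemma R_pow_sum: "(\<And>l. l \<in> L \<Longrightarrow> u l \<in> R_pow d) \<Longrightarrow> (\<lambda>i. \<Sum>l\<in>L. a l * u l i) \<in> R_pow d"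
  by (auto simp: R_pow_iff)

lemma R_pow_0: "(\<lambda>i. 0) \<in> R_pow d"
  by (simp add: R_pow_iff)

context
  fixes d k :: nat and f :: "(nat \<Rightarrow> nat \<Rightarrow> real) \<Rightarrow> real"
  assumes am: "alternating_multilinear d k f"
begin

lemma am_cong:
  assumes "\<And>j. j < k \<Longrightarrow> v j \<in> R_pow d" "\<And>j. j < k \<Longrightarrow> v j = w j"
  shows "f v = f w"
proof -
  have "\<forall>v w. (\<forall>j<k. v j \<in> R_pow d \<and> v j = w j) \<longrightarrow> f v = f w"
    using am unfolding alternating_multilinear_def by (elim conjE)
  then show ?thesis using assms by blast
qed

lemma am_linear:
  assumes "j < k" "u \<in> R_pow d" "w \<in> R_pow d" "\<And>i. i < k \<Longrightarrow> v i \<in> R_pow d"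
  shows "f (v(j := (\<lambda>i. a * u i + b * w i))) = a * f (v(j := u)) + b * f (v(j := w))"
proof -
  have "\<forall>v. \<forall>j<k. \<forall>u\<in>R_pow d. \<forall>w\<in>R_pow d. \<forall>a b. (\<forall>i<k. v i \<in> R_pow d) \<longrightarrow>
      f (v(j := (\<lambda>i. a * u i + b * w i))) = a * f (v(j := u)) + b * f (v(j := w))"
    using am unfolding alternating_multilinear_def by (elim conjE)
  then show ?thesis using assms by simp
qed

lemma am_alternating:
  assumes "i < k" "j < k" "\<And>l. l < k \<Longrightarrow> v l \<in> R_pow d" "i \<noteq> j" "v i = v j"
  shows "f v = 0"
proof -
  have "\<forall>v. \<forall>i<k. \<forall>j<k. (\<forall>l<k. v l \<in> R_pow d) \<and> i \<noteq> j \<and> v i = v j \<longrightarrow> f v = 0"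
    using am unfolding alternating_multilinear_def by (elim conjE)
  then show ?thesis using assms by auto
qed

lemma am_add:
  "j < k \<Longrightarrow> u \<in> R_pow d \<Longrightarrow> w \<in> R_pow d \<Longrightarrow> (\<And>i. i < k \<Longrightarrow> v i \<in> R_pow d) \<Longrightarrow>
    f (v(j := (\<lambda>i. u i + w i))) = f (v(j := u)) + f (v(j := w))"
  using am_linear[of j u w v 1 1] by simp

lemma am_sum:
  assumes j: "j < k" and v: "\<And>i. i < k \<Longrightarrow> v i \<in> R_pow d" and L: "finite L"
    and u: "\<And>l. l \<in> L \<Longrightarrow> u l \<in> R_pow d"
  shows "f (v(j := (\<lambda>i. \<Sum>l\<in>L. a l * u l i))) = (\<Sum>l\<in>L. a l * f (v(j := u l)))"
  using L u
proof (induction L rule: finite_induct)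
  case empty
  show ?case using am_linear[OF j R_pow_0 R_pow_0, of v 0 0, OF v] by (simp add: fun_upd_def)
next
  case (insert x L)
  then show ?case
    using am_linear[OF j _ R_pow_sum[of L u d a], of "u x" v "a x" 1, OF _ _ v] by (simp add: fun_upd_def)
qed

lemma am_swap:
  assumes i: "i < k" and j: "j < k" and ij: "i \<noteq> j" and v: "\<And>l. l < k \<Longrightarrow> v l \<in> R_pow d"
  shows "f (v(i := v j, j := v i)) = - f v"
proof -
  have R: "v i \<in> R_pow d" "v j \<in> R_pow d" using v i j by auto
  define s where "s = (\<lambda>l. v i l + v j l)"
  have s: "s \<in> R_pow d" using R by (auto simp: s_def R_pow_iff)
  have z: "f (v(i := x, j := x)) = 0" if "x \<in> R_pow d" for x
    by (rule am_alternating[OF i j _ ij]) (use that v ij in auto)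
  have "0 = f (v(i := s, j := s))" using z[OF s] by simp
  also have "\<dots> = f (v(i := s, j := v i)) + f (v(i := s, j := v j))"
    unfolding s_def by (rule am_add[OF j]) (use R v s in \<open>auto simp: s_def\<close>)
  also have "f (v(i := s, j := y)) = f (v(i := v i, j := y)) + f (v(i := v j, j := y))" if "y \<in> R_pow d" for y
  proof -
    have "f ((v(j := y))(i := s)) = f ((v(j := y))(i := v i)) + f ((v(j := y))(i := v j))"
      unfolding s_def by (rule am_add[OF i]) (use R v that in auto)
    moreover have "(v(j := y))(i := x) = v(i := x, j := y)" for x
      using ij by (rule fun_upd_twist[symmetric])
    ultimately show ?thesis by (simp only:)
  qed
  ultimately show ?thesis using z[OF R(1)] z[OF R(2)] R by simp
qed

text \<open>Moving the \<open>p\<close>-th argument to the front takes \<open>p\<close> transpositions of neighbours.\<close>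

lemma am_move_to_front:
  assumes "p < k" and v: "\<And>l. l < k \<Longrightarrow> v l \<in> R_pow d"
  shows "f v = (-1) ^ p * f (case_nat (v p) (omit p v))"
  using assms
proof (induction p arbitrary: v)
  case 0
  have "case_nat (v 0) (omit 0 v) = v" by (auto simp: fun_eq_iff omit_def split: nat.splits)
  then show ?case by simp
next
  case (Suc p)
  let ?w = "v(p := v (Suc p), Suc p := v p)"
  have "f v = - f ?w"
    using am_swap[of p "Suc p" v] Suc.prems by simp
  also have "f ?w = (-1) ^ p * f (case_nat (?w p) (omit p ?w))"
    by (rule Suc.IH) (use Suc.prems in auto)
  also have "omit p ?w = omit (Suc p) v"
    by (auto simp: omit_def fun_eq_iff less_Suc_eq)
  also have "?w p = v (Suc p)" by simp
  finally show ?case by simp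
qed

text \<open>
  Expansion in the standard basis. It separates the dependence of a form on the base point from the
  dependence on its arguments, so that the product rule applies when both vary.
\<close>

lemma am_expansion:
  assumes v: "\<And>j. j < k \<Longrightarrow> v j \<in> R_pow d"
  shows "f v = (\<Sum>I\<in>PiE {..<k} (\<lambda>_. {..<d}). (\<Prod>j<k. v j (I j)) * f (\<lambda>j. unit_vec (I j)))"
proof -
  define h where "h = (\<lambda>q I j. if j < q then unit_vec (I j) else v j)"
  have "f v = (\<Sum>I\<in>PiE {..<q} (\<lambda>_. {..<d}). (\<Prod>j<q. v j (I j)) * f (h q I))" if "q \<le> k" for q
    using that
  proof (induction q)
    case 0 then show ?case by (simp add: h_def)
  next
    case (Suc q)
    have step: "f (h q I) = (\<Sum>l<d. v q l * f (h (Suc q) (I(q := l))))" if I: "I \<in> PiE {..<q} (\<lambda>_. {..<d})" for I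
    proof -
      have hR: "h q I j \<in> R_pow d" if "j < k" for j
        using v[OF that] I by (auto simp: h_def PiE_def Pi_def)
      have "v q = (\<lambda>i. \<Sum>l<d. v q l * unit_vec l i)"
        using v[of q] Suc.prems by (auto simp: unit_vec_def fun_eq_iff R_pow_iff if_distrib[of "\<lambda>x. _ * x"] cong: if_cong)
      then have "f (h q I) = f ((h q I)(q := (\<lambda>i. \<Sum>l<d. v q l * unit_vec l i)))"
        by (metis fun_upd_triv h_def less_irrefl)
      also have "\<dots> = (\<Sum>l<d. v q l * f ((h q I)(q := unit_vec l)))"
        by (rule am_sum) (use Suc.prems hR in auto)
      also have "\<dots> = (\<Sum>l<d. v q l * f (h (Suc q) (I(q := l))))"
        by (intro sum.cong refl arg_cong2[where f = "(*)"] arg_cong[where f = f]) (auto simp: h_def fun_eq_iff less_Suc_eq)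
      finally show ?thesis .
    qed
    have "f v = (\<Sum>I\<in>PiE {..<q} (\<lambda>_. {..<d}). \<Sum>l<d. (\<Prod>j<q. v j (I j)) * v q l * f (h (Suc q) (I(q := l))))"
      using Suc by (simp add: step sum_distrib_left mult.assoc)
    also have "\<dots> = (\<Sum>(l, I)\<in>{..<d} \<times> PiE {..<q} (\<lambda>_. {..<d}). (\<Prod>j<q. v j (I j)) * v q l * f (h (Suc q) (I(q := l))))"
      by (subst sum.swap) (simp add: sum.cartesian_product)
    also have "\<dots> = (\<Sum>I\<in>(\<lambda>(l, I). I(q := l)) ` ({..<d} \<times> PiE {..<q} (\<lambda>_. {..<d})). (\<Prod>j<Suc q. v j (I j)) * f (h (Suc q) I))"
    proof (subst sum.reindex)
      show "inj_on (\<lambda>(l, I). I(q := l)) ({..<d} \<times> PiE {..<q} (\<lambda>_. {..<d}))"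
        by (rule inj_combinator) simp
      have "(\<Prod>j<q. v j (I j)) * v q l * F = (\<Prod>j<Suc q. v j ((I(q := l)) j)) * F" for I l and F :: real
        by simp
      then show "(\<Sum>(l, I)\<in>{..<d} \<times> PiE {..<q} (\<lambda>_. {..<d}). (\<Prod>j<q. v j (I j)) * v q l * f (h (Suc q) (I(q := l))))
          = sum ((\<lambda>I. (\<Prod>j<Suc q. v j (I j)) * f (h (Suc q) I)) \<circ> (\<lambda>(l, I). I(q := l)))
              ({..<d} \<times> PiE {..<q} (\<lambda>_. {..<d}))"
        unfolding comp_def case_prod_unfold by (intro sum.cong refl)
    qed
    also have "(\<lambda>(l, I). I(q := l)) ` ({..<d} \<times> PiE {..<q} (\<lambda>_. {..<d})) = PiE {..<Suc q} (\<lambda>_. {..<d})"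
      by (simp only: lessThan_Suc PiE_insert_eq)
    finally show ?case .
  qed
  from this[of k] have "f v = (\<Sum>I\<in>PiE {..<k} (\<lambda>_. {..<d}). (\<Prod>j<k. v j (I j)) * f (h k I))" by simp
  moreover have "f (h k I) = f (\<lambda>j. unit_vec (I j))" if "I \<in> PiE {..<k} (\<lambda>_. {..<d})" for I
  proof (rule am_cong)
    fix j assume j: "j < k"
    then have "I j \<in> {..<d}" using PiE_mem[OF that, of j] by simp
    with j show "h k I j \<in> R_pow d" "h k I j = unit_vec (I j)" by (simp_all add: h_def)
  qed
  ultimately show ?thesis by simp
qed

end

text \<open>
  The cancellation behind \<open>d \<circ> d = 0\<close>: omitting first index \<open>j\<close> and then position \<open>q < j\<close> is the same as
  omitting first \<open>q\<close> and then position \<open>j - 1\<close>, and the two terms carry opposite signs.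
\<close>

lemma alternating_double_sum_eq_0:
  fixes \<Psi> :: "nat \<Rightarrow> nat \<Rightarrow> real"
  assumes sym: "\<And>j q. q < j \<Longrightarrow> j \<le> p \<Longrightarrow> \<Psi> j q = \<Psi> q (j - 1)"
  shows "(\<Sum>j\<le>p. \<Sum>q<p. (-1) ^ (j + q) * \<Psi> j q) = 0"
proof -
  let ?t = "\<lambda>(j, q). (-1) ^ (j + q) * \<Psi> j q"
  let ?A = "{(j, q). j \<le> p \<and> q < j}" and ?B = "{(j, q). j \<le> q \<and> q < p}"
  have fin: "finite ?A" "finite ?B"
    by (rule finite_subset[of _ "{..p} \<times> {..p}"]; auto)+
  have "(\<Sum>j\<le>p. \<Sum>q<p. (-1) ^ (j + q) * \<Psi> j q) = sum ?t ({..p} \<times> {..<p})"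
    by (simp add: sum.cartesian_product)
  also have "{..p} \<times> {..<p} = ?A \<union> ?B" by auto
  also have "sum ?t (?A \<union> ?B) = sum ?t ?A + sum ?t ?B"
    by (rule sum.union_disjoint[OF fin]) auto
  also have "sum ?t ?A = (\<Sum>x\<in>?B. - ?t x)"
  proof (rule sum.reindex_bij_witness[where i = "\<lambda>(j, q). (Suc q, j)" and j = "\<lambda>(j, q). (q, j - 1)"])
    fix x assume "x \<in> ?A"
    then obtain j q where x: "x = (j, q)" "j \<le> p" "q < j" by blast
    then obtain i where i: "j = Suc i" by (cases j) auto
    show "- ?t (case x of (j, q) \<Rightarrow> (q, j - 1)) = ?t x"
      using x sym[of q j] by (simp add: i add.commute)
  qed force+
  finally show ?thesis by (simp add: sum_negf)
qed

section \<open>Smooth maps from open subsets of R^d into manifolds\<close>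

text \<open>
  For open \<open>W\<close> this is smoothness as a map of manifolds from \<open>euclidean_mfd d W\<close>, freed of the
  inverse of the identity chart; see \<open>smooth_from_iff_smooth_map\<close>.
\<close>

definition smooth_from :: "nat \<Rightarrow> (nat \<Rightarrow> real) set \<Rightarrow> 'a mfd \<Rightarrow> ((nat \<Rightarrow> real) \<Rightarrow> 'a) \<Rightarrow> bool" where
  "smooth_from d W M g \<longleftrightarrow> openin (Euclidean_space d) W \<and>
     continuous_map (subtopology (Euclidean_space d) W) (mtop M) g \<and>
     (\<forall>(U, \<phi>)\<in>atlas M. \<forall>i<mdim M. smooth_fun_on d {x \<in> W. g x \<in> U} (\<lambda>x. \<phi> (g x) i))"

lemma openin_preimage_Euclidean:
  assumes W: "openin (Euclidean_space d) W"
    and g: "continuous_map (subtopology (Euclidean_space d) W) X g" and U: "openin X U"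
  shows "openin (Euclidean_space d) {x \<in> W. g x \<in> U}"
proof -
  have "openin (subtopology (Euclidean_space d) W) {x \<in> topspace (subtopology (Euclidean_space d) W). g x \<in> U}"
    using g U by (rule openin_continuous_map_preimage)
  moreover have "topspace (subtopology (Euclidean_space d) W) = W"
    using openin_Euclidean_subset[OF W] by (simp only: topspace_subtopology) blast
  ultimately have "openin (subtopology (Euclidean_space d) W) {x \<in> W. g x \<in> U}"
    by (simp only:)
  then show ?thesis
    using W by (simp only: openin_open_subtopology)
qed

lemma Ck_on_zero_cong:
  assumes "openin (Euclidean_space d) U" "\<And>x. x \<in> U \<Longrightarrow> f x = 0"
  shows "Ck_on k d U f"
  by (rule Ck_on_cong[OF assms(1) _ Ck_on_const[of U d k 0]])
     (use assms openin_Euclidean_subset in auto)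

context
  fixes M :: "'a mfd"
  assumes M: "smooth_manifold M"
begin

lemma chart_openin: "(U, \<phi>) \<in> atlas M \<Longrightarrow> openin (mtop M) U"
  using M unfolding smooth_manifold_def by blast

lemma chart_openin_image: "(U, \<phi>) \<in> atlas M \<Longrightarrow> openin (Euclidean_space (mdim M)) (\<phi> ` U)"
  using M unfolding smooth_manifold_def by blast

lemma chart_homeomorphic: "(U, \<phi>) \<in> atlas M \<Longrightarrow> homeomorphic_map (subtopology (mtop M) U)
    (subtopology (Euclidean_space (mdim M)) (\<phi> ` U)) \<phi>"
  using M unfolding smooth_manifold_def by blast

lemma chart_image_openin:
  assumes c: "(U, \<phi>) \<in> atlas M" and A: "openin (mtop M) A" "A \<subseteq> U"
  shows "openin (Euclidean_space (mdim M)) (\<phi> ` A)"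
proof -
  have "open_map (subtopology (mtop M) U) (subtopology (Euclidean_space (mdim M)) (\<phi> ` U)) \<phi>"
    using chart_homeomorphic[OF c] by (rule homeomorphic_imp_open_map)
  moreover have "openin (subtopology (mtop M) U) A"
    using A chart_openin[OF c] by (simp add: openin_open_subtopology)
  ultimately have "openin (subtopology (Euclidean_space (mdim M)) (\<phi> ` U)) (\<phi> ` A)"
    by (simp add: open_map_def)
  then show ?thesis
    using chart_openin_image[OF c] by (simp add: openin_open_subtopology)
qed

lemma chart_inj_on: assumes "(U, \<phi>) \<in> atlas M" shows "inj_on \<phi> U"
proof -
  have "inj_on \<phi> (topspace (subtopology (mtop M) U))"
    using chart_homeomorphic[OF assms] by (rule homeomorphic_imp_injective_map)
  moreover have "topspace (subtopology (mtop M) U) = U"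
    using openin_subset[OF chart_openin[OF assms]] by (simp add: Int_absorb1)
  ultimately show ?thesis by simp
qed

lemma chart_inv: "(U, \<phi>) \<in> atlas M \<Longrightarrow> p \<in> U \<Longrightarrow> inv_into U \<phi> (\<phi> p) = p"
  using chart_inj_on by (rule inv_into_f_f)

lemma chart_in_R_pow: "(U, \<phi>) \<in> atlas M \<Longrightarrow> p \<in> U \<Longrightarrow> \<phi> p \<in> R_pow (mdim M)"
  using openin_Euclidean_subset[OF chart_openin_image] by blast

lemma chart_at: 
  assumes "p \<in> topspace (mtop M)" obtains U \<phi> where "(U, \<phi>) \<in> atlas M" "p \<in> U"
proof -
  have "topspace (mtop M) = (\<Union>(U, \<phi>)\<in>atlas M. U)"
    using M unfolding smooth_manifold_def by (elim conjE) (rule sym)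
  with assms that show thesis by blast
qed

text \<open>
  The coordinates with index beyond the dimension vanish on the chart and are included, so that
  differentials of transition maps may be compared as functions on all indices.
\<close>

lemma transition_smooth:
  assumes c: "(U, \<phi>) \<in> atlas M" and c': "(V, \<psi>) \<in> atlas M"
  shows "Ck_on k (mdim M) (\<phi> ` (U \<inter> V)) (\<lambda>x. \<psi> (inv_into U \<phi> x) i)"
proof (cases "i < mdim M")
  case True
  then have "smooth_fun_on (mdim M) (\<phi> ` (U \<inter> V)) (\<lambda>x. \<psi> (inv_into U \<phi> x) i)"
    using M c c' unfolding smooth_manifold_def by blast
  then show ?thesis by (simp add: smooth_fun_on_def)
next
  case False
  show ?thesis
  proof (rule Ck_on_zero_cong)
    show "openin (Euclidean_space (mdim M)) (\<phi> ` (U \<inter> V))"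
      using chart_openin[OF c] chart_openin[OF c'] by (intro chart_image_openin[OF c] openin_Int) auto
    fix x assume "x \<in> \<phi> ` (U \<inter> V)"
    then obtain p where p: "x = \<phi> p" "p \<in> U" "p \<in> V" by blast
    then show "\<psi> (inv_into U \<phi> x) i = 0"
      using chart_in_R_pow[OF c' p(3)] False by (simp add: chart_inv[OF c p(2)] R_pow_iff)
  qed
qed

context
  fixes d :: nat and W :: "(nat \<Rightarrow> real) set" and g :: "(nat \<Rightarrow> real) \<Rightarrow> 'a"
  assumes g: "smooth_from d W M g"
begin

lemma smooth_from_openin_preimage:
  "openin (mtop M) A \<Longrightarrow> openin (Euclidean_space d) {x \<in> W. g x \<in> A}"
  using g unfolding smooth_from_def by (elim conjE) (rule openin_preimage_Euclidean)

lemma smooth_from_openin: "openin (Euclidean_space d) W"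
  using g unfolding smooth_from_def by (elim conjE)

lemma smooth_from_in_topspace: "x \<in> W \<Longrightarrow> g x \<in> topspace (mtop M)"
  using g openin_Euclidean_subset[OF smooth_from_openin]
  unfolding smooth_from_def continuous_map_def by (auto simp: Pi_iff)

lemma smooth_from_chart:
  assumes c: "(U, \<phi>) \<in> atlas M"
  shows "Ck_on k d {x \<in> W. g x \<in> U} (\<lambda>x. \<phi> (g x) i)"
proof (cases "i < mdim M")
  case True
  then show ?thesis using g c unfolding smooth_from_def smooth_fun_on_def by blast
next
  case False
  show ?thesis
    by (rule Ck_on_zero_cong[OF smooth_from_openin_preimage[OF chart_openin[OF c]]])
       (use False chart_in_R_pow[OF c] in \<open>auto simp: R_pow_iff\<close>)
qed

text \<open>
  A function on the manifold that is smooth in the chart \<open>\<phi>\<close> is smooth along \<open>g\<close>, with the expected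
  derivative. This serves both for a second chart \<open>\<psi>\<close> and for \<open>\<psi> \<circ> F\<close> with a smooth map \<open>F\<close>.
\<close>

context
  fixes U \<phi> A f k
  assumes c: "(U, \<phi>) \<in> atlas M" and A: "openin (mtop M) A" "A \<subseteq> U"
    and f: "Ck_on k (mdim M) (\<phi> ` A) (\<lambda>z. f (inv_into U \<phi> z))"
begin

lemma eq_through_chart: "x \<in> {x \<in> W. g x \<in> A} \<Longrightarrow> f (inv_into U \<phi> (\<phi> (g x))) = f (g x)"
  using A(2) chart_inv[OF c] by (simp add: subset_iff)

lemma Ck_on_through_chart: "Ck_on k d {x \<in> W. g x \<in> A} (\<lambda>x. f (g x))"
proof (rule Ck_on_cong[OF smooth_from_openin_preimage[OF A(1)] eq_through_chart])
  show "Ck_on k d {x \<in> W. g x \<in> A} (\<lambda>x. f (inv_into U \<phi> (\<phi> (g x))))"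
  proof (rule Ck_on_compose[OF smooth_from_openin_preimage[OF A(1)] chart_image_openin[OF c A] f])
    show "Ck_on k d {x \<in> W. g x \<in> A} (\<lambda>x. \<phi> (g x) j)" for j
      by (rule Ck_on_subset[OF _ smooth_from_chart[OF c]])
         (use A(2) openin_Euclidean_subset[OF smooth_from_openin] in auto)
  qed auto
qed

lemma dir_deriv_through_chart:
  assumes k: "k \<ge> 1" and x: "x \<in> W" "g x \<in> A"
  shows "dir_deriv d (\<lambda>y. f (g y)) x w
     = dir_deriv (mdim M) (\<lambda>z. f (inv_into U \<phi> z)) (\<phi> (g x)) (differential d (\<phi> \<circ> g) x w)"
proof -
  let ?A = "{x \<in> W. g x \<in> A}"
  note oA = smooth_from_openin_preimage[OF A(1)] and oI = chart_image_openin[OF c A]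
  have "dir_deriv d (\<lambda>y. f (g y)) x w = dir_deriv d (\<lambda>y. f (inv_into U \<phi> ((\<phi> \<circ> g) y))) x w"
    by (rule dir_deriv_cong[OF oA]) (use x eq_through_chart in auto)
  also have "\<dots> = dir_deriv (mdim M) (\<lambda>z. f (inv_into U \<phi> z)) ((\<phi> \<circ> g) x) (differential d (\<phi> \<circ> g) x w)"
  proof (rule dir_deriv_compose[OF oA oI])
    show "Ck_on (Suc 0) (mdim M) (\<phi> ` A) (\<lambda>z. f (inv_into U \<phi> z))"
      using f k by (intro Ck_on_mono[OF openin_Euclidean_subset[OF oI] f]) simp
    show "Ck_on (Suc 0) d ?A (\<lambda>x. (\<phi> \<circ> g) x j)" for j
      unfolding comp_def
      by (rule Ck_on_subset[OF _ smooth_from_chart[OF c]])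
         (use A(2) openin_Euclidean_subset[OF smooth_from_openin] in auto)
  qed (use x in auto)
  finally show ?thesis by simp
qed

end

lemma differential_change_chart:
  assumes c: "(U, \<phi>) \<in> atlas M" and c': "(V, \<psi>) \<in> atlas M" and x: "x \<in> W" "g x \<in> U" "g x \<in> V"
  shows "differential d (\<psi> \<circ> g) x w
     = differential (mdim M) (\<psi> \<circ> inv_into U \<phi>) (\<phi> (g x)) (differential d (\<phi> \<circ> g) x w)"
proof
  fix i
  have UV: "openin (mtop M) (U \<inter> V)"
    using chart_openin[OF c] chart_openin[OF c'] by (rule openin_Int)
  show "differential d (\<psi> \<circ> g) x w i
     = differential (mdim M) (\<psi> \<circ> inv_into U \<phi>) (\<phi> (g x)) (differential d (\<phi> \<circ> g) x w) i"
    using dir_deriv_through_chart[OF c UV _ transition_smooth[OF c c', where k = 1 and i = i], where x = x and w = w] x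
    by (simp add: differential_def[of _ "\<psi> \<circ> g"] differential_def[of _ "\<psi> \<circ> inv_into U \<phi>"])
qed

lemma differential_in_R_pow:
  assumes c: "(U, \<phi>) \<in> atlas M" and x: "x \<in> W" "g x \<in> U"
  shows "differential d (\<phi> \<circ> g) x w \<in> R_pow (mdim M)"
  unfolding R_pow_iff
proof (intro allI impI)
  fix i assume "i \<ge> mdim M"
  have "differential d (\<phi> \<circ> g) x w i = dir_deriv d (\<lambda>y. 0) x w"
    unfolding differential_def
    by (rule dir_deriv_cong[OF smooth_from_openin_preimage[OF chart_openin[OF c]]])
       (use x \<open>i \<ge> mdim M\<close> chart_in_R_pow[OF c] in \<open>auto simp: R_pow_iff\<close>)
  then show "differential d (\<phi> \<circ> g) x w i = 0" by simp
qed

text \<open>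
  The second derivatives of the coordinates of \<open>g\<close> occur as arguments of forms, which are controlled
  only on vectors of R^m.
\<close>

lemma second_derivative_in_R_pow:
  assumes c: "(U, \<phi>) \<in> atlas M" and x: "x \<in> W" "g x \<in> U"
  shows "(\<lambda>i. dir_deriv d (\<lambda>y. dir_deriv d (\<lambda>y. \<phi> (g y) i) y v) x u) \<in> R_pow (mdim M)"
  unfolding R_pow_iff
proof (intro allI impI)
  fix i assume i: "i \<ge> mdim M"
  let ?V = "{x \<in> W. g x \<in> U}"
  note V = smooth_from_openin_preimage[OF chart_openin[OF c]]
  have z: "\<phi> (g y) i = 0" if "y \<in> ?V" for y
    using that i chart_in_R_pow[OF c] by (simp add: R_pow_iff)
  have "dir_deriv d (\<lambda>y. \<phi> (g y) i) y v = 0" if "y \<in> ?V" for y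
    using dir_deriv_cong[OF V that z, where w = v] by simp
  then have "dir_deriv d (\<lambda>y. dir_deriv d (\<lambda>y. \<phi> (g y) i) y v) x u = dir_deriv d (\<lambda>y. 0) x u"
    using x by (intro dir_deriv_cong[OF V]) auto
  then show "dir_deriv d (\<lambda>y. dir_deriv d (\<lambda>y. \<phi> (g y) i) y v) x u = 0" by simp
qed

end

end

lemma differential_linear:
  "differential d g x (\<lambda>i. a * u i + b * w i) = (\<lambda>i. a * differential d g x u i + b * differential d g x w i)"
  by (simp add: differential_def dir_deriv_def sum_distrib_left sum.distrib algebra_simps)

lemma smooth_fromI:
  assumes "openin (Euclidean_space d) W" "continuous_map (subtopology (Euclidean_space d) W) (mtop M) g"
    and "\<And>U \<phi> i. (U, \<phi>) \<in> atlas M \<Longrightarrow> i < mdim M \<Longrightarrow> smooth_fun_on d {x \<in> W. g x \<in> U} (\<lambda>x. \<phi> (g x) i)"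
  shows "smooth_from d W M g"
  unfolding smooth_from_def using assms by blast

lemma smooth_map_in_charts:
  assumes M: "smooth_manifold M" and N: "smooth_manifold N" and F: "smooth_map M N F"
    and c: "(U, \<phi>) \<in> atlas M" and c': "(V, \<psi>) \<in> atlas N"
  shows "openin (mtop M) {p \<in> U. F p \<in> V}"
    and "Ck_on k (mdim M) (\<phi> ` {p \<in> U. F p \<in> V}) (\<lambda>z. \<psi> (F (inv_into U \<phi> z)) i)"
proof -
  have Fc: "continuous_map (mtop M) (mtop N) F" using F by (simp add: smooth_map_def)
  have "{p \<in> U. F p \<in> V} = U \<inter> {p \<in> topspace (mtop M). F p \<in> V}"
    using openin_subset[OF chart_openin[OF M c]] by auto
  then show A: "openin (mtop M) {p \<in> U. F p \<in> V}"
    using chart_openin[OF M c] openin_continuous_map_preimage[OF Fc chart_openin[OF N c']] by (auto intro: openin_Int)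
  show "Ck_on k (mdim M) (\<phi> ` {p \<in> U. F p \<in> V}) (\<lambda>z. \<psi> (F (inv_into U \<phi> z)) i)"
  proof (cases "i < mdim N")
    case True
    then show ?thesis using F c c' unfolding smooth_map_def smooth_fun_on_def by blast
  next
    case False
    have "openin (Euclidean_space (mdim M)) (\<phi> ` {p \<in> U. F p \<in> V})"
      by (rule chart_image_openin[OF M c A]) auto
    then show ?thesis
    proof (rule Ck_on_zero_cong)
      fix z assume "z \<in> \<phi> ` {p \<in> U. F p \<in> V}"
      then obtain p where p: "z = \<phi> p" "p \<in> U" "F p \<in> V" by blast
      then show "\<psi> (F (inv_into U \<phi> z)) i = 0"
        using chart_in_R_pow[OF N c' p(3)] False by (simp add: chart_inv[OF M c p(2)] R_pow_iff)
    qed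
  qed
qed

lemma smooth_from_compose_smooth_map:
  assumes M: "smooth_manifold M" and N: "smooth_manifold N"
    and g: "smooth_from d W M g" and F: "smooth_map M N F"
  shows "smooth_from d W N (F \<circ> g)"
proof (rule smooth_fromI)
  note W = smooth_from_openin[OF M g]
  show "openin (Euclidean_space d) W" by (rule W)
  have Fc: "continuous_map (mtop M) (mtop N) F" using F by (simp add: smooth_map_def)
  show "continuous_map (subtopology (Euclidean_space d) W) (mtop N) (F \<circ> g)"
    using g Fc unfolding smooth_from_def by (blast intro: continuous_map_compose)
  fix V \<psi> i assume c': "(V, \<psi>) \<in> atlas N" and i: "i < mdim N"
  show "smooth_fun_on d {x \<in> W. (F \<circ> g) x \<in> V} (\<lambda>x. \<psi> ((F \<circ> g) x) i)"
    unfolding smooth_fun_on_def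
  proof (rule allI, rule Ck_on_local)
    show "{x \<in> W. (F \<circ> g) x \<in> V} \<subseteq> R_pow d" using openin_Euclidean_subset[OF W] by auto
    fix k x assume x: "x \<in> {x \<in> W. (F \<circ> g) x \<in> V}"
    then obtain U \<phi> where c: "(U, \<phi>) \<in> atlas M" "g x \<in> U"
      using smooth_from_in_topspace[OF M g] chart_at[OF M] by (metis (lifting) mem_Collect_eq)
    define A where "A = {p \<in> U. F p \<in> V}"
    have A: "openin (mtop M) A" "A \<subseteq> U"
      using smooth_map_in_charts(1)[OF M N F c(1) c'] by (auto simp: A_def)
    have "Ck_on k (mdim M) (\<phi> ` A) (\<lambda>z. \<psi> (F (inv_into U \<phi> z)) i)"
      unfolding A_def by (rule smooth_map_in_charts(2)[OF M N F c(1) c'])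
    then have "Ck_on k d {x \<in> W. g x \<in> A} (\<lambda>x. \<psi> (F (g x)) i)"
      by (rule Ck_on_through_chart[OF M g c(1) A, where f = "\<lambda>p. \<psi> (F p) i"])
    then show "\<exists>T. openin (Euclidean_space d) T \<and> x \<in> T \<and> T \<subseteq> {x \<in> W. (F \<circ> g) x \<in> V} \<and>
        Ck_on k d T (\<lambda>x. \<psi> ((F \<circ> g) x) i)"
      using smooth_from_openin_preimage[OF M g A(1)] x c(2)
      by (intro exI[of _ "{x \<in> W. g x \<in> A}"]) (auto simp: A_def)
  qed
qed

lemma smooth_from_precompose:
  assumes M: "smooth_manifold M" and g: "smooth_from d W M g" and V: "openin (Euclidean_space e) V"
    and \<iota>: "\<And>x. x \<in> V \<Longrightarrow> \<iota> x \<in> W" "\<And>j k. j < d \<Longrightarrow> Ck_on k e V (\<lambda>x. \<iota> x j)"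
  shows "smooth_from e V M (g \<circ> \<iota>)"
proof (rule smooth_fromI)
  note W = smooth_from_openin[OF M g]
  have cont: "continuous_map (subtopology (Euclidean_space e) V) (subtopology (Euclidean_space d) W) \<iota>"
    unfolding subtopology_Euclidean_space_eq[OF openin_Euclidean_subset[OF W]]
      subtopology_Euclidean_space_eq[OF openin_Euclidean_subset[OF V]]
  proof (rule continuous_map_subtopology_eu[THEN iffD2], intro conjI)
    show "continuous_on V \<iota>"
    proof (rule continuous_on_coordinatewise_then_product)
      fix j show "continuous_on V (\<lambda>x. \<iota> x j)"
      proof (cases "j < d")
        case True
        then show ?thesis using \<iota>(2)[OF True] Ck_on_imp_continuous openin_Euclidean_subset[OF V] by blast
      next
        case False
        then have "\<iota> x j = 0" if "x \<in> V" for x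
          using \<iota>(1)[OF that] openin_Euclidean_subset[OF W] by (auto simp: R_pow_iff)
        then show ?thesis by (simp cong: continuous_on_cong_simp)
      qed
    qed
  qed (use \<iota>(1) in auto)
  show V': "openin (Euclidean_space e) V" by (rule V)
  show gc: "continuous_map (subtopology (Euclidean_space e) V) (mtop M) (g \<circ> \<iota>)"
    using g cont unfolding smooth_from_def by (blast intro: continuous_map_compose)
  fix U \<phi> i assume c: "(U, \<phi>) \<in> atlas M" and i: "i < mdim M"
  have o1: "openin (Euclidean_space e) {x \<in> V. (g \<circ> \<iota>) x \<in> U}"
    by (rule openin_preimage_Euclidean[OF V gc chart_openin[OF M c]])
  show "smooth_fun_on e {x \<in> V. (g \<circ> \<iota>) x \<in> U} (\<lambda>x. \<phi> ((g \<circ> \<iota>) x) i)"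
    unfolding smooth_fun_on_def comp_def
  proof (rule allI, rule Ck_on_compose[OF o1[unfolded comp_def] smooth_from_openin_preimage[OF M g chart_openin[OF M c]] smooth_from_chart[OF M g c]])
    show "Ck_on k e {x \<in> V. g (\<iota> x) \<in> U} (\<lambda>x. \<iota> x j)" if "j < d" for j k
      by (rule Ck_on_subset[OF openin_Euclidean_subset[OF V] \<iota>(2)[OF that]]) auto
  qed (use \<iota>(1) in auto)
qed

lemma smooth_from_iff_smooth_map:
  assumes M: "smooth_manifold M" and W: "openin (Euclidean_space d) W"
  shows "smooth_map (euclidean_mfd d W) M g \<longleftrightarrow> smooth_from d W M g"
proof -
  have inv: "inv_into W (\<lambda>x. x) x = x" if "x \<in> W" for x
    using inv_into_f_f[of "\<lambda>x. x" W x] that by simp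
  have "smooth_fun_on d {x \<in> W. g x \<in> U} (\<lambda>x. \<phi> (g (inv_into W (\<lambda>x. x) x)) i)
     \<longleftrightarrow> smooth_fun_on d {x \<in> W. g x \<in> U} (\<lambda>x. \<phi> (g x) i)"
    if g: "continuous_map (subtopology (Euclidean_space d) W) (mtop M) g" and c: "(U, \<phi>) \<in> atlas M" for U \<phi> i
  proof -
    note o = openin_preimage_Euclidean[OF W g chart_openin[OF M c]]
    show ?thesis unfolding smooth_fun_on_def
      by (intro all_cong1 iffI; rule Ck_on_cong[OF o]; (assumption | use inv in auto))
  qed
  then show ?thesis
    using W unfolding smooth_from_def smooth_map_def euclidean_mfd_def by fastforce
qed

section \<open>Pulling back forms\<close>

context
  fixes \<alpha> :: "'a form" and p :: nat and M :: "'a mfd" and U \<phi>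
  assumes \<alpha>: "\<alpha> \<in> smooth_forms p M" and c: "(U, \<phi>) \<in> atlas M"
begin

lemma smooth_forms_in_chart:
  "(\<forall>x\<in>\<phi> ` U. alternating_multilinear (mdim M) p (\<alpha> (U, \<phi>) x)) \<and>
   (\<forall>v. (\<forall>j<p. v j \<in> R_pow (mdim M)) \<longrightarrow> smooth_fun_on (mdim M) (\<phi> ` U) (\<lambda>x. \<alpha> (U, \<phi>) x v))"
proof -
  have "\<forall>(U, \<phi>)\<in>atlas M. (\<forall>x\<in>\<phi> ` U. alternating_multilinear (mdim M) p (\<alpha> (U, \<phi>) x)) \<and>
      (\<forall>v. (\<forall>j<p. v j \<in> R_pow (mdim M)) \<longrightarrow> smooth_fun_on (mdim M) (\<phi> ` U) (\<lambda>x. \<alpha> (U, \<phi>) x v))"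
    using \<alpha> unfolding smooth_forms_def mem_Collect_eq by (elim conjE)
  from bspec[OF this c] show ?thesis by simp
qed

lemma smooth_forms_alternating: "y \<in> \<phi> ` U \<Longrightarrow> alternating_multilinear (mdim M) p (\<alpha> (U, \<phi>) y)"
  by (rule bspec[OF smooth_forms_in_chart[THEN conjunct1]])

lemma smooth_forms_Ck_on:
  "(\<And>j. j < p \<Longrightarrow> v j \<in> R_pow (mdim M)) \<Longrightarrow> Ck_on k (mdim M) (\<phi> ` U) (\<lambda>y. \<alpha> (U, \<phi>) y v)"
  using smooth_forms_in_chart[THEN conjunct2, THEN spec, THEN mp, of v] by (simp add: smooth_fun_on_def)

lemma smooth_forms_change_chart:
  assumes c': "(V, \<psi>) \<in> atlas M" and q: "q \<in> U" "q \<in> V" and v: "\<And>j. j < p \<Longrightarrow> v j \<in> R_pow (mdim M)"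
  shows "\<alpha> (U, \<phi>) (\<phi> q) v = \<alpha> (V, \<psi>) (\<psi> q) (\<lambda>j. differential (mdim M) (\<psi> \<circ> inv_into U \<phi>) (\<phi> q) (v j))"
proof -
  have "\<forall>(U, \<phi>)\<in>atlas M. \<forall>(V, \<psi>)\<in>atlas M. \<forall>p'\<in>U \<inter> V. \<forall>v. (\<forall>j<p. v j \<in> R_pow (mdim M)) \<longrightarrow>
      \<alpha> (U, \<phi>) (\<phi> p') v = \<alpha> (V, \<psi>) (\<psi> p') (\<lambda>j. differential (mdim M) (\<psi> \<circ> inv_into U \<phi>) (\<phi> p') (v j))"
    using \<alpha> unfolding smooth_forms_def mem_Collect_eq by (elim conjE)
  from bspec[OF bspec[OF this c, unfolded case_prod_conv] c', unfolded case_prod_conv, THEN bspec, of q] q v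
  show ?thesis by simp
qed

end

text \<open>
  For an arbitrary family \<open>\<alpha>\<close>, not yet known to be a form, the pullback can be evaluated only in the
  chart that \<^const>\<open>pull_local\<close> selects. This is needed for \<open>ext_deriv\<close> and for \<open>pullback\<close>.
\<close>

lemma pull_local_some_chart:
  assumes M: "smooth_manifold M" and p: "g x \<in> topspace (mtop M)"
  obtains U \<phi> where "(U, \<phi>) \<in> atlas M" "g x \<in> U" "(SOME c. c \<in> atlas M \<and> g x \<in> fst c) = (U, \<phi>)"
    "\<And>d \<alpha> v. pull_local M d g \<alpha> x v = \<alpha> (U, \<phi>) (\<phi> (g x)) (\<lambda>j. differential d (\<phi> \<circ> g) x (v j))"
proof -
  have "\<exists>c. c \<in> atlas M \<and> g x \<in> fst c"
    using chart_at[OF M p] by (metis fst_conv)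
  then have "(SOME c. c \<in> atlas M \<and> g x \<in> fst c) \<in> atlas M \<and> g x \<in> fst (SOME c. c \<in> atlas M \<and> g x \<in> fst c)"
    by (rule someI_ex)
  then show thesis
    by (cases "SOME c. c \<in> atlas M \<and> g x \<in> fst c") (auto intro!: that simp: pull_local_def)
qed

text \<open>
  For forms the selected chart is immaterial: the transition rule of the form matches the chain rule
  for the change of chart.
\<close>

lemma pull_local_in_chart:
  assumes M: "smooth_manifold M" and g: "smooth_from d W M g" and \<alpha>: "\<alpha> \<in> smooth_forms p M"
    and c: "(U, \<phi>) \<in> atlas M" and x: "x \<in> W" "g x \<in> U"
  shows "pull_local M d g \<alpha> x v = \<alpha> (U, \<phi>) (\<phi> (g x)) (\<lambda>j. differential d (\<phi> \<circ> g) x (v j))"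
proof -
  obtain V \<psi> where c': "(V, \<psi>) \<in> atlas M" "g x \<in> V"
    "\<And>d \<alpha> v. pull_local M d g \<alpha> x v = \<alpha> (V, \<psi>) (\<psi> (g x)) (\<lambda>j. differential d (\<psi> \<circ> g) x (v j))"
    by (rule pull_local_some_chart[where g = g and x = x, OF M smooth_from_in_topspace[OF M g x(1)]]) (rule that)
  show ?thesis
    using smooth_forms_change_chart[OF \<alpha> c c'(1) x(2) c'(2), of "\<lambda>j. differential d (\<phi> \<circ> g) x (v j)"]
      differential_change_chart[OF M g c c'(1) x c'(2)] differential_in_R_pow[OF M g c x] c'(3) by simp
qed

lemma pull_local_alternating:
  assumes M: "smooth_manifold M" and g: "smooth_from d W M g" and \<alpha>: "\<alpha> \<in> smooth_forms p M" and x: "x \<in> W"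
  shows "alternating_multilinear d p (pull_local M d g \<alpha> x)"
proof -
  obtain U \<phi> where c: "(U, \<phi>) \<in> atlas M" "g x \<in> U"
    using chart_at[OF M smooth_from_in_topspace[OF M g x]] by blast
  let ?D = "differential d (\<phi> \<circ> g) x"
  note am = smooth_forms_alternating[OF \<alpha> c(1) imageI[OF c(2)]]
  note R = differential_in_R_pow[OF M g c(1) x c(2)]
  have upd: "(\<lambda>l. ?D ((v(j := u)) l)) = (\<lambda>l. ?D (v l))(j := ?D u)" for v j u by auto
  show ?thesis
    unfolding alternating_multilinear_def pull_local_in_chart[OF M g \<alpha> c(1) x c(2)]
  proof (intro conjI allI impI ballI)
    fix v w :: "nat \<Rightarrow> nat \<Rightarrow> real" assume "\<forall>j<p. v j \<in> R_pow d \<and> v j = w j"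
    then show "\<alpha> (U, \<phi>) (\<phi> (g x)) (\<lambda>j. ?D (v j)) = \<alpha> (U, \<phi>) (\<phi> (g x)) (\<lambda>j. ?D (w j))"
      by (intro am_cong[OF am] R) simp
  next
    fix v :: "nat \<Rightarrow> nat \<Rightarrow> real" and j u w a b assume "j < p"
    then show "\<alpha> (U, \<phi>) (\<phi> (g x)) (\<lambda>l. ?D ((v(j := \<lambda>i. a * u i + b * w i)) l))
        = a * \<alpha> (U, \<phi>) (\<phi> (g x)) (\<lambda>l. ?D ((v(j := u)) l)) + b * \<alpha> (U, \<phi>) (\<phi> (g x)) (\<lambda>l. ?D ((v(j := w)) l))"
      unfolding upd differential_linear by (intro am_linear[OF am] R)
  next
    fix v :: "nat \<Rightarrow> nat \<Rightarrow> real" and i j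
    assume "i < p" "j < p" "(\<forall>l<p. v l \<in> R_pow d) \<and> i \<noteq> j \<and> v i = v j"
    then show "\<alpha> (U, \<phi>) (\<phi> (g x)) (\<lambda>j. ?D (v j)) = 0"
      using am_alternating[OF am, of i j "\<lambda>j. ?D (v j)"] R by simp
  qed
qed

lemma pull_local_expansion:
  assumes M: "smooth_manifold M" and g: "smooth_from d W M g" and \<alpha>: "\<alpha> \<in> smooth_forms p M"
    and c: "(U, \<phi>) \<in> atlas M" and x: "x \<in> W" "g x \<in> U"
  shows "pull_local M d g \<alpha> x v = (\<Sum>I\<in>PiE {..<p} (\<lambda>_. {..<mdim M}).
    (\<Prod>j<p. dir_deriv d (\<lambda>y. \<phi> (g y) (I j)) x (v j)) * \<alpha> (U, \<phi>) (\<phi> (g x)) (\<lambda>j. unit_vec (I j)))"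
  unfolding pull_local_in_chart[OF assms]
  by (subst am_expansion[OF smooth_forms_alternating[OF \<alpha> c imageI[OF x(2)]]])
     (simp_all only: differential_in_R_pow[OF M g c x], simp only: differential_def comp_def)

lemma unit_vec_PiE_in_R_pow: "I \<in> PiE {..<p} (\<lambda>_. {..<m}) \<Longrightarrow> j < p \<Longrightarrow> unit_vec (I j) \<in> R_pow m"
  using PiE_mem[of I "{..<p}" "\<lambda>_. {..<m}" j] by simp

lemma pull_local_smooth:
  assumes M: "smooth_manifold M" and g: "smooth_from d W M g" and \<alpha>: "\<alpha> \<in> smooth_forms p M"
  shows "Ck_on k d W (\<lambda>x. pull_local M d g \<alpha> x v)"
proof (rule Ck_on_local[OF openin_Euclidean_subset[OF smooth_from_openin[OF M g]]])
  fix x assume x: "x \<in> W"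
  obtain U \<phi> where c: "(U, \<phi>) \<in> atlas M" "g x \<in> U"
    using chart_at[OF M smooth_from_in_topspace[OF M g x]] by blast
  let ?V = "{x \<in> W. g x \<in> U}"
  note V = smooth_from_openin_preimage[OF M g chart_openin[OF M c(1)]]
  have "Ck_on k d ?V (\<lambda>x. pull_local M d g \<alpha> x v)"
  proof (rule Ck_on_cong[OF V])
    show "Ck_on k d ?V (\<lambda>x. \<Sum>I\<in>PiE {..<p} (\<lambda>_. {..<mdim M}).
      (\<Prod>j<p. dir_deriv d (\<lambda>y. \<phi> (g y) (I j)) x (v j)) * \<alpha> (U, \<phi>) (\<phi> (g x)) (\<lambda>j. unit_vec (I j)))"
    proof (intro Ck_on_sum[OF V] Ck_on_mult[OF V] Ck_on_prod[OF V] Ck_on_dir_deriv[OF V] smooth_from_chart[OF M g c(1)])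
      fix I assume "I \<in> PiE {..<p} (\<lambda>_. {..<mdim M})"
      then show "Ck_on k d ?V (\<lambda>x. \<alpha> (U, \<phi>) (\<phi> (g x)) (\<lambda>j. unit_vec (I j)))"
        by (intro Ck_on_compose[OF V chart_openin_image[OF M c(1)] smooth_forms_Ck_on[OF \<alpha> c(1)] smooth_from_chart[OF M g c(1)]])
           (auto intro: unit_vec_PiE_in_R_pow)
    qed
  qed (use pull_local_expansion[OF M g \<alpha> c(1)] in auto)
  with V x c(2) show "\<exists>V. openin (Euclidean_space d) V \<and> x \<in> V \<and> V \<subseteq> W \<and> Ck_on k d V (\<lambda>x. pull_local M d g \<alpha> x v)"
    by (intro exI[of _ ?V]) auto
qed

text \<open>
  Product rule for the pullback on constant vectors: the first term differentiates the form at a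
  frozen frame, the others the frame \<open>Dg v\<^sub>q\<close>, which contributes second derivatives of \<open>g\<close>.
\<close>

lemma dir_deriv_pull_local:
  assumes M: "smooth_manifold M" and g: "smooth_from d W M g" and \<alpha>: "\<alpha> \<in> smooth_forms p M"
    and c: "(U, \<phi>) \<in> atlas M" and x: "x \<in> W" "g x \<in> U"
  defines "D \<equiv> differential d (\<phi> \<circ> g) x"
  shows "dir_deriv d (\<lambda>y. pull_local M d g \<alpha> y v) x u =
      dir_deriv (mdim M) (\<lambda>z. \<alpha> (U, \<phi>) z (\<lambda>j. D (v j))) (\<phi> (g x)) (D u)
    + (\<Sum>q<p. \<alpha> (U, \<phi>) (\<phi> (g x))
         ((\<lambda>j. D (v j))(q := (\<lambda>i. dir_deriv d (\<lambda>y. dir_deriv d (\<lambda>y. \<phi> (g y) i) y (v q)) x u))))"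
proof -
  let ?V = "{x \<in> W. g x \<in> U}" and ?m = "mdim M"
  let ?P = "PiE {..<p} (\<lambda>_. {..<?m})"
  note V = smooth_from_openin_preimage[OF M g chart_openin[OF M c]]
  have xV: "x \<in> ?V" using x by simp
  define G where "G = (\<lambda>i y. \<phi> (g y) i)"
  define a where "a = (\<lambda>I z. \<alpha> (U, \<phi>) z (\<lambda>j. unit_vec (I j)))"
  define H where "H = (\<lambda>q i. dir_deriv d (\<lambda>y. dir_deriv d (G i) y (v q)) x u)"
  have DG: "D w i = dir_deriv d (G i) x w" for w i
    by (simp add: D_def differential_def G_def)
  have DR: "D w \<in> R_pow ?m" for w
    unfolding D_def by (rule differential_in_R_pow[OF M g c x])
  have HR: "H q \<in> R_pow ?m" for q
    unfolding H_def G_def by (rule second_derivative_in_R_pow[OF M g c x])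
  have Gs: "Ck_on k d ?V (G i)" for k i
    unfolding G_def by (rule smooth_from_chart[OF M g c])
  have as: "Ck_on k ?m (\<phi> ` U) (a I)" if "I \<in> ?P" for k I
    unfolding a_def by (rule smooth_forms_Ck_on[OF \<alpha> c unit_vec_PiE_in_R_pow[OF that]])
  have aGs: "Ck_on k d ?V (\<lambda>y. a I (\<phi> (g y)))" if "I \<in> ?P" for k I
    by (rule Ck_on_compose[OF V chart_openin_image[OF M c] as[OF that] smooth_from_chart[OF M g c]]) auto
  have am: "alternating_multilinear ?m p (\<alpha> (U, \<phi>) z)" if "z \<in> \<phi> ` U" for z
    by (rule smooth_forms_alternating[OF \<alpha> c that])
  have gU: "\<phi> (g x) \<in> \<phi> ` U" using x by blast
  have "dir_deriv d (\<lambda>y. pull_local M d g \<alpha> y v) x u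
      = dir_deriv d (\<lambda>y. \<Sum>I\<in>?P. (\<Prod>j<p. dir_deriv d (G (I j)) y (v j)) * a I (\<phi> (g y))) x u"
    by (rule dir_deriv_cong[OF V xV]) (simp add: pull_local_expansion[OF M g \<alpha> c] G_def a_def)
  also have "\<dots> = (\<Sum>I\<in>?P. dir_deriv d (\<lambda>y. (\<Prod>j<p. dir_deriv d (G (I j)) y (v j)) * a I (\<phi> (g y))) x u)"
    by (intro dir_deriv_sum[OF V xV] Ck_on_mult[OF V] Ck_on_prod[OF V] Ck_on_dir_deriv[OF V] Gs aGs)
  also have "\<dots> = (\<Sum>I\<in>?P. (\<Sum>q<p. H q (I q) * (\<Prod>j\<in>{..<p} - {q}. D (v j) (I j))) * a I (\<phi> (g x))
      + (\<Prod>j<p. D (v j) (I j)) * dir_deriv ?m (a I) (\<phi> (g x)) (D u))"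
  proof (rule sum.cong[OF refl])
    fix I assume I: "I \<in> ?P"
    have 1: "dir_deriv d (\<lambda>y. \<Prod>j<p. dir_deriv d (G (I j)) y (v j)) x u
        = (\<Sum>q<p. H q (I q) * (\<Prod>j\<in>{..<p} - {q}. D (v j) (I j)))"
      unfolding H_def DG by (intro dir_deriv_prod[OF V xV] Ck_on_dir_deriv[OF V] Gs) simp
    have 2: "dir_deriv d (\<lambda>y. a I (\<phi> (g y))) x u = dir_deriv ?m (a I) (\<phi> (g x)) (D u)"
      using dir_deriv_compose[OF V chart_openin_image[OF M c] as[OF I, of "Suc 0"] smooth_from_chart[OF M g c], where x = x and w = u] xV
      by (auto simp: D_def comp_def)
    show "dir_deriv d (\<lambda>y. (\<Prod>j<p. dir_deriv d (G (I j)) y (v j)) * a I (\<phi> (g y))) x u =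
        (\<Sum>q<p. H q (I q) * (\<Prod>j\<in>{..<p} - {q}. D (v j) (I j))) * a I (\<phi> (g x))
      + (\<Prod>j<p. D (v j) (I j)) * dir_deriv ?m (a I) (\<phi> (g x)) (D u)"
      by (subst dir_deriv_mult[OF V Ck_on_prod[OF V Ck_on_dir_deriv[OF V Gs]] aGs[OF I] xV]) (simp only: 1 2 DG)
  qed
  also have "\<dots> = (\<Sum>I\<in>?P. \<Sum>q<p. (\<Prod>j<p. ((\<lambda>j. D (v j))(q := H q)) j (I j)) * a I (\<phi> (g x)))
      + (\<Sum>I\<in>?P. (\<Prod>j<p. D (v j) (I j)) * dir_deriv ?m (a I) (\<phi> (g x)) (D u))"
  proof -
    have "(\<Prod>j<p. ((\<lambda>j. D (v j))(q := H q)) j (I j)) = H q (I q) * (\<Prod>j\<in>{..<p} - {q}. D (v j) (I j))" if "q < p" for q I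
      using that by (subst prod.remove[of _ q]) (auto intro!: prod.cong)
    then show ?thesis by (simp add: sum.distrib sum_distrib_right)
  qed
  also have "(\<Sum>I\<in>?P. \<Sum>q<p. (\<Prod>j<p. ((\<lambda>j. D (v j))(q := H q)) j (I j)) * a I (\<phi> (g x)))
      = (\<Sum>q<p. \<alpha> (U, \<phi>) (\<phi> (g x)) ((\<lambda>j. D (v j))(q := H q)))"
  proof (subst sum.swap, rule sum.cong[OF refl])
    fix q
    show "(\<Sum>I\<in>?P. (\<Prod>j<p. ((\<lambda>j. D (v j))(q := H q)) j (I j)) * a I (\<phi> (g x))) = \<alpha> (U, \<phi>) (\<phi> (g x)) ((\<lambda>j. D (v j))(q := H q))"
      unfolding a_def by (rule am_expansion[OF am[OF gU], symmetric]) (use DR HR in simp)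
  qed
  also have "(\<Sum>I\<in>?P. (\<Prod>j<p. D (v j) (I j)) * dir_deriv ?m (a I) (\<phi> (g x)) (D u))
      = dir_deriv ?m (\<lambda>z. \<alpha> (U, \<phi>) z (\<lambda>j. D (v j))) (\<phi> (g x)) (D u)"
  proof -
    note V' = chart_openin_image[OF M c]
    have "dir_deriv ?m (\<lambda>z. \<alpha> (U, \<phi>) z (\<lambda>j. D (v j))) (\<phi> (g x)) (D u)
        = dir_deriv ?m (\<lambda>z. \<Sum>I\<in>?P. (\<Prod>j<p. D (v j) (I j)) * a I z) (\<phi> (g x)) (D u)"
      unfolding a_def by (rule dir_deriv_cong[OF V' gU]) (rule am_expansion[OF am DR])
    also have "\<dots> = (\<Sum>I\<in>?P. dir_deriv ?m (\<lambda>z. (\<Prod>j<p. D (v j) (I j)) * a I z) (\<phi> (g x)) (D u))"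
      by (intro dir_deriv_sum[OF V' gU] Ck_on_mult[OF V'] as Ck_on_const openin_Euclidean_subset[OF V'])
    also have "\<dots> = (\<Sum>I\<in>?P. (\<Prod>j<p. D (v j) (I j)) * dir_deriv ?m (a I) (\<phi> (g x)) (D u))"
      by (intro sum.cong refl dir_deriv_cmult[OF V' as gU])
    finally show ?thesis by simp
  qed
  finally show ?thesis unfolding H_def G_def by (simp only: add.commute)
qed

text \<open>
  Naturality of the exterior derivative. The second derivatives of \<open>g\<close> cancel in the alternating sum
  because they are symmetric while the form is alternating.
\<close>

lemma pull_local_ext_deriv:
  assumes M: "smooth_manifold M" and g: "smooth_from d W M g" and \<alpha>: "\<alpha> \<in> smooth_forms p M" and x: "x \<in> W"
  shows "pull_local M d g (ext_deriv p M \<alpha>) x v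
     = (\<Sum>j\<le>p. (-1) ^ j * dir_deriv d (\<lambda>y. pull_local M d g \<alpha> y (omit j v)) x (v j))"
proof -
  obtain U \<phi> where c: "(U, \<phi>) \<in> atlas M" "g x \<in> U" and
    P: "\<And>d \<alpha> v. pull_local M d g \<alpha> x v = \<alpha> (U, \<phi>) (\<phi> (g x)) (\<lambda>j. differential d (\<phi> \<circ> g) x (v j))"
    by (rule pull_local_some_chart[where g = g and x = x, OF M smooth_from_in_topspace[OF M g x]]) (rule that)
  define D where "D = differential d (\<phi> \<circ> g) x"
  define H where "H = (\<lambda>u v i. dir_deriv d (\<lambda>y. dir_deriv d (\<lambda>y. \<phi> (g y) i) y v) x u)"
  have DR: "D w \<in> R_pow (mdim M)" for w
    unfolding D_def by (rule differential_in_R_pow[OF M g c(1) x c(2)])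
  let ?V = "{x \<in> W. g x \<in> U}"
  note V = smooth_from_openin_preimage[OF M g chart_openin[OF M c(1)]]
  have xV: "x \<in> ?V" using x c by simp
  have Hsym: "H u w = H w u" for u w
    unfolding H_def by (intro ext dir_deriv_commute[OF V smooth_from_chart[OF M g c(1)] xV])
  have HR: "H u w \<in> R_pow (mdim M)" for u w
    unfolding H_def by (rule second_derivative_in_R_pow[OF M g c(1) x c(2)])
  define f where "f = \<alpha> (U, \<phi>) (\<phi> (g x))"
  have am: "alternating_multilinear (mdim M) p f"
    unfolding f_def by (rule smooth_forms_alternating[OF \<alpha> c(1) imageI[OF c(2)]])
  have om: "omit j (\<lambda>i. D (v i)) = (\<lambda>i. D (omit j v i))" for j
    by (auto simp: omit_def)
  let ?S = "\<lambda>j q. f (case_nat (H (v j) (omit j v q)) (omit q (\<lambda>i. D (omit j v i))))"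
  have second: "f ((\<lambda>i. D (omit j v i))(q := H (v j) (omit j v q))) = (-1) ^ q * ?S j q" if "q < p" for j q
  proof -
    have "omit q ((\<lambda>i. D (omit j v i))(q := H (v j) (omit j v q))) = omit q (\<lambda>i. D (omit j v i))"
      by (auto simp: omit_def fun_eq_iff)
    then show ?thesis
      using am_move_to_front[OF am that, of "(\<lambda>i. D (omit j v i))(q := H (v j) (omit j v q))"] DR HR by simp
  qed
  have "pull_local M d g (ext_deriv p M \<alpha>) x v
      = (\<Sum>j\<le>p. (-1) ^ j * dir_deriv (mdim M) (\<lambda>z. \<alpha> (U, \<phi>) z (\<lambda>i. D (omit j v i))) (\<phi> (g x)) (D (v j)))"
    unfolding P ext_deriv_def D_def[symmetric] om[symmetric] by (simp add: omit_def)
  also have "\<dots> = (\<Sum>j\<le>p. (-1) ^ j * dir_deriv d (\<lambda>y. pull_local M d g \<alpha> y (omit j v)) x (v j)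
      - (\<Sum>q<p. (-1) ^ (j + q) * ?S j q))"
  proof (rule sum.cong[OF refl])
    fix j
    have "dir_deriv d (\<lambda>y. pull_local M d g \<alpha> y (omit j v)) x (v j)
       = dir_deriv (mdim M) (\<lambda>z. \<alpha> (U, \<phi>) z (\<lambda>i. D (omit j v i))) (\<phi> (g x)) (D (v j)) + (\<Sum>q<p. (-1) ^ q * ?S j q)"
    proof -
      have "dir_deriv d (\<lambda>y. pull_local M d g \<alpha> y (omit j v)) x (v j)
       = dir_deriv (mdim M) (\<lambda>z. \<alpha> (U, \<phi>) z (\<lambda>i. D (omit j v i))) (\<phi> (g x)) (D (v j))
        + (\<Sum>q<p. f ((\<lambda>i. D (omit j v i))(q := H (v j) (omit j v q))))"
        unfolding dir_deriv_pull_local[OF M g \<alpha> c(1) x c(2)] D_def H_def f_def ..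
      then show ?thesis using second by simp
    qed
    then show "(-1) ^ j * dir_deriv (mdim M) (\<lambda>z. \<alpha> (U, \<phi>) z (\<lambda>i. D (omit j v i))) (\<phi> (g x)) (D (v j))
      = (-1) ^ j * dir_deriv d (\<lambda>y. pull_local M d g \<alpha> y (omit j v)) x (v j) - (\<Sum>q<p. (-1) ^ (j + q) * ?S j q)"
      by (simp add: distrib_left sum_distrib_left power_add mult.assoc)
  qed
  also have "\<dots> = (\<Sum>j\<le>p. (-1) ^ j * dir_deriv d (\<lambda>y. pull_local M d g \<alpha> y (omit j v)) x (v j))
      - (\<Sum>j\<le>p. \<Sum>q<p. (-1) ^ (j + q) * ?S j q)"
    by (rule sum_subtractf)
  also have "(\<Sum>j\<le>p. \<Sum>q<p. (-1) ^ (j + q) * ?S j q) = 0"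
  proof (rule alternating_double_sum_eq_0)
    fix j q :: nat assume qj: "q < j"
    have 1: "omit j v q = v q" "omit q v (j - 1) = v j"
      using qj by (auto simp: omit_def)
    have 2: "omit q (\<lambda>i. D (omit j v i)) = omit (j - 1) (\<lambda>i. D (omit q v i))"
      using qj by (auto simp: omit_def fun_eq_iff)
    show "?S j q = ?S q (j - 1)"
      unfolding 1 2 Hsym[of "v j"] ..
  qed
  finally show ?thesis by simp
qed

lemma pull_local_precompose:
  assumes M: "smooth_manifold M" and g: "smooth_from d W M g" and \<alpha>: "\<alpha> \<in> smooth_forms p M"
    and V: "openin (Euclidean_space e) V"
    and \<iota>: "\<And>x. x \<in> V \<Longrightarrow> \<iota> x \<in> W" "\<And>j k. j < d \<Longrightarrow> Ck_on k e V (\<lambda>x. \<iota> x j)" and x: "x \<in> V"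
  shows "pull_local M e (g \<circ> \<iota>) \<alpha> x v = pull_local M d g \<alpha> (\<iota> x) (\<lambda>j. differential e \<iota> x (v j))"
proof -
  note g' = smooth_from_precompose[OF M g V \<iota>]
  obtain U \<phi> where c: "(U, \<phi>) \<in> atlas M" "g (\<iota> x) \<in> U"
    using chart_at[OF M smooth_from_in_topspace[OF M g \<iota>(1)[OF x]]] by blast
  let ?A = "{y \<in> V. (g \<circ> \<iota>) y \<in> U}"
  note A = smooth_from_openin_preimage[OF M g' chart_openin[OF M c(1)]]
  note B = smooth_from_openin_preimage[OF M g chart_openin[OF M c(1)]]
  have "differential e (\<phi> \<circ> (g \<circ> \<iota>)) x w = differential d (\<phi> \<circ> g) (\<iota> x) (differential e \<iota> x w)" for w
  proof
    fix i
    have "dir_deriv e (\<lambda>y. \<phi> (g (\<iota> y)) i) x w = dir_deriv d (\<lambda>y. \<phi> (g y) i) (\<iota> x) (differential e \<iota> x w)"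
    proof (rule dir_deriv_compose[OF A B smooth_from_chart[OF M g c(1)]])
      show "Ck_on (Suc 0) e ?A (\<lambda>x. \<iota> x j)" if "j < d" for j
        by (rule Ck_on_subset[OF openin_Euclidean_subset[OF V] \<iota>(2)[OF that]]) auto
    qed (use \<iota>(1) x c in auto)
    then show "differential e (\<phi> \<circ> (g \<circ> \<iota>)) x w i = differential d (\<phi> \<circ> g) (\<iota> x) (differential e \<iota> x w) i"
      by (simp add: differential_def[of _ "\<phi> \<circ> _"])
  qed
  then show ?thesis
    using pull_local_in_chart[OF M g' \<alpha> c(1) x, of v] pull_local_in_chart[OF M g \<alpha> c(1) \<iota>(1)[OF x] c(2)] c(2)
    by simp
qed

text \<open>
  Both sides evaluate \<open>\<omega>\<close> in the chart of \<open>N\<close> selected at the point \<open>F (g x)\<close>, so \<open>\<omega>\<close> may be any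
  family; only the differentials have to be compared.
\<close>

lemma pull_local_pullback:
  assumes M: "smooth_manifold M" and N: "smooth_manifold N" and F: "smooth_map M N F"
    and g: "smooth_from d W M g" and x: "x \<in> W"
  shows "pull_local N d (F \<circ> g) \<omega> x v = pull_local M d g (pullback M N F \<omega>) x v"
proof -
  note Fg = smooth_from_compose_smooth_map[OF M N g F]
  obtain U \<phi> where c: "(U, \<phi>) \<in> atlas M" "g x \<in> U" and
    P: "\<And>d \<alpha> v. pull_local M d g \<alpha> x v = \<alpha> (U, \<phi>) (\<phi> (g x)) (\<lambda>j. differential d (\<phi> \<circ> g) x (v j))"
    by (rule pull_local_some_chart[where g = g and x = x, OF M smooth_from_in_topspace[OF M g x]]) (rule that)
  obtain V \<psi> where c': "(V, \<psi>) \<in> atlas N" "(F \<circ> g) x \<in> V" and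
    S: "(SOME c. c \<in> atlas N \<and> (F \<circ> g) x \<in> fst c) = (V, \<psi>)"
    by (rule pull_local_some_chart[where g = "F \<circ> g" and x = x, OF N smooth_from_in_topspace[OF N Fg x]]) (rule that)
  have inv: "inv_into U \<phi> (\<phi> (g x)) = g x"
    by (rule chart_inv[OF M c])
  define A where "A = {p \<in> U. F p \<in> V}"
  have A: "openin (mtop M) A" "A \<subseteq> U"
    using smooth_map_in_charts(1)[OF M N F c(1) c'(1)] by (auto simp: A_def)
  have sm: "Ck_on 1 (mdim M) (\<phi> ` A) (\<lambda>z. \<psi> (F (inv_into U \<phi> z)) i)" for i
    unfolding A_def by (rule smooth_map_in_charts(2)[OF M N F c(1) c'(1)])
  have D: "differential d (\<psi> \<circ> (F \<circ> g)) x w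
      = differential (mdim M) (\<psi> \<circ> (F \<circ> inv_into U \<phi>)) (\<phi> (g x)) (differential d (\<phi> \<circ> g) x w)" for w
  proof
    fix i show "differential d (\<psi> \<circ> (F \<circ> g)) x w i
      = differential (mdim M) (\<psi> \<circ> (F \<circ> inv_into U \<phi>)) (\<phi> (g x)) (differential d (\<phi> \<circ> g) x w) i"
    using dir_deriv_through_chart[OF M g c(1) A sm[of i] _ x, of w] c c'
    by (simp add: differential_def[of _ "\<psi> \<circ> _"] A_def)
  qed
  have S': "(SOME c. c \<in> atlas N \<and> F (g x) \<in> fst c) = (V, \<psi>)" using S by simp
  have "pull_local M d g (pullback M N F \<omega>) x v
      = pull_local N (mdim M) (F \<circ> inv_into U \<phi>) \<omega> (\<phi> (g x)) (\<lambda>j. differential d (\<phi> \<circ> g) x (v j))"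
    by (simp add: P pullback_def)
  then show ?thesis
    by (simp add: pull_local_def inv S' D)
qed

section \<open>Integration over the solid simplex\<close>

definition insert_coord :: "nat \<Rightarrow> 'a \<Rightarrow> (nat \<Rightarrow> 'a) \<Rightarrow> nat \<Rightarrow> 'a" where
  "insert_coord i s t = (\<lambda>j. if j < i then t j else if j = i then s else t (j - 1))"

text \<open>Points of the product measure space are undefined from index \<open>k\<close> on; this moves them to R^k.\<close>

definition truncate :: "nat \<Rightarrow> (nat \<Rightarrow> real) \<Rightarrow> nat \<Rightarrow> real" where
  "truncate k t = (\<lambda>i. if i < k then t i else 0)"

definition solid_simplex :: "nat \<Rightarrow> (nat \<Rightarrow> real) set" where
  "solid_simplex k = {x \<in> R_pow k. (\<forall>j<k. 0 \<le> x j) \<and> (\<Sum>j<k. x j) \<le> 1}"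

text \<open>
  This set constrains only the first \<open>k\<close> coordinates, so it also applies to points of the product
  measure space.
\<close>

definition open_simplex :: "nat \<Rightarrow> (nat \<Rightarrow> real) set" where
  "open_simplex k = {t. (\<forall>j<k. 0 < t j) \<and> (\<Sum>j<k. t j) < 1}"

abbreviation lborel_pow :: "nat \<Rightarrow> (nat \<Rightarrow> real) measure" where
  "lborel_pow k \<equiv> PiM {..<k} (\<lambda>_. lborel)"

interpretation lborel_pow: product_sigma_finite "\<lambda>_::nat. lborel :: real measure"
  by standard

lemma truncate_R_pow [simp]: "truncate k t \<in> R_pow k"
  by (simp add: R_pow_iff truncate_def)

lemma truncate_simplex: "t \<in> open_simplex k \<Longrightarrow> truncate k t \<in> solid_simplex k"
  by (auto simp: solid_simplex_def open_simplex_def truncate_def R_pow_iff less_imp_le)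

lemma insert_coord_R_pow: "i \<le> p \<Longrightarrow> t \<in> R_pow p \<Longrightarrow> insert_coord i s t \<in> R_pow (Suc p)"
  by (auto simp: R_pow_iff insert_coord_def)

lemma insert_coord_upd [simp]: "(insert_coord i s t)(i := r) = insert_coord i r t"
  by (auto simp: insert_coord_def)

lemma insert_coord_same [simp]: "insert_coord i s t i = s"
  by (simp add: insert_coord_def)

text \<open>The index at which \<^const>\<open>insert_coord\<close> puts the \<open>j\<close>-th of the old coordinates.\<close>

definition skip :: "nat \<Rightarrow> nat \<Rightarrow> nat" where
  "skip i j = (if j < i then j else Suc j)"

lemma skip_neq [simp]: "skip i j \<noteq> i"
  by (auto simp: skip_def)

lemma inj_skip: "inj_on (skip i) A"
  by (auto simp: inj_on_def skip_def split: if_splits)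

lemma insert_coord_skip [simp]: "insert_coord i s t (skip i j) = t j"
  by (auto simp: insert_coord_def skip_def)

lemma skip_image: "i \<le> p \<Longrightarrow> {..<Suc p} = insert i (skip i ` {..<p})"
proof (intro equalityI subsetI)
  fix j assume "i \<le> p" "j \<in> {..<Suc p}"
  then show "j \<in> insert i (skip i ` {..<p})"
    by (cases "j < i"; cases "j = i") (auto simp: skip_def intro!: image_eqI[of _ _ "if j < i then j else j - 1"])
qed (auto simp: skip_def)

lemma prod_skip:
  fixes f :: "nat \<Rightarrow> 'a::comm_monoid_mult"
  assumes "i \<le> p"
  shows "(\<Prod>j<Suc p. f j) = f i * (\<Prod>j<p. f (skip i j))"
proof -
  have "i \<notin> skip i ` {..<p}" by (metis imageE skip_neq)
  then show ?thesis
    unfolding skip_image[OF assms] by (simp add: prod.reindex[OF inj_skip] comp_def)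
qed

lemma sum_skip:
  fixes f :: "nat \<Rightarrow> 'a::comm_monoid_add"
  assumes "i \<le> p"
  shows "(\<Sum>j<Suc p. f j) = f i + (\<Sum>j<p. f (skip i j))"
proof -
  have "i \<notin> skip i ` {..<p}" by (metis imageE skip_neq)
  then show ?thesis
    unfolding skip_image[OF assms] by (simp add: sum.reindex[OF inj_skip] comp_def)
qed

lemma all_skip:
  assumes "i \<le> p"
  shows "(\<forall>j\<in>{..<Suc p}. P j) \<longleftrightarrow> P i \<and> (\<forall>j<p. P (skip i j))"
  unfolding skip_image[OF assms] by auto

lemma sum_insert_coord: "i \<le> p \<Longrightarrow> (\<Sum>j<Suc p. insert_coord i s t j) = s + (\<Sum>j<p. t j :: real)"
  by (simp only: sum_skip insert_coord_skip insert_coord_same)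

lemma insert_coord_simplex_iff:
  assumes "i \<le> p"
  shows "insert_coord i s t \<in> open_simplex (Suc p) \<longleftrightarrow> t \<in> open_simplex p \<and> s \<in> {0<..<1 - (\<Sum>j<p. t j)}"
  using all_skip[OF assms, of "\<lambda>j. 0 < insert_coord i s t j"]
  unfolding open_simplex_def mem_Collect_eq sum_insert_coord[OF assms] by auto

lemma insert_coord_solid_simplex:
  assumes "i \<le> p" "t \<in> solid_simplex p" "0 \<le> s" "s \<le> 1 - (\<Sum>j<p. t j)"
  shows "insert_coord i s t \<in> solid_simplex (Suc p)"
  using assms insert_coord_R_pow[of i p t s] all_skip[OF assms(1), of "\<lambda>j. 0 \<le> insert_coord i s t j"]
  unfolding solid_simplex_def mem_Collect_eq sum_insert_coord[OF assms(1)] by auto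

lemma continuous_on_coord: "continuous_on S (\<lambda>t. t k :: real)" for k :: nat
  using continuous_on_product_coordinates by (rule continuous_on_subset) simp

lemma continuous_on_insert_coord:
  fixes t :: "'b::topological_space \<Rightarrow> nat \<Rightarrow> real"
  assumes "continuous_on S s" "\<And>j. continuous_on S (\<lambda>x. t x j)"
  shows "continuous_on S (\<lambda>x. insert_coord i (s x) (t x))"
proof (rule continuous_on_coordinatewise_then_product)
  fix k
  have eq: "(\<lambda>x. insert_coord i (s x) (t x) k)
      = (if k < i then (\<lambda>x. t x k) else if k = i then s else (\<lambda>x. t x (k - 1)))"
    by (auto simp: insert_coord_def)
  show "continuous_on S (\<lambda>x. insert_coord i (s x) (t x) k)"
    unfolding eq using assms by (simp split: if_split)
qed

lemma solid_simplex_subset: "solid_simplex k \<subseteq> R_pow k"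
  by (auto simp: solid_simplex_def)

lemma compact_solid_simplex: "compact (solid_simplex k)"
proof -
  have box: "compact (PiE UNIV (\<lambda>_::nat. {0..1::real}))"
    using compactin_PiE[of "\<lambda>_. euclideanreal" UNIV "\<lambda>_::nat. {0..1}"] by (simp add: euclidean_product_topology)
  have "closed (\<Inter>i\<in>{k..}. {x::nat \<Rightarrow> real. x i = 0})"
    by (intro closed_INT ballI closed_Collect_eq continuous_on_product_coordinates continuous_on_const)
  moreover have "closed (\<Inter>j\<in>{..<k}. {x::nat \<Rightarrow> real. 0 \<le> x j})"
    by (intro closed_INT ballI closed_Collect_le continuous_on_product_coordinates continuous_on_const)
  moreover have "closed {x::nat \<Rightarrow> real. (\<Sum>j<k. x j) \<le> 1}"
    by (intro closed_Collect_le continuous_on_sum continuous_on_product_coordinates continuous_on_const)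
  ultimately have cl: "closed ((\<Inter>i\<in>{k..}. {x::nat \<Rightarrow> real. x i = 0}) \<inter> (\<Inter>j\<in>{..<k}. {x. 0 \<le> x j}) \<inter> {x. (\<Sum>j<k. x j) \<le> 1})"
    by (intro closed_Int)
  have eq: "solid_simplex k = (\<Inter>i\<in>{k..}. {x::nat \<Rightarrow> real. x i = 0}) \<inter> (\<Inter>j\<in>{..<k}. {x. 0 \<le> x j}) \<inter> {x. (\<Sum>j<k. x j) \<le> 1}"
    by (auto simp: solid_simplex_def R_pow_iff)
  have "x j \<in> {0..1}" if "x \<in> solid_simplex k" for x j
  proof (cases "j < k")
    case True
    then have "x j \<le> (\<Sum>j<k. x j)"
      using that by (intro member_le_sum) (auto simp: solid_simplex_def)
    with that True show ?thesis by (auto simp: solid_simplex_def)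
  qed (use that in \<open>auto simp: solid_simplex_def R_pow_iff\<close>)
  then have sub: "solid_simplex k \<subseteq> PiE UNIV (\<lambda>_::nat. {0..1::real})" by auto
  then have "solid_simplex k = PiE UNIV (\<lambda>_::nat. {0..1::real}) \<inter> solid_simplex k" by blast
  then show ?thesis
    using compact_Int_closed[OF box cl[folded eq]] by simp
qed

lemma truncate_measurable [measurable]: "truncate k \<in> borel_measurable (lborel_pow k)"
proof (rule measurable_coordinatewise_then_product)
  fix i show "(\<lambda>t. truncate k t i) \<in> borel_measurable (lborel_pow k)"
    unfolding truncate_def by (cases "i < k") auto
qed

lemma open_simplex_sets: "open_simplex k \<inter> space (lborel_pow k) \<in> sets (lborel_pow k)"
proof -
  have "{t \<in> space (lborel_pow k). (\<forall>j\<in>{..<k}. 0 < t j) \<and> (\<Sum>j<k. t j) < 1} \<in> sets (lborel_pow k)"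
    by measurable
  moreover have "{t \<in> space (lborel_pow k). (\<forall>j\<in>{..<k}. 0 < t j) \<and> (\<Sum>j<k. t j) < 1} = open_simplex k \<inter> space (lborel_pow k)"
    by (auto simp: open_simplex_def)
  ultimately show ?thesis by simp
qed

lemma integrable_on_simplex:
  assumes h: "continuous_on (solid_simplex k) h"
  shows "integrable (lborel_pow k) (\<lambda>t. indicator (open_simplex k) t * (h (truncate k t) :: real))"
proof -
  let ?S = "open_simplex k \<inter> space (lborel_pow k)"
  define h' where "h' = (\<lambda>x. indicator (solid_simplex k) x *\<^sub>R h x)"
  have "solid_simplex k \<in> sets borel"
    using compact_imp_closed[OF compact_solid_simplex] by (rule borel_closed)
  then have h': "h' \<in> borel_measurable borel"
    unfolding h'_def using h by (rule borel_measurable_continuous_on_indicator)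
  obtain B where B: "\<And>x. x \<in> solid_simplex k \<Longrightarrow> \<bar>h x\<bar> \<le> B"
    using compact_imp_bounded[OF compact_continuous_image[OF h compact_solid_simplex]]
    unfolding bounded_iff by auto
  have "integrable (lborel_pow k) (\<lambda>t. indicator ?S t *\<^sub>R h' (truncate k t))"
  proof (rule integrableI_bounded_set_indicator[OF open_simplex_sets, where B = B])
    show "(\<lambda>t. h' (truncate k t)) \<in> borel_measurable (lborel_pow k)"
      using h' by measurable
    show "AE x in lborel_pow k. x \<in> ?S \<longrightarrow> norm (h' (truncate k x)) \<le> B"
      using B truncate_simplex by (auto simp: h'_def)
    have "?S \<subseteq> PiE {..<k} (\<lambda>_. {0..1})"
    proof
      fix t assume t: "t \<in> ?S"
      have "t j \<in> {0..1}" if "j < k" for j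
      proof -
        have "t j \<le> (\<Sum>j<k. t j)"
          using t that by (intro member_le_sum) (auto simp: open_simplex_def less_imp_le)
        then show ?thesis using t that by (auto simp: open_simplex_def less_imp_le)
      qed
      then show "t \<in> PiE {..<k} (\<lambda>_. {0..1})" using t by (auto simp: space_PiM PiE_def)
    qed
    then have "emeasure (lborel_pow k) ?S \<le> emeasure (lborel_pow k) (PiE {..<k} (\<lambda>_. {0..1}))"
      by (intro emeasure_mono sets_PiM_I_finite) auto
    also have "\<dots> = (\<Prod>j<k. emeasure lborel {0..1::real})"
      by (intro lborel_pow.emeasure_PiM) auto
    also have "\<dots> < \<infinity>" by simp
    finally show "emeasure (lborel_pow k) ?S < \<infinity>" .
  qed
  also have "?this \<longleftrightarrow> ?thesis"
    by (rule Bochner_Integration.integrable_cong[OF refl]) (auto simp: h'_def indicator_def truncate_simplex)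
  finally show ?thesis .
qed

text \<open>
  Lebesgue measure on R^(p+1) with the \<open>i\<close>-th coordinate split off and the others renumbered, which
  is the form in which Fubini is needed for the faces of a simplex.
\<close>

lemma lborel_pow_insert_coord:
  assumes i: "i \<le> p"
  shows "distr (lborel \<Otimes>\<^sub>M lborel_pow p) (lborel_pow (Suc p)) (\<lambda>(s, t). restrict (insert_coord i s t) {..<Suc p}) = lborel_pow (Suc p)"
    (is "distr ?P ?Q ?f = _")
    and "(\<lambda>(s, t). restrict (insert_coord i s t) {..<Suc p}) \<in> lborel \<Otimes>\<^sub>M lborel_pow p \<rightarrow>\<^sub>M lborel_pow (Suc p)"
proof -
  interpret p: finite_product_sigma_finite "\<lambda>_::nat. lborel :: real measure" "{..<p}"
    by standard simp
  have comp: "(\<lambda>x. insert_coord i (fst x) (snd x) j) \<in> ?P \<rightarrow>\<^sub>M lborel" if "j < Suc p" for j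
  proof -
    consider "j < i" | "j = i" | "j > i" by linarith
    then show ?thesis
    proof cases
      case 1
      then have "j < p" using i by simp
      then have "(\<lambda>x. snd x j) \<in> ?P \<rightarrow>\<^sub>M lborel"
        by (intro measurable_compose[OF measurable_snd measurable_component_singleton]) simp
      then show ?thesis using 1 by (simp add: insert_coord_def)
    next
      case 2 then show ?thesis by (simp add: insert_coord_def)
    next
      case 3
      then have "j - 1 < p" using that by simp
      then have "(\<lambda>x. snd x (j - 1)) \<in> ?P \<rightarrow>\<^sub>M lborel"
        by (intro measurable_compose[OF measurable_snd measurable_component_singleton]) simp
      then show ?thesis using 3 by (simp add: insert_coord_def)
    qed
  qed
  show meas: "?f \<in> ?P \<rightarrow>\<^sub>M ?Q"
    unfolding case_prod_unfold by (intro measurable_restrict comp) simp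
  show "distr ?P ?Q ?f = ?Q"
  proof (rule lborel_pow.PiM_eqI)
    fix A :: "nat \<Rightarrow> real set" assume A: "\<And>j. j \<in> {..<Suc p} \<Longrightarrow> A j \<in> sets lborel"
    let ?k = "skip i"
    have Ak: "A (skip i j) \<in> sets lborel" if "j < p" for j
      using A[of "skip i j"] that by (auto simp: skip_def split: if_splits)
    have mem_iff: "restrict (insert_coord i s t) {..<Suc p} \<in> PiE {..<Suc p} A \<longleftrightarrow> s \<in> A i \<and> (\<forall>j<p. t j \<in> A (?k j))" for s t
    proof -
      have "restrict (insert_coord i s t) {..<Suc p} \<in> PiE {..<Suc p} A \<longleftrightarrow> (\<forall>j\<in>{..<Suc p}. insert_coord i s t j \<in> A j)"
        by (auto simp: PiE_iff)
      also have "\<dots> \<longleftrightarrow> s \<in> A i \<and> (\<forall>j<p. t j \<in> A (?k j))"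
        by (simp only: all_skip[OF i] insert_coord_skip insert_coord_same)
      finally show ?thesis .
    qed
    have "?f -` PiE {..<Suc p} A \<inter> space ?P = A i \<times> PiE {..<p} (\<lambda>j. A (?k j))"
    proof (rule Set.set_eqI)
      fix x :: "real \<times> (nat \<Rightarrow> real)"
      obtain s t where x: "x = (s, t)" by (cases x)
      have "t \<in> space (lborel_pow p) \<longleftrightarrow> t \<in> extensional {..<p}"
        by (auto simp: space_PiM PiE_iff)
      moreover have "t \<in> PiE {..<p} (\<lambda>j. A (?k j)) \<longleftrightarrow> (\<forall>j<p. t j \<in> A (?k j)) \<and> t \<in> extensional {..<p}"
        by (auto simp: PiE_iff)
      moreover have "x \<in> ?f -` PiE {..<Suc p} A \<inter> space ?P \<longleftrightarrow>
          restrict (insert_coord i s t) {..<Suc p} \<in> PiE {..<Suc p} A \<and> t \<in> space (lborel_pow p)"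
        by (simp add: x space_pair_measure)
      ultimately show "x \<in> ?f -` PiE {..<Suc p} A \<inter> space ?P \<longleftrightarrow> x \<in> A i \<times> PiE {..<p} (\<lambda>j. A (?k j))"
        unfolding mem_iff x by blast
    qed
    then have "emeasure (distr ?P ?Q ?f) (PiE {..<Suc p} A) = emeasure ?P (A i \<times> PiE {..<p} (\<lambda>j. A (?k j)))"
      using A by (subst emeasure_distr[OF meas]) (auto intro: sets_PiM_I_finite)
    also have "\<dots> = emeasure lborel (A i) * emeasure (lborel_pow p) (PiE {..<p} (\<lambda>j. A (?k j)))"
      by (rule p.emeasure_pair_measure_Times) (use A i Ak in \<open>auto intro!: sets_PiM_I_finite\<close>)
    also have "emeasure (lborel_pow p) (PiE {..<p} (\<lambda>j. A (?k j))) = (\<Prod>j<p. emeasure lborel (A (?k j)))"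
      by (rule p.measure_times) (use Ak in auto)
    also have "emeasure lborel (A i) * (\<Prod>j<p. emeasure lborel (A (?k j))) = (\<Prod>j<Suc p. emeasure lborel (A j))"
      by (rule prod_skip[OF i, symmetric])
    finally show "emeasure (distr ?P ?Q ?f) (PiE {..<Suc p} A) = (\<Prod>j\<in>{..<Suc p}. emeasure lborel (A j))" .
  qed auto
qed

definition simplex_int :: "nat \<Rightarrow> ((nat \<Rightarrow> real) \<Rightarrow> real) \<Rightarrow> real" where
  "simplex_int k h = (\<integral>t. indicator (open_simplex k) t * h (truncate k t) \<partial>lborel_pow k)"

lemma simplex_int_cong:
  assumes "\<And>x. x \<in> solid_simplex k \<Longrightarrow> (\<And>j. j < k \<Longrightarrow> 0 < x j) \<Longrightarrow> (\<Sum>j<k. x j) < 1 \<Longrightarrow> f x = g x"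
  shows "simplex_int k f = simplex_int k g"
  unfolding simplex_int_def
proof (rule Bochner_Integration.integral_cong[OF refl])
  fix t
  have "f (truncate k t) = g (truncate k t)" if "t \<in> open_simplex k"
    by (rule assms[OF truncate_simplex[OF that]]) (use that in \<open>auto simp: truncate_def open_simplex_def\<close>)
  then show "indicator (open_simplex k) t * f (truncate k t) = indicator (open_simplex k) t * g (truncate k t)"
    by (simp add: indicator_def)
qed

lemma simplex_int_sum:
  assumes "\<And>i. i \<in> I \<Longrightarrow> continuous_on (solid_simplex k) (f i)"
  shows "simplex_int k (\<lambda>x. \<Sum>i\<in>I. f i x) = (\<Sum>i\<in>I. simplex_int k (f i))"
  unfolding simplex_int_def sum_distrib_left
  by (rule Bochner_Integration.integral_sum) (rule integrable_on_simplex[OF assms])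

lemma simplex_int_cmult: "simplex_int k (\<lambda>x. c * f x) = c * simplex_int k f"
  unfolding simplex_int_def by (simp add: mult.left_commute)

lemma simplex_int_diff:
  assumes "continuous_on (solid_simplex k) f" "continuous_on (solid_simplex k) g"
  shows "simplex_int k (\<lambda>x. f x - g x) = simplex_int k f - simplex_int k g"
  unfolding simplex_int_def right_diff_distrib
  by (rule Bochner_Integration.integral_diff) (rule integrable_on_simplex assms)+

lemma simplex_int_fubini:
  assumes i: "i \<le> p" and h: "continuous_on (solid_simplex (Suc p)) h"
  shows "simplex_int (Suc p) h = simplex_int p (\<lambda>t. \<integral>s. indicator {0<..<1 - (\<Sum>j<p. t j)} s * h (insert_coord i s t) \<partial>lborel)"
proof -
  interpret p: finite_product_sigma_finite "\<lambda>_::nat. lborel :: real measure" "{..<p}"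
    by standard simp
  interpret pair_sigma_finite "lborel :: real measure" "lborel_pow p"
    by standard
  let ?f = "\<lambda>(s, t). restrict (insert_coord i s t) {..<Suc p}"
  let ?F = "\<lambda>t. indicator (open_simplex (Suc p)) t * h (truncate (Suc p) t)"
  note D = lborel_pow_insert_coord[OF i]
  have F: "?F (restrict (insert_coord i s t) {..<Suc p})
      = indicator (open_simplex p) t * (indicator {0<..<1 - (\<Sum>j<p. truncate p t j)} s * h (insert_coord i s (truncate p t)))" for s t
  proof -
    have "restrict (insert_coord i s t) {..<Suc p} \<in> open_simplex (Suc p) \<longleftrightarrow> insert_coord i s t \<in> open_simplex (Suc p)"
      by (simp add: open_simplex_def)
    moreover have "truncate (Suc p) (restrict (insert_coord i s t) {..<Suc p}) = insert_coord i s (truncate p t)"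
      using i by (auto simp: truncate_def insert_coord_def fun_eq_iff)
    moreover have "(\<Sum>j<p. truncate p t j) = (\<Sum>j<p. t j)"
      by (simp add: truncate_def)
    ultimately show ?thesis
      by (simp add: indicator_def insert_coord_simplex_iff[OF i])
  qed
  have int: "integrable (lborel_pow (Suc p)) ?F"
    by (rule integrable_on_simplex[OF h])
  have int': "integrable (lborel \<Otimes>\<^sub>M lborel_pow p) (case_prod (\<lambda>s t. ?F (restrict (insert_coord i s t) {..<Suc p})))"
    using int borel_measurable_integrable[OF int] integrable_distr_eq[OF D(2), of ?F] unfolding D(1) by (simp add: case_prod_unfold)
  have "simplex_int (Suc p) h = (\<integral>x. ?F x \<partial>distr (lborel \<Otimes>\<^sub>M lborel_pow p) (lborel_pow (Suc p)) ?f)"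
    unfolding D(1) simplex_int_def ..
  also have "\<dots> = (\<integral>x. ?F (?f x) \<partial>(lborel \<Otimes>\<^sub>M lborel_pow p))"
    by (rule integral_distr[OF D(2)]) (rule borel_measurable_integrable[OF int])
  also have "\<dots> = (\<integral>t. (\<integral>s. ?F (restrict (insert_coord i s t) {..<Suc p}) \<partial>lborel) \<partial>lborel_pow p)"
    by (subst integral_snd[OF int']) (simp add: case_prod_unfold)
  also have "\<dots> = simplex_int p (\<lambda>t. \<integral>s. indicator {0<..<1 - (\<Sum>j<p. t j)} s * h (insert_coord i s t) \<partial>lborel)"
    unfolding F simplex_int_def by simp
  finally show ?thesis .
qed

text \<open>
  The \<open>i\<close>-th coordinate of a point of the simplex runs from 0 to one minus the sum of the others. The
  fundamental theorem of calculus on that segment yields values on the slanted face and on the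
  \<open>i\<close>-th coordinate face.
\<close>

lemma simplex_int_partial_deriv:
  assumes W: "openin (Euclidean_space (Suc p)) W" "solid_simplex (Suc p) \<subseteq> W"
    and b: "Ck_on (Suc 0) (Suc p) W b" and i: "i \<le> p"
  shows "simplex_int (Suc p) (partial_deriv i b)
    = simplex_int p (\<lambda>t. b (insert_coord i (1 - (\<Sum>j<p. t j)) t) - b (insert_coord i 0 t))"
proof -
  note WR = openin_Euclidean_subset[OF W(1)]
  have der: "\<And>x. x \<in> W \<Longrightarrow> ((\<lambda>t. b (x(i := t))) has_real_derivative partial_deriv i b x) (at (x i))"
    and cont: "continuous_on W (partial_deriv i b)"
    using b i by (auto simp: Ck_on_Suc_iff[OF WR] Ck_on_0_iff[OF WR])
  have "simplex_int (Suc p) (partial_deriv i b)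
      = simplex_int p (\<lambda>t. \<integral>s. indicator {0<..<1 - (\<Sum>j<p. t j)} s * partial_deriv i b (insert_coord i s t) \<partial>lborel)"
    by (rule simplex_int_fubini[OF i continuous_on_subset[OF cont W(2)]])
  also have "\<dots> = simplex_int p (\<lambda>t. b (insert_coord i (1 - (\<Sum>j<p. t j)) t) - b (insert_coord i 0 t))"
  proof (rule simplex_int_cong)
    fix t assume t: "t \<in> solid_simplex p" "(\<Sum>j<p. t j) < 1"
    define c where "c = 1 - (\<Sum>j<p. t j)"
    have inW: "insert_coord i s t \<in> W" if "s \<in> {0..c}" for s
      using insert_coord_solid_simplex[OF i t(1), of s] that W(2) by (auto simp: c_def)
    have "(\<integral>s. indicator {0<..<c} s * partial_deriv i b (insert_coord i s t) \<partial>lborel)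
        = (\<integral>s. indicator {0..c} s *\<^sub>R partial_deriv i b (insert_coord i s t) \<partial>lborel)"
    proof (rule integral_cong_AE)
      have c0: "continuous_on {0..c} (\<lambda>s. partial_deriv i b (insert_coord i s t))"
      proof (rule continuous_on_compose2[OF cont])
        show "continuous_on {0..c} (\<lambda>s. insert_coord i s t)"
          by (intro continuous_on_insert_coord continuous_intros)
      qed (use inW in auto)
      then have m: "(\<lambda>s. indicator {0..c} s *\<^sub>R partial_deriv i b (insert_coord i s t)) \<in> borel_measurable borel"
        by (intro borel_measurable_continuous_on_indicator) auto
      then show "(\<lambda>s. indicator {0..c} s *\<^sub>R partial_deriv i b (insert_coord i s t)) \<in> borel_measurable lborel"
        by simp
      have "(\<lambda>s. indicator {0<..<c} s *\<^sub>R partial_deriv i b (insert_coord i s t)) \<in> borel_measurable borel"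
        by (intro borel_measurable_continuous_on_indicator continuous_on_subset[OF c0]) auto
      then show "(\<lambda>s. indicator {0<..<c} s * partial_deriv i b (insert_coord i s t)) \<in> borel_measurable lborel"
        by simp
      show "AE s in lborel. indicator {0<..<c} s * partial_deriv i b (insert_coord i s t)
          = indicator {0..c} s *\<^sub>R partial_deriv i b (insert_coord i s t)"
        using AE_lborel_singleton[of 0] AE_lborel_singleton[of c]
        by eventually_elim (auto simp: indicator_def)
    qed
    also have "\<dots> = b (insert_coord i c t) - b (insert_coord i 0 t)"
    proof (rule integral_FTC_Icc)
      show "0 \<le> c" using t by (simp add: c_def)
      show "((\<lambda>s. b (insert_coord i s t)) has_vector_derivative partial_deriv i b (insert_coord i s t)) (at s within {0..c})"
        if "0 \<le> s" "s \<le> c" for s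
        using der[OF inW[of s]] that
        by (simp add: has_real_derivative_iff_has_vector_derivative has_vector_derivative_at_within)
      show "continuous_on {0..c} (\<lambda>s. partial_deriv i b (insert_coord i s t))"
      proof (rule continuous_on_compose2[OF cont])
        show "continuous_on {0..c} (\<lambda>s. insert_coord i s t)"
          by (intro continuous_on_insert_coord continuous_intros)
      qed (use inW in auto)
    qed
    finally show "(\<integral>s. indicator {0<..<1 - (\<Sum>j<p. t j)} s * partial_deriv i b (insert_coord i s t) \<partial>lborel)
       = b (insert_coord i (1 - (\<Sum>j<p. t j)) t) - b (insert_coord i 0 t)"
      by (simp add: c_def)
  qed
  finally show ?thesis .
qed

text \<open>
  Exchanging vertex \<open>0\<close> with vertex \<open>i + 1\<close> of the simplex is, on each line parallel to the \<open>i\<close>-th axis,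
  the reflection of a segment in its midpoint.
\<close>

lemma simplex_int_reflect:
  assumes h: "continuous_on (solid_simplex p) h" and i: "i < p"
  shows "simplex_int p (\<lambda>t. h (t(i := 1 - (\<Sum>j<p. t j)))) = simplex_int p h"
proof -
  obtain q where q: "p = Suc q" using i by (cases p) auto
  with i have iq: "i \<le> q" by simp
  have map: "t(i := 1 - (\<Sum>j<p. t j)) \<in> solid_simplex p" if t: "t \<in> solid_simplex p" for t
  proof -
    have "(\<Sum>j<p. (t(i := 1 - (\<Sum>j<p. t j))) j) = 1 - t i"
      using i by (simp add: sum.remove[of "{..<p}" i])
    then show ?thesis using t i by (auto simp: solid_simplex_def R_pow_iff)
  qed
  have "continuous_on (solid_simplex p) (\<lambda>t. t(i := 1 - (\<Sum>j<p. t j)) :: nat \<Rightarrow> real)"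
  proof (rule continuous_on_coordinatewise_then_product)
    show "continuous_on (solid_simplex p) (\<lambda>t. (t(i := 1 - (\<Sum>j<p. t j))) k :: real)" for k
      by (cases "k = i") (auto intro!: continuous_intros continuous_on_coord)
  qed
  then have h': "continuous_on (solid_simplex p) (\<lambda>t. h (t(i := 1 - (\<Sum>j<p. t j))))"
    by (rule continuous_on_compose2[OF h]) (use map in auto)
  have "simplex_int p (\<lambda>t. h (t(i := 1 - (\<Sum>j<p. t j))))
      = simplex_int q (\<lambda>t. \<integral>s. indicator {0<..<1 - (\<Sum>j<q. t j)} s * h ((insert_coord i s t)(i := 1 - (\<Sum>j<p. insert_coord i s t j))) \<partial>lborel)"
    using simplex_int_fubini[OF iq h'[unfolded q]] unfolding q .
  also have "\<dots> = simplex_int q (\<lambda>t. \<integral>s. indicator {0<..<1 - (\<Sum>j<q. t j)} s * h (insert_coord i s t) \<partial>lborel)"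
  proof (rule simplex_int_cong)
    fix t :: "nat \<Rightarrow> real"
    define c where "c = 1 - (\<Sum>j<q. t j)"
    have "(\<integral>s. indicator {0<..<c} s * h (insert_coord i s t) \<partial>lborel)
       = (\<integral>s. indicator {0<..<c} (c + -1 * s) * h (insert_coord i (c + -1 * s) t) \<partial>lborel)"
      using lborel_integral_real_affine[of "-1" "\<lambda>s. indicator {0<..<c} s * h (insert_coord i s t)" c] by simp
    also have "\<dots> = (\<integral>s. indicator {0<..<c} s * h ((insert_coord i s t)(i := 1 - (\<Sum>j<p. insert_coord i s t j))) \<partial>lborel)"
      unfolding q sum_insert_coord[OF iq]
      by (intro Bochner_Integration.integral_cong) (auto simp: indicator_def c_def algebra_simps)
    finally show "(\<integral>s. indicator {0<..<1 - (\<Sum>j<q. t j)} s * h ((insert_coord i s t)(i := 1 - (\<Sum>j<p. insert_coord i s t j))) \<partial>lborel)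
      = (\<integral>s. indicator {0<..<1 - (\<Sum>j<q. t j)} s * h (insert_coord i s t) \<partial>lborel)"
      by (simp add: c_def)
  qed
  also have "\<dots> = simplex_int p h"
    using simplex_int_fubini[OF iq h[unfolded q]] unfolding q by simp
  finally show ?thesis .
qed

lemma continuous_on_faces:
  assumes h: "continuous_on (solid_simplex (Suc p)) h" and i: "i \<le> p"
  shows "continuous_on (solid_simplex p) (\<lambda>t. h (insert_coord i (1 - (\<Sum>j<p. t j)) t))"
    and "continuous_on (solid_simplex p) (\<lambda>t. h (insert_coord i 0 t))"
  by (rule continuous_on_compose2[OF h continuous_on_insert_coord];
      use insert_coord_solid_simplex[OF i] in \<open>auto simp: solid_simplex_def intro!: continuous_intros continuous_on_coord\<close>)+

text \<open>
  The slanted face is a graph over each coordinate hyperplane. Passing from one of them to the next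
  is a reflection of the parametrising simplex, so all these graphs give the same integral.
\<close>

lemma simplex_int_slanted_face:
  assumes h: "continuous_on (solid_simplex (Suc p)) h" and "i \<le> p"
  shows "simplex_int p (\<lambda>t. h (insert_coord i (1 - (\<Sum>j<p. t j)) t)) = simplex_int p (\<lambda>t. h (insert_coord 0 (1 - (\<Sum>j<p. t j)) t))"
  using assms(2)
proof (induction i)
  case (Suc i)
  then have i: "i < p" by simp
  let ?H = "\<lambda>t. h (insert_coord i (1 - (\<Sum>j<p. t j)) t)"
  have eq: "insert_coord (Suc i) (1 - (\<Sum>j<p. t j)) t
      = insert_coord i (1 - (\<Sum>j<p. (t(i := 1 - (\<Sum>j<p. t j))) j)) (t(i := 1 - (\<Sum>j<p. t j)))" for t :: "nat \<Rightarrow> real"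
  proof -
    have "(\<Sum>j<p. (t(i := 1 - (\<Sum>j<p. t j))) j) = 1 - t i"
      using i by (simp add: sum.remove[of "{..<p}" i])
    then show ?thesis by (auto simp: insert_coord_def fun_eq_iff)
  qed
  have "simplex_int p (\<lambda>t. h (insert_coord (Suc i) (1 - (\<Sum>j<p. t j)) t)) = simplex_int p (\<lambda>t. ?H (t(i := 1 - (\<Sum>j<p. t j))))"
    unfolding eq ..
  also have "\<dots> = simplex_int p ?H"
    by (rule simplex_int_reflect[OF continuous_on_faces(1)[OF h] i]) (use i in simp)
  finally show ?case using Suc by simp
qed simp

section \<open>Smooth simplices in affine coordinates\<close>

lemma simplex_param_truncate: "simplex_param k (truncate k t) = simplex_param k t"
  by (auto simp: simplex_param_def truncate_def fun_eq_iff)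

lemma simplex_param_R_pow: "simplex_param k t \<in> R_pow (Suc k)"
  by (auto simp: R_pow_iff simplex_param_def)

lemma simplex_param_standard_simplex:
  assumes t: "t \<in> solid_simplex k"
  shows "simplex_param k t \<in> standard_simplex k"
proof -
  have le: "t j \<le> (\<Sum>j<k. t j)" if "j < k" for j
    using t that by (intro member_le_sum) (auto simp: solid_simplex_def)
  have "0 \<le> simplex_param k t i \<and> simplex_param k t i \<le> 1" for i
  proof (cases "i = 0 \<or> i > k")
    case True
    have "0 \<le> (\<Sum>j<k. t j)" using t by (intro sum_nonneg) (auto simp: solid_simplex_def)
    then show ?thesis using True t by (auto simp: simplex_param_def solid_simplex_def)
  next
    case False
    then have "i - 1 < k" by auto
    then show ?thesis using False t le[of "i - 1"] by (auto simp: simplex_param_def solid_simplex_def)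
  qed
  moreover have "(\<Sum>i\<le>k. simplex_param k t i) = 1"
  proof -
    have "(\<Sum>i\<le>k. simplex_param k t i) = simplex_param k t 0 + (\<Sum>i<k. simplex_param k t (Suc i))"
      by (simp add: sum.atMost_shift)
    also have "(\<Sum>i<k. simplex_param k t (Suc i)) = (\<Sum>i<k. t i)"
      by (intro sum.cong) (auto simp: simplex_param_def)
    finally show ?thesis by (simp add: simplex_param_def)
  qed
  ultimately show ?thesis by (auto simp: standard_simplex_def simplex_param_def)
qed

text \<open>
  The face inclusion \<^const>\<open>simplical_face\<close> in affine coordinates. These omit the barycentric
  coordinate of vertex 0, so the face opposite to vertex 0 is the slanted one.
\<close>

definition face_incl :: "nat \<Rightarrow> nat \<Rightarrow> (nat \<Rightarrow> real) \<Rightarrow> nat \<Rightarrow> real" where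
  "face_incl p j t = (case j of 0 \<Rightarrow> insert_coord 0 (1 - (\<Sum>l<p. t l)) t | Suc i \<Rightarrow> insert_coord i 0 t)"

lemma simplical_face_simplex_param:
  assumes "j \<le> Suc p"
  shows "simplical_face j (simplex_param p t) = simplex_param (Suc p) (face_incl p j t)"
proof (cases j)
  case 0
  have "(\<Sum>l<Suc p. insert_coord 0 (1 - (\<Sum>l<p. t l)) t l) = 1"
    by (simp add: sum_insert_coord del: sum.lessThan_Suc)
  then show ?thesis
    unfolding 0 face_incl_def
    by (auto simp: simplical_face_def simplex_param_def insert_coord_def fun_eq_iff simp del: sum.lessThan_Suc)
next
  case (Suc i)
  then have "(\<Sum>l<Suc p. insert_coord i 0 t l) = (\<Sum>l<p. t l)"
    using assms by (simp add: sum_insert_coord del: sum.lessThan_Suc)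
  then show ?thesis
    using assms unfolding Suc face_incl_def
    by (auto simp: simplical_face_def simplex_param_def insert_coord_def fun_eq_iff simp del: sum.lessThan_Suc)
qed

lemma face_incl_R_pow: "j \<le> Suc p \<Longrightarrow> t \<in> R_pow p \<Longrightarrow> face_incl p j t \<in> R_pow (Suc p)"
  by (cases j) (auto simp: face_incl_def intro!: insert_coord_R_pow)

lemma face_incl_solid_simplex: "j \<le> Suc p \<Longrightarrow> t \<in> solid_simplex p \<Longrightarrow> face_incl p j t \<in> solid_simplex (Suc p)"
  by (cases j) (auto simp: face_incl_def solid_simplex_def[of p] intro!: insert_coord_solid_simplex)

lemma Ck_on_insert_coord:
  assumes "\<And>l. Ck_on k d U (\<lambda>x. t x l)" "Ck_on k d U s"
  shows "Ck_on k d U (\<lambda>x. insert_coord i (s x) (t x) l)"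
  using assms by (cases "l < i"; cases "l = i") (simp_all add: insert_coord_def)

lemma Ck_on_one_minus_sum:
  assumes U: "openin (Euclidean_space d) U"
  shows "Ck_on k d U (\<lambda>x. 1 - (\<Sum>l<p. x l))"
proof -
  note UR = openin_Euclidean_subset[OF U]
  have "Ck_on k d U (\<lambda>x. 1 + (-1) * (\<Sum>l<p. x l))"
    by (intro Ck_on_add[OF U] Ck_on_mult[OF U] Ck_on_sum[OF U] Ck_on_const[OF UR] Ck_on_coord[OF UR])
  then show ?thesis by simp
qed

lemma Ck_on_face_incl:
  assumes U: "openin (Euclidean_space d) U"
  shows "Ck_on k d U (\<lambda>t. face_incl p j t l)"
  using openin_Euclidean_subset[OF U]
  by (cases j) (auto simp: face_incl_def intro!: Ck_on_insert_coord Ck_on_const Ck_on_coord Ck_on_one_minus_sum[OF U])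

lemma Ck_on_simplex_param:
  assumes U: "openin (Euclidean_space d) U"
  shows "Ck_on k d U (\<lambda>t. simplex_param p t l)"
  using openin_Euclidean_subset[OF U] Ck_on_one_minus_sum[OF U]
  by (cases "l = 0"; cases "l \<le> p") (auto simp: simplex_param_def intro!: Ck_on_const Ck_on_coord)

lemma openin_R_pow: "openin (Euclidean_space d) (R_pow d)"
  by (rule openin_topspace)

lemma openin_smooth_preimage:
  assumes W: "openin (Euclidean_space d) W" and \<iota>: "\<And>x. x \<in> R_pow e \<Longrightarrow> \<iota> x \<in> R_pow d"
    and C: "\<And>j. Ck_on 0 e (R_pow e) (\<lambda>x. \<iota> x j)"
  shows "openin (Euclidean_space e) {x \<in> R_pow e. \<iota> x \<in> W}"
proof (rule openin_preimage_Euclidean[OF openin_R_pow _ W])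
  have "continuous_on (R_pow e) \<iota>"
    by (rule continuous_on_coordinatewise_then_product) (use C in \<open>simp add: Ck_on_0_iff\<close>)
  then show "continuous_map (subtopology (Euclidean_space e) (R_pow e)) (Euclidean_space d) \<iota>"
    using \<iota> unfolding cm_Euclidean_space_iff_continuous_on by auto
qed

text \<open>
  A smooth simplex extends smoothly to a neighbourhood by definition, so in affine coordinates it
  becomes a smooth map near the solid simplex. All further arguments use only this map.
\<close>

lemma smooth_simplex_param:
  assumes M: "smooth_manifold M" and \<sigma>: "smooth_simplex k M \<sigma>"
  obtains W g where "smooth_from k W M g" "solid_simplex k \<subseteq> W"
    "\<And>t. t \<in> solid_simplex k \<Longrightarrow> \<sigma> (simplex_param k t) = g t"
proof -
  obtain W g where W: "openin (Euclidean_space (Suc k)) W" "standard_simplex k \<subseteq> W"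
    and g: "smooth_map (euclidean_mfd (Suc k) W) M g" "\<And>x. x \<in> standard_simplex k \<Longrightarrow> \<sigma> x = g x"
    using \<sigma> unfolding smooth_simplex_def by blast
  have g': "smooth_from (Suc k) W M g"
    using g(1) smooth_from_iff_smooth_map[OF M W(1)] by blast
  let ?W = "{t \<in> R_pow k. simplex_param k t \<in> W}"
  have o: "openin (Euclidean_space k) ?W"
    by (intro openin_smooth_preimage[OF W(1)] simplex_param_R_pow Ck_on_simplex_param openin_R_pow)
  have "smooth_from k ?W M (g \<circ> simplex_param k)"
    by (intro smooth_from_precompose[OF M g' o] Ck_on_simplex_param[OF o]) simp
  then show thesis
  proof (rule that)
    show "solid_simplex k \<subseteq> ?W"
      using simplex_param_standard_simplex W(2) solid_simplex_subset by blast
    show "\<sigma> (simplex_param k t) = (g \<circ> simplex_param k) t" if "t \<in> solid_simplex k" for t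
      using g(2)[OF simplex_param_standard_simplex[OF that]] by simp
  qed
qed

lemma smooth_simplex_face:
  assumes M: "smooth_manifold M" and \<sigma>: "smooth_simplex (Suc p) M \<sigma>" and j: "j \<le> Suc p"
  shows "smooth_simplex p M (singular_face (Suc p) j \<sigma>)"
proof -
  obtain W g where W: "openin (Euclidean_space (Suc (Suc p))) W" "standard_simplex (Suc p) \<subseteq> W"
    and g: "smooth_map (euclidean_mfd (Suc (Suc p)) W) M g" "\<And>x. x \<in> standard_simplex (Suc p) \<Longrightarrow> \<sigma> x = g x"
    using \<sigma> unfolding smooth_simplex_def by blast
  have g': "smooth_from (Suc (Suc p)) W M g"
    using g(1) smooth_from_iff_smooth_map[OF M W(1)] by blast
  have std: "simplical_face j x \<in> standard_simplex (Suc p)" if "x \<in> standard_simplex p" for x :: "nat \<Rightarrow> real"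
    using simplical_face_in_standard_simplex[of "Suc p" j x] that j by simp
  have R: "simplical_face j x \<in> R_pow (Suc (Suc p))" if "x \<in> R_pow (Suc p)" for x :: "nat \<Rightarrow> real"
    using that j by (auto simp: R_pow_iff simplical_face_def)
  have C: "Ck_on k d U (\<lambda>x. simplical_face j x l)" if "openin (Euclidean_space d) U" for k d U l
    using openin_Euclidean_subset[OF that]
    by (cases "l < j"; cases "l = j") (auto simp: simplical_face_def intro!: Ck_on_const Ck_on_coord)
  let ?W = "{x \<in> R_pow (Suc p). simplical_face j x \<in> W}"
  have o: "openin (Euclidean_space (Suc p)) ?W"
    by (intro openin_smooth_preimage[OF W(1)] R C openin_R_pow)
  have "smooth_from (Suc p) ?W M (g \<circ> simplical_face j)"
    by (intro smooth_from_precompose[OF M g' o] C[OF o]) simp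
  then have "smooth_map (euclidean_mfd (Suc p) ?W) M (g \<circ> simplical_face j)"
    using smooth_from_iff_smooth_map[OF M o] by blast
  moreover have "standard_simplex p \<subseteq> ?W"
    using std W(2) by (auto simp: standard_simplex_def R_pow_iff)
  moreover have "\<forall>x\<in>standard_simplex p. singular_face (Suc p) j \<sigma> x = (g \<circ> simplical_face j) x"
    using g(2) std by (simp add: singular_face_def)
  moreover have "singular_simplex p (mtop M) (singular_face (Suc p) j \<sigma>)"
    using singular_simplex_singular_face[of "Suc p" "mtop M" \<sigma> j] \<sigma> j by (simp add: smooth_simplex_def)
  ultimately show ?thesis
    using o unfolding smooth_simplex_def by blast
qed

lemma smooth_simplex_map:
  assumes M: "smooth_manifold M" and N: "smooth_manifold N" and F: "smooth_map M N F" and \<sigma>: "smooth_simplex k M \<sigma>"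
  shows "smooth_simplex k N (simplex_map k F \<sigma>)"
proof -
  obtain W g where W: "openin (Euclidean_space (Suc k)) W" "standard_simplex k \<subseteq> W"
    and g: "smooth_map (euclidean_mfd (Suc k) W) M g" "\<And>x. x \<in> standard_simplex k \<Longrightarrow> \<sigma> x = g x"
    using \<sigma> unfolding smooth_simplex_def by blast
  have "smooth_map (euclidean_mfd (Suc k) W) N (F \<circ> g)"
    using smooth_from_compose_smooth_map[OF M N _ F] smooth_from_iff_smooth_map[OF M W(1)]
      smooth_from_iff_smooth_map[OF N W(1)] g(1) by blast
  moreover have "\<forall>x\<in>standard_simplex k. simplex_map k F \<sigma> x = (F \<circ> g) x"
    using g(2) by (simp add: simplex_map_def)
  moreover have "singular_simplex k (mtop N) (simplex_map k F \<sigma>)"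
    using \<sigma> F singular_simplex_simplex_map unfolding smooth_simplex_def smooth_map_def by blast
  ultimately show ?thesis
    using W unfolding smooth_simplex_def by blast
qed

lemma eventually_upd_open_simplex:
  assumes t: "t \<in> open_simplex k" and l: "l < k"
  shows "\<forall>\<^sub>F s in nhds (t l). t(l := s) \<in> open_simplex k"
proof -
  define r where "r = (\<Sum>j\<in>{..<k} - {l}. t j)"
  have S: "(\<Sum>j<k. (t(l := s)) j) = s + r" for s
    using l by (simp add: sum.remove[of "{..<k}" l] r_def)
  have "t l \<in> {0<..<1 - r}"
    using t l S[of "t l"] by (auto simp: open_simplex_def)
  then have "\<forall>\<^sub>F s in nhds (t l). s \<in> {0<..<1 - r}"
    by (intro eventually_nhds_in_open) auto
  then show ?thesis
  proof eventually_elim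
    case (elim s)
    then show ?case using t S[of s] by (auto simp: open_simplex_def)
  qed
qed

text \<open>
  At interior points \<open>\<sigma>\<close> and its extension have the same values and partial derivatives, hence
  select the same chart and have the same pullback.
\<close>

lemma simplex_integral_eq_simplex_int:
  assumes agree: "\<And>t. t \<in> solid_simplex k \<Longrightarrow> \<sigma> (simplex_param k t) = g t"
  shows "simplex_integral k M \<alpha> \<sigma> = simplex_int k (\<lambda>t. pull_local M k g \<alpha> t unit_vec)"
  unfolding simplex_integral_def simplex_int_def set_lebesgue_integral_def open_simplex_def[symmetric]
proof (rule Bochner_Integration.integral_cong[OF refl])
  fix t :: "nat \<Rightarrow> real"
  have ag: "(\<sigma> \<circ> simplex_param k) t = g (truncate k t)" if "t \<in> open_simplex k" for t
    using agree[OF truncate_simplex[OF that]] by (simp add: simplex_param_truncate)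
  have "pull_local M k (\<sigma> \<circ> simplex_param k) \<alpha> t (\<lambda>j i. if i = j then 1 else 0)
     = pull_local M k g \<alpha> (truncate k t) unit_vec" if t: "t \<in> open_simplex k"
  proof -
    have pd: "partial_deriv l (\<lambda>y. f ((\<sigma> \<circ> simplex_param k) y)) t = partial_deriv l (\<lambda>y. f (g y)) (truncate k t)" if l: "l < k" for l f
      unfolding partial_deriv_def
    proof (rule deriv_cong_ev)
      show "\<forall>\<^sub>F s in nhds (t l). f ((\<sigma> \<circ> simplex_param k) (t(l := s))) = f (g ((truncate k t)(l := s)))"
        using eventually_upd_open_simplex[OF t l]
      proof eventually_elim
        case (elim s)
        have "truncate k (t(l := s)) = (truncate k t)(l := s)" using l by (auto simp: truncate_def)
        then show ?case using ag[OF elim] by simp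
      qed
    qed (use l in \<open>simp add: truncate_def\<close>)
    have "differential k (h \<circ> (\<sigma> \<circ> simplex_param k)) t v = differential k (h \<circ> g) (truncate k t) v" for h v
      unfolding differential_def dir_deriv_def
    proof (intro ext sum.cong refl)
      fix i l assume "l \<in> {..<k}"
      then show "v l * partial_deriv l (\<lambda>y. (h \<circ> (\<sigma> \<circ> simplex_param k)) y i) t = v l * partial_deriv l (\<lambda>y. (h \<circ> g) y i) (truncate k t)"
        using pd[of l "\<lambda>q. h q i"] by simp
    qed
    then show ?thesis
      unfolding pull_local_def ag[OF t] unit_vec_def by simp
  qed
  then show "indicator (open_simplex k) t *\<^sub>R pull_local M k (\<sigma> \<circ> simplex_param k) \<alpha> t (\<lambda>j i. if i = j then 1 else 0)
     = indicator (open_simplex k) t * pull_local M k g \<alpha> (truncate k t) unit_vec"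
    by (simp add: indicator_def)
qed

section \<open>Stokes' theorem\<close>

text \<open>
  With \<open>w\<close> already in position \<open>q\<close>, subtracting \<open>w\<close> from other arguments has no effect.
\<close>

lemma am_replace_one:
  assumes am: "alternating_multilinear d p f"
    and u: "\<And>j. u j \<in> R_pow d" and w: "w \<in> R_pow d" and q: "q < p" and r: "r \<le> q"
  shows "f (\<lambda>j. if j < r then (\<lambda>i. u j i - w i) else if j = q then w else u j) = f (u(q := w))"
  using r
proof (induction r)
  case 0
  have "(\<lambda>j. if j < 0 then (\<lambda>i. u j i - w i) else if j = q then w else u j) = u(q := w)" by auto
  then show ?case by simp
next
  case (Suc r)
  define h where "h = (\<lambda>j. if j < r then (\<lambda>i. u j i - w i) else if j = q then w else u j)"
  have R: "(\<lambda>i. u j i - w i) \<in> R_pow d" for j using u[of j] w by (auto simp: R_pow_iff)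
  have hR: "h j \<in> R_pow d" for j using R u w by (simp add: h_def)
  have rp: "r < p" "r \<noteq> q" using Suc.prems q by auto
  have "(\<lambda>j. if j < Suc r then (\<lambda>i. u j i - w i) else if j = q then w else u j) = h(r := (\<lambda>i. 1 * u r i + (-1) * w i))"
    using rp by (auto simp: h_def fun_eq_iff less_Suc_eq)
  then have "f (\<lambda>j. if j < Suc r then (\<lambda>i. u j i - w i) else if j = q then w else u j)
      = 1 * f (h(r := u r)) + (-1) * f (h(r := w))"
    by (simp only: am_linear[OF am rp(1) u w hR])
  also have "f (h(r := w)) = 0"
    by (rule am_alternating[OF am rp(1) q _ rp(2)]) (use hR w rp Suc.prems in \<open>auto simp: h_def\<close>)
  also have "h(r := u r) = h" using rp by (auto simp: h_def)
  finally show ?case using Suc by (simp add: h_def)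
qed

lemma am_translate:
  assumes am: "alternating_multilinear d p f"
    and u: "\<And>j. u j \<in> R_pow d" and w: "w \<in> R_pow d"
  shows "f (\<lambda>j i. u j i - w i) = f u - (\<Sum>q<p. f (u(q := w)))"
proof -
  have R: "(\<lambda>i. u j i - w i) \<in> R_pow d" for j using u[of j] w by (auto simp: R_pow_iff)
  have "f (\<lambda>j. if j < q then (\<lambda>i. u j i - w i) else u j) = f u - (\<Sum>r<q. f (u(r := w)))" if "q \<le> p" for q
    using that
  proof (induction q)
    case (Suc q)
    define h where "h = (\<lambda>j. if j < q then (\<lambda>i. u j i - w i) else u j)"
    have hR: "h j \<in> R_pow d" for j using R u by (simp add: h_def)
    have q: "q < p" using Suc.prems by simp
    have "(\<lambda>j. if j < Suc q then (\<lambda>i. u j i - w i) else u j) = h(q := (\<lambda>i. 1 * u q i + (-1) * w i))"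
      by (auto simp: h_def fun_eq_iff less_Suc_eq)
    then have "f (\<lambda>j. if j < Suc q then (\<lambda>i. u j i - w i) else u j) = 1 * f (h(q := u q)) + (-1) * f (h(q := w))"
      by (simp only: am_linear[OF am q u w hR])
    also have "h(q := u q) = h" by (auto simp: h_def)
    also have "h(q := w) = (\<lambda>j. if j < q then (\<lambda>i. u j i - w i) else if j = q then w else u j)"
      by (auto simp: h_def)
    also have "f \<dots> = f (u(q := w))"
      by (rule am_replace_one[OF am u w q order_refl])
    finally show ?case using Suc by (simp add: h_def fun_upd_def)
  qed simp
  from this[OF order_refl] show ?thesis
    by (subst am_cong[OF am, of "\<lambda>j i. u j i - w i" "\<lambda>j. if j < p then (\<lambda>i. u j i - w i) else u j"]) (use R in auto)
qed

text \<open>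
  The slanted face is spanned by the vectors \<open>e\<^sub>j\<^sub>+\<^sub>1 - e\<^sub>0\<close>. A form evaluated on them collects its
  coefficients from all coordinate faces, with the signs of the boundary operator.
\<close>

lemma am_slanted_face:
  assumes am: "alternating_multilinear (Suc p) p f"
  shows "f (\<lambda>j. if j < p then (\<lambda>i. unit_vec (Suc j) i - unit_vec 0 i) else w j) = (\<Sum>i\<le>p. (-1) ^ i * f (omit i unit_vec))"
proof -
  define u where "u = (\<lambda>j. if j < p then unit_vec (Suc j) else unit_vec 0)"
  have u: "u j \<in> R_pow (Suc p)" for j by (simp add: u_def)
  have w: "unit_vec 0 \<in> R_pow (Suc p)" by simp
  have oR: "omit i unit_vec l \<in> R_pow (Suc p)" if "l < p" for i l
    using that by (simp add: omit_def)
  have "f (\<lambda>j. if j < p then (\<lambda>i. unit_vec (Suc j) i - unit_vec 0 i) else w j) = f (\<lambda>j i. u j i - unit_vec 0 i)"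
  proof (rule am_cong[OF am])
    fix j assume j: "j < p"
    then show "(if j < p then (\<lambda>i. unit_vec (Suc j) i - unit_vec 0 i) else w j) \<in> R_pow (Suc p)"
      by (auto simp: R_pow_iff unit_vec_def)
  qed (simp add: u_def)
  also have "\<dots> = f u - (\<Sum>q<p. f (u(q := unit_vec 0)))"
    by (rule am_translate[OF am u w])
  moreover have "f (u(q := unit_vec 0)) = (-1) ^ q * f (omit (Suc q) unit_vec)" if q: "q < p" for q
  proof -
    have "f (u(q := unit_vec 0)) = (-1) ^ q * f (case_nat (unit_vec 0) (omit q (u(q := unit_vec 0))))"
      using am_move_to_front[OF am q, of "u(q := unit_vec 0)"] u w by simp
    also have "f (case_nat (unit_vec 0) (omit q (u(q := unit_vec 0)))) = f (omit (Suc q) unit_vec)"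
      by (rule am_cong[OF am, symmetric]) (use oR q in \<open>auto simp: omit_def u_def split: nat.splits\<close>)
    finally show ?thesis .
  qed
  moreover have "f u = f (omit 0 unit_vec)"
    by (rule am_cong[OF am, OF u]) (auto simp: u_def omit_def)
  ultimately show ?thesis
    by (simp add: sum.atMost_shift sum_negf)
qed

lemma differential_face_incl:
  assumes j: "j < p"
  shows "differential p (face_incl p (Suc i)) t (unit_vec j) = unit_vec (skip i j)"
    and "differential p (face_incl p 0) t (unit_vec j) = (\<lambda>l. unit_vec (Suc j) l - unit_vec 0 l)"
proof -
  have D: "differential p f t (unit_vec j) = (\<lambda>l. partial_deriv j (\<lambda>y. f y l) t)" for f
    using j by (simp add: differential_def dir_deriv_def unit_vec_def if_distrib[of "\<lambda>x. x * _"] cong: if_cong)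
  have "partial_deriv j (\<lambda>y. face_incl p (Suc i) y l) t = unit_vec (skip i j) l" for l
  proof -
    have "(\<lambda>y. face_incl p (Suc i) y l) = (if l < i then (\<lambda>y. y l) else if l = i then (\<lambda>y. 0) else (\<lambda>y. y (l - 1)))"
      by (auto simp: face_incl_def insert_coord_def)
    then show ?thesis by (auto simp: unit_vec_def skip_def split: if_splits)
  qed
  then show "differential p (face_incl p (Suc i)) t (unit_vec j) = unit_vec (skip i j)"
    by (simp add: D)
  have "partial_deriv j (\<lambda>y. face_incl p 0 y l) t = unit_vec (Suc j) l - unit_vec 0 l" for l
  proof (cases "l = 0")
    case True
    have "((\<lambda>s. 1 - (\<Sum>m<p. (t(j := s)) m)) has_real_derivative 0 - (\<Sum>m<p. if m = j then 1 else 0)) (at (t j))"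
      by (intro derivative_intros) (auto intro!: derivative_eq_intros)
    then have "partial_deriv j (\<lambda>y. 1 - (\<Sum>m<p. y m)) t = - 1"
      using j by (intro partial_deriv_eqI) simp
    then show ?thesis
      using True by (simp add: face_incl_def insert_coord_def unit_vec_def)
  next
    case False
    then have "(\<lambda>y. face_incl p 0 y l) = (\<lambda>y. y (l - 1))"
      by (auto simp: face_incl_def insert_coord_def)
    then show ?thesis using False by (auto simp: unit_vec_def)
  qed
  then show "differential p (face_incl p 0) t (unit_vec j) = (\<lambda>l. unit_vec (Suc j) l - unit_vec 0 l)"
    by (simp add: D)
qed

text \<open>
  With \<open>b\<^sub>i\<close> the coefficient of the pulled back form on all basis vectors but \<open>e\<^sub>i\<close>, the integrand of the
  left-hand side is \<open>\<Sum>\<^sub>i (-1)\<^sup>i \<partial>\<^sub>i b\<^sub>i\<close>. Integrating the \<open>i\<close>-th summand in direction \<open>i\<close> gives the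
  face \<open>i + 1\<close> and a contribution on the slanted face; these contributions add up to face 0.
\<close>

lemma stokes_simplex:
  assumes M: "smooth_manifold M" and \<alpha>: "\<alpha> \<in> smooth_forms p M" and \<sigma>: "smooth_simplex (Suc p) M \<sigma>"
  shows "simplex_integral (Suc p) M (ext_deriv p M \<alpha>) \<sigma>
     = (\<Sum>j\<le>Suc p. (-1) ^ j * simplex_integral p M \<alpha> (singular_face (Suc p) j \<sigma>))"
proof -
  obtain W g where g: "smooth_from (Suc p) W M g" "solid_simplex (Suc p) \<subseteq> W"
    and agree: "\<And>t. t \<in> solid_simplex (Suc p) \<Longrightarrow> \<sigma> (simplex_param (Suc p) t) = g t"
    using smooth_simplex_param[OF M \<sigma>] by metis
  note W = smooth_from_openin[OF M g(1)]
  note WR = openin_Euclidean_subset[OF W]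
  define b where "b = (\<lambda>i t. pull_local M (Suc p) g \<alpha> t (omit i unit_vec))"
  have b: "Ck_on k (Suc p) W (b i)" for k i
    unfolding b_def by (rule pull_local_smooth[OF M g(1) \<alpha>])
  have bc: "continuous_on (solid_simplex (Suc p)) (b i)" for i
    using Ck_on_imp_continuous[OF WR b] g(2) by (rule continuous_on_subset)
  have bpc: "continuous_on (solid_simplex (Suc p)) (partial_deriv i (b i))" if "i \<le> p" for i
  proof -
    have "Ck_on 0 (Suc p) W (partial_deriv i (b i))"
      by (rule Ck_on_partial[OF WR b]) (use that in simp)
    then show ?thesis using g(2) by (auto simp: Ck_on_0_iff WR intro: continuous_on_subset)
  qed
  have face: "simplex_integral p M \<alpha> (singular_face (Suc p) j \<sigma>)
     = simplex_int p (\<lambda>t. pull_local M (Suc p) g \<alpha> (face_incl p j t) (\<lambda>i. differential p (face_incl p j) t (unit_vec i)))"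
    if j: "j \<le> Suc p" for j
  proof -
    let ?V = "{t \<in> R_pow p. face_incl p j t \<in> W}"
    have o: "openin (Euclidean_space p) ?V"
      by (intro openin_smooth_preimage[OF W] face_incl_R_pow[OF j] Ck_on_face_incl openin_R_pow)
    have "simplex_integral p M \<alpha> (singular_face (Suc p) j \<sigma>) = simplex_int p (\<lambda>t. pull_local M p (g \<circ> face_incl p j) \<alpha> t unit_vec)"
    proof (rule simplex_integral_eq_simplex_int)
      fix t assume t: "t \<in> solid_simplex p"
      show "singular_face (Suc p) j \<sigma> (simplex_param p t) = (g \<circ> face_incl p j) t"
        using simplex_param_standard_simplex[OF t] agree[OF face_incl_solid_simplex[OF j t]]
        by (simp add: singular_face_def simplical_face_simplex_param[OF j])
    qed
    also have "\<dots> = simplex_int p (\<lambda>t. pull_local M (Suc p) g \<alpha> (face_incl p j t) (\<lambda>i. differential p (face_incl p j) t (unit_vec i)))"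
    proof (rule simplex_int_cong)
      fix t assume "t \<in> solid_simplex p"
      then have "t \<in> ?V" using face_incl_solid_simplex[OF j] g(2) solid_simplex_subset by blast
      then show "pull_local M p (g \<circ> face_incl p j) \<alpha> t unit_vec
        = pull_local M (Suc p) g \<alpha> (face_incl p j t) (\<lambda>i. differential p (face_incl p j) t (unit_vec i))"
        by (intro pull_local_precompose[OF M g(1) \<alpha> o _ Ck_on_face_incl[OF o]]) simp
    qed
    finally show ?thesis .
  qed
  have amf: "alternating_multilinear (Suc p) p (pull_local M (Suc p) g \<alpha> (face_incl p j t))"
    if "j \<le> Suc p" "t \<in> solid_simplex p" for j t
    using pull_local_alternating[OF M g(1) \<alpha>] face_incl_solid_simplex[OF that] g(2) by blast
  have face_Suc: "simplex_integral p M \<alpha> (singular_face (Suc p) (Suc i) \<sigma>) = simplex_int p (\<lambda>t. b i (insert_coord i 0 t))"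
    if i: "i \<le> p" for i
  proof -
    have "simplex_integral p M \<alpha> (singular_face (Suc p) (Suc i) \<sigma>) = simplex_int p (\<lambda>t. b i (face_incl p (Suc i) t))"
    proof (subst face, use i in simp, rule simplex_int_cong)
      fix t assume t: "t \<in> solid_simplex p"
      show "pull_local M (Suc p) g \<alpha> (face_incl p (Suc i) t) (\<lambda>l. differential p (face_incl p (Suc i)) t (unit_vec l)) = b i (face_incl p (Suc i) t)"
        unfolding b_def
      proof (rule am_cong[OF amf[OF _ t], symmetric])
        fix l assume l: "l < p"
        then show "omit i unit_vec l \<in> R_pow (Suc p)" by (simp add: omit_def)
        show "omit i unit_vec l = differential p (face_incl p (Suc i)) t (unit_vec l)"
          by (simp add: differential_face_incl[OF l] omit_def skip_def)
      qed (use i in simp)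
    qed
    then show ?thesis by (simp add: face_incl_def)
  qed
  have face_0: "simplex_integral p M \<alpha> (singular_face (Suc p) 0 \<sigma>)
      = (\<Sum>i\<le>p. (-1) ^ i * simplex_int p (\<lambda>t. b i (insert_coord 0 (1 - (\<Sum>l<p. t l)) t)))"
  proof -
    have "simplex_integral p M \<alpha> (singular_face (Suc p) 0 \<sigma>) = simplex_int p (\<lambda>t. \<Sum>i\<le>p. (-1) ^ i * b i (face_incl p 0 t))"
    proof (subst face, simp, rule simplex_int_cong)
      fix t assume t: "t \<in> solid_simplex p"
      let ?f = "pull_local M (Suc p) g \<alpha> (face_incl p 0 t)"
      have "(\<lambda>i. differential p (face_incl p 0) t (unit_vec i))
         = (\<lambda>j. if j < p then (\<lambda>i. unit_vec (Suc j) i - unit_vec 0 i) else differential p (face_incl p 0) t (unit_vec j))"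
        using differential_face_incl(2) by auto
      then show "?f (\<lambda>i. differential p (face_incl p 0) t (unit_vec i)) = (\<Sum>i\<le>p. (-1) ^ i * b i (face_incl p 0 t))"
        unfolding b_def using am_slanted_face[OF amf[OF _ t, of 0]] by simp
    qed
    also have "\<dots> = (\<Sum>i\<le>p. simplex_int p (\<lambda>t. (-1) ^ i * b i (face_incl p 0 t)))"
      by (rule simplex_int_sum) (auto simp: face_incl_def intro!: continuous_intros continuous_on_faces bc)
    finally show ?thesis by (simp add: simplex_int_cmult face_incl_def)
  qed
  have "simplex_integral (Suc p) M (ext_deriv p M \<alpha>) \<sigma> = simplex_int (Suc p) (\<lambda>t. pull_local M (Suc p) g (ext_deriv p M \<alpha>) t unit_vec)"
    by (rule simplex_integral_eq_simplex_int[where \<sigma> = \<sigma> and g = g]) (rule agree)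
  also have "\<dots> = simplex_int (Suc p) (\<lambda>t. \<Sum>i\<le>p. (-1) ^ i * partial_deriv i (b i) t)"
  proof (rule simplex_int_cong)
    fix t assume "t \<in> solid_simplex (Suc p)"
    then have t: "t \<in> W" using g(2) by blast
    have "dir_deriv (Suc p) f t (unit_vec i) = partial_deriv i f t" if "i \<le> p" for i f
      using that by (simp add: dir_deriv_def unit_vec_def if_distrib[of "\<lambda>x. x * _"] cong: if_cong del: sum.lessThan_Suc)
    then show "pull_local M (Suc p) g (ext_deriv p M \<alpha>) t unit_vec = (\<Sum>i\<le>p. (-1) ^ i * partial_deriv i (b i) t)"
      by (simp add: pull_local_ext_deriv[OF M g(1) \<alpha> t] b_def)
  qed
  also have "\<dots> = (\<Sum>i\<le>p. simplex_int (Suc p) (\<lambda>t. (-1) ^ i * partial_deriv i (b i) t))"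
    by (rule simplex_int_sum) (auto intro!: continuous_intros bpc)
  also have "\<dots> = (\<Sum>i\<le>p. (-1) ^ i * simplex_int p (\<lambda>t. b i (insert_coord 0 (1 - (\<Sum>l<p. t l)) t))
      + (-1) ^ Suc i * simplex_integral p M \<alpha> (singular_face (Suc p) (Suc i) \<sigma>))"
  proof (rule sum.cong[OF refl])
    fix i assume "i \<in> {..p}"
    then have i: "i \<le> p" by simp
    have "simplex_int (Suc p) (partial_deriv i (b i))
       = simplex_int p (\<lambda>t. b i (insert_coord i (1 - (\<Sum>l<p. t l)) t) - b i (insert_coord i 0 t))"
      by (rule simplex_int_partial_deriv[OF W g(2) b i])
    also have "\<dots> = simplex_int p (\<lambda>t. b i (insert_coord i (1 - (\<Sum>l<p. t l)) t)) - simplex_int p (\<lambda>t. b i (insert_coord i 0 t))"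
      by (rule simplex_int_diff[OF continuous_on_faces[OF bc i]])
    also have "simplex_int p (\<lambda>t. b i (insert_coord i (1 - (\<Sum>l<p. t l)) t)) = simplex_int p (\<lambda>t. b i (insert_coord 0 (1 - (\<Sum>l<p. t l)) t))"
      by (rule simplex_int_slanted_face[OF bc i])
    finally show "simplex_int (Suc p) (\<lambda>t. (-1) ^ i * partial_deriv i (b i) t)
      = (-1) ^ i * simplex_int p (\<lambda>t. b i (insert_coord 0 (1 - (\<Sum>l<p. t l)) t))
      + (-1) ^ Suc i * simplex_integral p M \<alpha> (singular_face (Suc p) (Suc i) \<sigma>)"
      by (simp add: simplex_int_cmult face_Suc[OF i] right_diff_distrib)
  qed
  also have "\<dots> = (\<Sum>j\<le>Suc p. (-1) ^ j * simplex_integral p M \<alpha> (singular_face (Suc p) j \<sigma>))"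
    by (subst sum.atMost_Suc_shift) (simp add: face_0 sum_subtractf sum_negf)
  finally show ?thesis .
qed

section \<open>Smooth chains\<close>

lemma smooth_chains_iff: "c \<in> smooth_chains k M \<longleftrightarrow> Poly_Mapping.keys c \<subseteq> Collect (smooth_simplex k M)"
  by (simp add: smooth_chains_def smooth_chain_group_def)

lemma smooth_chains_0 [simp]: "0 \<in> smooth_chains k M"
  by (simp add: smooth_chains_iff)

lemma smooth_chains_diff: "a \<in> smooth_chains k M \<Longrightarrow> b \<in> smooth_chains k M \<Longrightarrow> a - b \<in> smooth_chains k M"
  using keys_diff[of a b] by (auto simp: smooth_chains_iff)

lemma smooth_chains_uminus: "a \<in> smooth_chains k M \<Longrightarrow> - a \<in> smooth_chains k M"
  using smooth_chains_diff[of 0 k M a] by simp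

lemma smooth_chains_add: "a \<in> smooth_chains k M \<Longrightarrow> b \<in> smooth_chains k M \<Longrightarrow> a + b \<in> smooth_chains k M"
  using smooth_chains_diff[of a k M "- b"] smooth_chains_uminus[of b k M] by simp

lemma smooth_chains_cmul: "a \<in> smooth_chains k M \<Longrightarrow> frag_cmul m a \<in> smooth_chains k M"
  using keys_cmul[of m a] by (auto simp: smooth_chains_iff)

lemma smooth_chains_sum: "(\<And>i. i \<in> I \<Longrightarrow> f i \<in> smooth_chains k M) \<Longrightarrow> (\<Sum>i\<in>I. f i) \<in> smooth_chains k M"
  by (induction I rule: infinite_finite_induct) (auto intro: smooth_chains_add)

lemma smooth_chains_frag_of: "smooth_simplex k M \<sigma> \<Longrightarrow> frag_of \<sigma> \<in> smooth_chains k M"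
  by (simp add: smooth_chains_iff)

lemma smooth_chains_singular: "c \<in> smooth_chains k M \<Longrightarrow> singular_chain k (mtop M) c"
  by (auto simp: smooth_chains_iff singular_chain_def smooth_simplex_def)

lemma smooth_chains_induct [consumes 1, case_names zero simplex diff]:
  assumes "c \<in> smooth_chains k M" "P 0" "\<And>\<sigma>. smooth_simplex k M \<sigma> \<Longrightarrow> P (frag_of \<sigma>)"
    "\<And>a b. a \<in> smooth_chains k M \<Longrightarrow> b \<in> smooth_chains k M \<Longrightarrow> P a \<Longrightarrow> P b \<Longrightarrow> P (a - b)"
  shows "P c"
proof -
  have "Poly_Mapping.keys c \<subseteq> Collect (smooth_simplex k M)"
    using assms(1) by (simp add: smooth_chains_iff)
  then have "c \<in> smooth_chains k M \<and> P c"
    by (induction c rule: frag_induction) (auto intro: assms(2-4) smooth_chains_frag_of smooth_chains_diff)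
  then show ?thesis ..
qed

lemma smooth_chains_boundary:
  assumes M: "smooth_manifold M" and c: "c \<in> smooth_chains (Suc k) M"
  shows "chain_boundary (Suc k) c \<in> smooth_chains k M"
  using c
proof (induction rule: smooth_chains_induct)
  case (simplex \<sigma>)
  then show ?case
    by (auto simp: chain_boundary_of simp del: sum.atMost_Suc
        intro!: smooth_chains_sum smooth_chains_cmul smooth_chains_frag_of smooth_simplex_face[OF M])
qed (auto simp: chain_boundary_diff intro: smooth_chains_diff)

lemma smooth_chains_map:
  assumes "smooth_manifold M" "smooth_manifold N" "smooth_map M N F" and c: "c \<in> smooth_chains k M"
  shows "chain_map k F c \<in> smooth_chains k N"
  using c
  by (induction rule: smooth_chains_induct)
     (auto simp: chain_map_diff intro: smooth_chains_diff smooth_chains_frag_of smooth_simplex_map[OF assms(1-3)])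

lemma chain_integral_superset:
  "finite A \<Longrightarrow> Poly_Mapping.keys c \<subseteq> A \<Longrightarrow>
    chain_integral k M \<alpha> c = (\<Sum>\<sigma>\<in>A. of_int (Poly_Mapping.lookup c \<sigma>) * simplex_integral k M \<alpha> \<sigma>)"
  unfolding chain_integral_def by (rule sum.mono_neutral_left) (auto simp: in_keys_iff)

lemma chain_integral_0 [simp]: "chain_integral k M \<alpha> 0 = 0"
  by (simp add: chain_integral_def)

lemma chain_integral_frag_of [simp]: "chain_integral k M \<alpha> (frag_of \<sigma>) = simplex_integral k M \<alpha> \<sigma>"
  by (simp add: chain_integral_def)

lemma chain_integral_diff [simp]:
  "chain_integral k M \<alpha> (a - b) = chain_integral k M \<alpha> a - chain_integral k M \<alpha> b"
proof -
  let ?A = "Poly_Mapping.keys a \<union> Poly_Mapping.keys b"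
  have "chain_integral k M \<alpha> c = (\<Sum>\<sigma>\<in>?A. of_int (Poly_Mapping.lookup c \<sigma>) * simplex_integral k M \<alpha> \<sigma>)"
    if "Poly_Mapping.keys c \<subseteq> ?A" for c
    by (rule chain_integral_superset) (use that in auto)
  then show ?thesis
    using keys_diff[of a b] by (simp add: lookup_minus left_diff_distrib sum_subtractf)
qed

lemma chain_integral_uminus [simp]: "chain_integral k M \<alpha> (- a) = - chain_integral k M \<alpha> a"
  using chain_integral_diff[of k M \<alpha> 0 a] by simp

lemma chain_integral_add [simp]:
  "chain_integral k M \<alpha> (a + b) = chain_integral k M \<alpha> a + chain_integral k M \<alpha> b"
  using chain_integral_diff[of k M \<alpha> a "- b"] by simp

lemma chain_integral_cmul [simp]: "chain_integral k M \<alpha> (frag_cmul m a) = of_int m * chain_integral k M \<alpha> a"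
proof -
  have "chain_integral k M \<alpha> (frag_cmul m a)
      = (\<Sum>\<sigma>\<in>Poly_Mapping.keys a. of_int (Poly_Mapping.lookup (frag_cmul m a) \<sigma>) * simplex_integral k M \<alpha> \<sigma>)"
    by (rule chain_integral_superset) (auto simp: keys_cmul)
  then show ?thesis
    by (simp add: chain_integral_def sum_distrib_left mult.assoc)
qed

lemma chain_integral_sum [simp]:
  "chain_integral k M \<alpha> (\<Sum>i\<in>I. f i) = (\<Sum>i\<in>I. chain_integral k M \<alpha> (f i))"
  by (induction I rule: infinite_finite_induct) auto

text \<open>Both sides are additive in the chain, so simplices suffice.\<close>

theorem stokes:
  assumes M: "smooth_manifold M" and \<alpha>: "\<alpha> \<in> smooth_forms k M" and c: "c \<in> smooth_chains (Suc k) M"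
  shows "chain_integral (Suc k) M (ext_deriv k M \<alpha>) c = chain_integral k M \<alpha> (chain_boundary (Suc k) c)"
  using c
proof (induction rule: smooth_chains_induct)
  case (simplex \<sigma>)
  then show ?case
    by (simp add: chain_boundary_of stokes_simplex[OF M \<alpha>] del: sum.atMost_Suc)
qed (auto simp: chain_boundary_diff)

lemma chain_integral_chain_map:
  assumes M: "smooth_manifold M" and N: "smooth_manifold N" and F: "smooth_map M N F" and c: "c \<in> smooth_chains k M"
  shows "chain_integral k N \<omega> (chain_map k F c) = chain_integral k M (pullback M N F \<omega>) c"
  using c
proof (induction rule: smooth_chains_induct)
  case (simplex \<sigma>)
  then obtain W g where g: "smooth_from k W M g" "solid_simplex k \<subseteq> W"
    and agree: "\<And>t. t \<in> solid_simplex k \<Longrightarrow> \<sigma> (simplex_param k t) = g t"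
    using smooth_simplex_param[OF M] by metis
  have "simplex_integral k N \<omega> (simplex_map k F \<sigma>) = simplex_int k (\<lambda>t. pull_local N k (F \<circ> g) \<omega> t unit_vec)"
    by (rule simplex_integral_eq_simplex_int)
       (simp add: simplex_map_def simplex_param_standard_simplex agree)
  also have "\<dots> = simplex_int k (\<lambda>t. pull_local M k g (pullback M N F \<omega>) t unit_vec)"
    by (rule simplex_int_cong, rule pull_local_pullback[OF M N F g(1)]) (use g(2) in blast)
  also have "\<dots> = simplex_integral k M (pullback M N F \<omega>) \<sigma>"
    by (rule simplex_integral_eq_simplex_int[symmetric, where \<sigma> = \<sigma> and g = g]) (rule agree)
  finally show ?case by simp
qed (auto simp: chain_map_diff)

lemma chain_integral_cong:
  assumes M: "smooth_manifold M" and c: "c \<in> smooth_chains k M"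
    and eq: "form_vanishes k M (\<lambda>c x v. \<theta> c x v - \<theta>' c x v)"
  shows "chain_integral k M \<theta> c = chain_integral k M \<theta>' c"
  using c
proof (induction rule: smooth_chains_induct)
  case (simplex \<sigma>)
  then obtain W g where g: "smooth_from k W M g" "solid_simplex k \<subseteq> W"
    and agree: "\<And>t. t \<in> solid_simplex k \<Longrightarrow> \<sigma> (simplex_param k t) = g t"
    using smooth_simplex_param[OF M] by metis
  have "simplex_int k (\<lambda>t. pull_local M k g \<theta> t unit_vec) = simplex_int k (\<lambda>t. pull_local M k g \<theta>' t unit_vec)"
  proof (rule simplex_int_cong)
    fix t assume "t \<in> solid_simplex k"
    then have t: "t \<in> W" using g(2) by blast
    obtain U \<phi> where c: "(U, \<phi>) \<in> atlas M" "g t \<in> U"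
      "(SOME c. c \<in> atlas M \<and> g t \<in> fst c) = (U, \<phi>)" and
      P: "\<And>d \<alpha> v. pull_local M d g \<alpha> t v = \<alpha> (U, \<phi>) (\<phi> (g t)) (\<lambda>j. differential d (\<phi> \<circ> g) t (v j))"
      by (rule pull_local_some_chart[where g = g and x = t, OF M smooth_from_in_topspace[OF M g(1) t]]) (rule that)
    have "\<forall>(U, \<phi>)\<in>atlas M. \<forall>x\<in>\<phi> ` U. \<forall>v. (\<forall>j<k. v j \<in> R_pow (mdim M)) \<longrightarrow> \<theta> (U, \<phi>) x v - \<theta>' (U, \<phi>) x v = 0"
      using eq unfolding form_vanishes_def .
    from bspec[OF this c(1), unfolded case_prod_conv, THEN bspec, OF imageI[OF c(2)]]
    show "pull_local M k g \<theta> t unit_vec = pull_local M k g \<theta>' t unit_vec"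
      unfolding P using differential_in_R_pow[OF M g(1) c(1) t c(2)] by simp
  qed
  then show ?case
    using simplex_integral_eq_simplex_int[where \<sigma> = \<sigma> and g = g, OF agree] by simp
qed auto

lemma chain_integral_vanish:
  assumes M: "smooth_manifold M" and c: "c \<in> smooth_chains k M" and z: "form_vanishes k M \<theta>"
  shows "chain_integral k M \<theta> c = 0"
proof -
  have "chain_integral k M \<theta> c = chain_integral k M (\<lambda>c x v. 0) c"
    by (rule chain_integral_cong[OF M c]) (use z in simp)
  also have "\<dots> = 0"
    by (simp add: chain_integral_def simplex_integral_def pull_local_def Let_def set_lebesgue_integral_def)
  finally show ?thesis .
qed

lemma chain_integral_scale: "chain_integral k M (\<lambda>c x v. a * \<alpha> c x v) z = a * chain_integral k M \<alpha> z"
proof -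
  have "simplex_integral k M (\<lambda>c x v. a * \<alpha> c x v) \<sigma> = a * simplex_integral k M \<alpha> \<sigma>" for \<sigma>
    unfolding simplex_integral_def pull_local_def Let_def by (rule set_integral_mult_right)
  then show ?thesis
    by (simp add: chain_integral_def sum_distrib_left mult_ac)
qed

section \<open>Smooth homology\<close>

text \<open>
  A property of group elements that respects the group operations passes from the members of
  generating cosets to the members of all cosets they generate. This spares the explicit integral
  combinations of generators.
\<close>

lemma (in normal) quotient_generate_induct:
  assumes X: "X \<in> generate (G Mod H) A" and A: "A \<subseteq> carrier (G Mod H)"
    and one: "\<And>x. x \<in> H \<Longrightarrow> P x" and gen: "\<And>Y x. Y \<in> A \<Longrightarrow> x \<in> Y \<Longrightarrow> P x"
    and inv: "\<And>x. x \<in> carrier G \<Longrightarrow> P x \<Longrightarrow> P (inv x)"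
    and mult: "\<And>x y. x \<in> carrier G \<Longrightarrow> y \<in> carrier G \<Longrightarrow> P x \<Longrightarrow> P y \<Longrightarrow> P (x \<otimes> y)"
    and x: "x \<in> X"
  shows "P x"
proof -
  have sub: "Y \<subseteq> carrier G" if "Y \<in> A" for Y
    using A that r_coset_subset_G[OF subset] by (auto simp: carrier_FactGroup)
  have "\<forall>x\<in>X. x \<in> carrier G \<and> P x"
    using X
  proof induction
    case one
    then show ?case using assms(3) mem_carrier by simp
  next
    case (incl Y)
    then show ?case using sub gen by blast
  next
    case (inv Y)
    then have "inv\<^bsub>G Mod H\<^esub> Y = set_inv Y" using A inv_FactGroup by blast
    then show ?case using sub[OF inv] gen[OF inv] assms(5) by (auto simp: SET_INV_def)
  next
    case (eng Y Z)
    then show ?case using mult by (auto simp: set_mult_def)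
  qed
  with x show ?thesis by blast
qed

lemma (in comm_group) subgroup_torsion: "subgroup (torsion_subgroup G) G"
proof
  fix x y assume "x \<in> torsion_subgroup G" "y \<in> torsion_subgroup G"
  then obtain m n :: nat where x: "x \<in> carrier G" "m > 0" "x [^] m = \<one>" and y: "y \<in> carrier G" "n > 0" "y [^] n = \<one>"
    by (auto simp: torsion_subgroup_def)
  have "x [^] (m * n) = \<one>" "y [^] (m * n) = \<one>"
    using x y by (simp_all add: nat_pow_pow[symmetric] mult.commute[of m])
       (metis mult.commute nat_pow_one nat_pow_pow)
  then have "(x \<otimes> y) [^] (m * n) = \<one>"
    using x y by (simp add: nat_pow_distrib)
  then show "x \<otimes> y \<in> torsion_subgroup G"
    using x y unfolding torsion_subgroup_def by (auto intro!: exI[of _ "m * n"])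
next
  fix x assume "x \<in> torsion_subgroup G"
  then show "inv x \<in> torsion_subgroup G"
    by (auto simp: torsion_subgroup_def nat_pow_inv)
qed (auto simp: torsion_subgroup_def)

lemma smooth_cycles_iff: "c \<in> smooth_cycles k M \<longleftrightarrow> c \<in> smooth_chains k M \<and> chain_boundary k c = 0"
  by (simp add: smooth_cycles_def)

context
  fixes M :: "'a mfd" and k :: nat
  assumes M: "smooth_manifold M"
begin

lemma subgroup_smooth_cycles: "subgroup (smooth_cycles k M) (smooth_chain_group k M)"
proof
  show "smooth_cycles k M \<subseteq> carrier (smooth_chain_group k M)"
    by (auto simp: smooth_cycles_iff smooth_chains_def)
next
  fix x assume x: "x \<in> smooth_cycles k M"
  then have "inv\<^bsub>smooth_chain_group k M\<^esub> x = - x"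
    unfolding smooth_chain_group_def
    by (intro inv_free_Abelian_group) (auto simp: smooth_cycles_iff smooth_chains_iff)
  then show "inv\<^bsub>smooth_chain_group k M\<^esub> x \<in> smooth_cycles k M"
    using x by (simp add: smooth_cycles_iff smooth_chains_uminus chain_boundary_minus)
qed (auto simp: smooth_chain_group_def smooth_cycles_iff chain_boundary_add intro: smooth_chains_add)

lemma comm_group_smooth_cycle_group: "comm_group (smooth_cycle_group k M)"
  unfolding smooth_cycle_group_def smooth_chain_group_def
  by (rule group.abelian_subgroup_generated[OF group_free_Abelian_group abelian_free_Abelian_group])

lemma carrier_smooth_cycle_group [simp]: "carrier (smooth_cycle_group k M) = smooth_cycles k M"
  unfolding smooth_cycle_group_def
  by (rule subgroup.carrier_subgroup_generated_subgroup[OF subgroup_smooth_cycles])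

lemma mult_smooth_cycle_group [simp]: "x \<otimes>\<^bsub>smooth_cycle_group k M\<^esub> y = x + y"
  by (simp add: smooth_cycle_group_def smooth_chain_group_def)

lemma one_smooth_cycle_group [simp]: "\<one>\<^bsub>smooth_cycle_group k M\<^esub> = 0"
  by (simp add: smooth_cycle_group_def smooth_chain_group_def)

lemma inv_smooth_cycle_group [simp]:
  assumes "x \<in> smooth_cycles k M" shows "inv\<^bsub>smooth_cycle_group k M\<^esub> x = - x"
proof -
  interpret comm_group "smooth_cycle_group k M" by (rule comm_group_smooth_cycle_group)
  show ?thesis
    by (rule inv_equality)
       (use assms in \<open>auto simp: smooth_cycles_iff smooth_chains_uminus chain_boundary_minus\<close>)
qed

lemma pow_smooth_cycle_group [simp]: "x [^]\<^bsub>smooth_cycle_group k M\<^esub> (m::nat) = frag_cmul (int m) x"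
  by (induction m) (auto simp: nat_pow_def frag_cmul_distrib add.commute)

lemma smooth_boundaries_subset: "smooth_boundaries k M \<subseteq> smooth_cycles k M"
proof
  fix x assume "x \<in> smooth_boundaries k M"
  then obtain c where c: "c \<in> smooth_chains (Suc k) M" "x = chain_boundary (Suc k) c"
    by (auto simp: smooth_boundaries_def)
  then show "x \<in> smooth_cycles k M"
    using smooth_chains_boundary[OF M c(1)] chain_boundary_boundary_alt[OF smooth_chains_singular[OF c(1)]]
    by (simp add: smooth_cycles_iff)
qed

lemma normal_smooth_boundaries: "smooth_boundaries k M \<lhd> smooth_cycle_group k M"
proof -
  interpret comm_group "smooth_cycle_group k M" by (rule comm_group_smooth_cycle_group)
  have 0: "0 \<in> smooth_boundaries k M"
    unfolding smooth_boundaries_def by (rule image_eqI[of _ _ 0]) auto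
  have add: "x + y \<in> smooth_boundaries k M" if "x \<in> smooth_boundaries k M" "y \<in> smooth_boundaries k M" for x y
    using that unfolding smooth_boundaries_def by (auto simp flip: chain_boundary_add intro: smooth_chains_add)
  have minus: "- x \<in> smooth_boundaries k M" if "x \<in> smooth_boundaries k M" for x
    using that unfolding smooth_boundaries_def by (auto simp flip: chain_boundary_minus intro: smooth_chains_uminus)
  have "subgroup (smooth_boundaries k M) (smooth_cycle_group k M)"
    using smooth_boundaries_subset 0 add minus by unfold_locales auto
  then show ?thesis by (rule subgroup_imp_normal)
qed

lemma comm_group_smooth_homology: "comm_group (smooth_homology_group k M)"
  unfolding smooth_homology_group_def
  using comm_group.abelian_FactGroup[OF comm_group_smooth_cycle_group] normal_smooth_boundaries
  by (blast dest: normal.axioms(1) normal_imp_subgroup)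

abbreviation cls where "cls z \<equiv> smooth_boundaries k M #>\<^bsub>smooth_cycle_group k M\<^esub> z"

lemma mem_cls_iff: "x \<in> cls z \<longleftrightarrow> (\<exists>y\<in>smooth_boundaries k M. x = y + z)"
  by (auto simp: r_coset_def)

lemma carrier_smooth_homology: "carrier (smooth_homology_group k M) = cls ` smooth_cycles k M"
  by (simp add: smooth_homology_group_def carrier_FactGroup)

lemma cls_self: "z \<in> smooth_cycles k M \<Longrightarrow> z \<in> cls z"
  using normal_imp_subgroup[OF normal_smooth_boundaries]
  by (intro group.rcos_self comm_group.axioms(2) comm_group_smooth_cycle_group) auto

lemma homology_class_subset: "X \<in> carrier (smooth_homology_group k M) \<Longrightarrow> x \<in> X \<Longrightarrow> x \<in> smooth_cycles k M"
  using smooth_boundaries_subset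
  by (auto simp: carrier_smooth_homology mem_cls_iff smooth_cycles_iff chain_boundary_add subset_iff intro!: smooth_chains_add)

lemma homology_class_diff:
  assumes "X \<in> carrier (smooth_homology_group k M)" "x \<in> X" "y \<in> X"
  shows "x - y \<in> smooth_boundaries k M"
proof -
  obtain z u v where "x = u + z" "y = v + z" and u: "u \<in> smooth_boundaries k M" "v \<in> smooth_boundaries k M"
    using assms by (auto simp: carrier_smooth_homology mem_cls_iff)
  then have "x - y = u - v" by simp
  also have "u - v \<in> smooth_boundaries k M"
    using u unfolding smooth_boundaries_def by (auto simp flip: chain_boundary_diff intro: smooth_chains_diff)
  finally show ?thesis .
qed

lemma homology_generate_induct:
  assumes X: "X \<in> generate (smooth_homology_group k M) A" and A: "A \<subseteq> carrier (smooth_homology_group k M)"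
    and one: "\<And>x. x \<in> smooth_boundaries k M \<Longrightarrow> P x" and gen: "\<And>Y x. Y \<in> A \<Longrightarrow> x \<in> Y \<Longrightarrow> P x"
    and minus: "\<And>x. P x \<Longrightarrow> P (- x)" and add: "\<And>x y. P x \<Longrightarrow> P y \<Longrightarrow> P (x + y)"
    and x: "x \<in> X"
  shows "P x"
  using X A one gen _ _ x unfolding smooth_homology_group_def
  by (rule normal.quotient_generate_induct[OF normal_smooth_boundaries]) (use minus add in auto)

lemma homology_mult_mem:
  "x \<in> X \<otimes>\<^bsub>smooth_homology_group k M\<^esub> Y \<longleftrightarrow> (\<exists>u\<in>X. \<exists>v\<in>Y. x = u + v)"
  by (auto simp: smooth_homology_group_def set_mult_def)

lemma homology_inv_mem:
  assumes X: "X \<in> carrier (smooth_homology_group k M)" and x: "x \<in> inv\<^bsub>smooth_homology_group k M\<^esub> X"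
  shows "\<exists>u\<in>X. x = - u"
proof -
  have "inv\<^bsub>smooth_homology_group k M\<^esub> X = (\<Union>u\<in>X. {inv\<^bsub>smooth_cycle_group k M\<^esub> u})"
    using normal.inv_FactGroup[OF normal_smooth_boundaries] X
    unfolding smooth_homology_group_def SET_INV_def by blast
  with x obtain u where u: "u \<in> X" "x = inv\<^bsub>smooth_cycle_group k M\<^esub> u" by blast
  then show ?thesis using homology_class_subset[OF X u(1)] by auto
qed

lemma homology_torsion_multiple:
  assumes X: "X \<in> torsion_subgroup (smooth_homology_group k M)" and x: "x \<in> X"
  shows "\<exists>m>0. frag_cmul (int m) x \<in> smooth_boundaries k M"
proof -
  obtain m :: nat where Xc: "X \<in> carrier (smooth_homology_group k M)" and m: "m > 0"
    "X [^]\<^bsub>smooth_homology_group k M\<^esub> m = \<one>\<^bsub>smooth_homology_group k M\<^esub>"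
    using X by (auto simp: torsion_subgroup_def)
  have xZ: "x \<in> smooth_cycles k M" by (rule homology_class_subset[OF Xc x])
  obtain z where z: "X = cls z" "z \<in> smooth_cycles k M" using Xc by (auto simp: carrier_smooth_homology)
  interpret Z: comm_group "smooth_cycle_group k M" by (rule comm_group_smooth_cycle_group)
  have "X = cls x"
    using Z.repr_independence[of x "smooth_boundaries k M" z] x z normal_imp_subgroup[OF normal_smooth_boundaries] by simp
  then have "X [^]\<^bsub>smooth_homology_group k M\<^esub> m = cls (frag_cmul (int m) x)"
    using normal.FactGroup_pow[OF normal_smooth_boundaries, of x m] xZ by (simp add: smooth_homology_group_def)
  then have "cls (frag_cmul (int m) x) = smooth_boundaries k M"
    using m(2) by (simp add: smooth_homology_group_def)
  moreover have "frag_cmul (int m) x \<in> smooth_cycles k M"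
    using xZ by (simp add: smooth_cycles_iff smooth_chains_cmul chain_boundary_cmul)
  ultimately show ?thesis using m(1) cls_self by blast
qed

text \<open>
  The induction principle for quotients, used for the quotient by torsion with the property that
  \<open>P\<close> holds on the whole homology class.
\<close>

lemma homology_mod_torsion_generate_induct:
  defines "H \<equiv> smooth_homology_group k M" and "Tor \<equiv> torsion_subgroup (smooth_homology_group k M)"
  assumes gens: "generate (H Mod Tor) ((\<lambda>i. Tor #>\<^bsub>H\<^esub> S i) ` I) = carrier (H Mod Tor)"
    and S: "\<And>i. i \<in> I \<Longrightarrow> S i \<in> carrier H"
    and tor: "\<And>x m. x \<in> smooth_cycles k M \<Longrightarrow> m > 0 \<Longrightarrow> frag_cmul (int m) x \<in> smooth_boundaries k M \<Longrightarrow> P x"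
    and gen: "\<And>i x. i \<in> I \<Longrightarrow> x \<in> S i \<Longrightarrow> P x"
    and minus: "\<And>x. P x \<Longrightarrow> P (- x)" and add: "\<And>x y. P x \<Longrightarrow> P y \<Longrightarrow> P (x + y)"
    and x: "x \<in> smooth_cycles k M"
  shows "P x"
proof -
  interpret H: comm_group H unfolding H_def by (rule comm_group_smooth_homology)
  have T: "subgroup Tor H" unfolding Tor_def H_def[symmetric] by (rule H.subgroup_torsion)
  then have nT: "Tor \<lhd> H" by (rule H.subgroup_imp_normal)
  have xH: "cls x \<in> carrier H" using x by (simp add: H_def carrier_smooth_homology)
  have mem: "cls x \<in> Tor #>\<^bsub>H\<^esub> cls x" using xH T by (rule H.rcos_self)
  have torP: "P z" if "D \<in> Tor" "z \<in> D" for D z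
  proof -
    have "D \<in> carrier H" using that(1) subgroup.subset[OF T] by blast
    then show ?thesis
      using homology_torsion_multiple[of D z] that tor[of z] homology_class_subset[of D z] unfolding Tor_def H_def by blast
  qed
  have "\<forall>z\<in>cls x. P z"
  proof (rule normal.quotient_generate_induct[OF nT _ _ _ _ _ _ mem])
    show "Tor #>\<^bsub>H\<^esub> cls x \<in> generate (H Mod Tor) ((\<lambda>i. Tor #>\<^bsub>H\<^esub> S i) ` I)"
      unfolding gens using xH by (simp add: carrier_FactGroup)
    show "(\<lambda>i. Tor #>\<^bsub>H\<^esub> S i) ` I \<subseteq> carrier (H Mod Tor)"
      using S by (auto simp: carrier_FactGroup)
    show "\<forall>z\<in>D. P z" if "D \<in> Tor" for D using torP[OF that] by blast
    show "\<forall>z\<in>C. P z" if Y: "Y \<in> (\<lambda>i. Tor #>\<^bsub>H\<^esub> S i) ` I" and C: "C \<in> Y" for Y C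
    proof
      fix z assume z: "z \<in> C"
      obtain i D where i: "i \<in> I" and D: "D \<in> Tor" "C = D \<otimes>\<^bsub>H\<^esub> S i"
        using Y C by (auto simp: r_coset_def)
      then obtain u v where "u \<in> D" "v \<in> S i" "z = u + v"
        using z by (auto simp: H_def homology_mult_mem)
      then show "P z" using torP[OF D(1)] gen[OF i] add by blast
    qed
    show "\<forall>z\<in>inv\<^bsub>H\<^esub> C. P z" if "C \<in> carrier H" "\<forall>z\<in>C. P z" for C
      using homology_inv_mem[of C] that minus unfolding H_def by blast
    show "\<forall>z\<in>C \<otimes>\<^bsub>H\<^esub> D. P z" if "\<forall>z\<in>C. P z" "\<forall>z\<in>D. P z" for C D
      using that add by (auto simp: H_def homology_mult_mem)
  qed
  then show ?thesis using cls_self[OF x] by blast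
qed

end

lemma chain_map_smooth_boundaries:
  assumes M: "smooth_manifold M" and N: "smooth_manifold N" and F: "smooth_map M N F"
    and x: "x \<in> smooth_boundaries k M"
  shows "chain_map k F x \<in> smooth_boundaries k N"
proof -
  obtain U where U: "U \<in> smooth_chains (Suc k) M" "x = chain_boundary (Suc k) U"
    using x by (auto simp: smooth_boundaries_def)
  then have "chain_map k F x = chain_boundary (Suc k) (chain_map (Suc k) F U)"
    using chain_boundary_chain_map[OF smooth_chains_singular[OF U(1)], of F] by simp
  then show ?thesis
    using smooth_chains_map[OF M N F U(1)] by (simp add: smooth_boundaries_def)
qed

text \<open>
  The induced map selects the common value of a function on representatives, so it is the zero class
  as soon as the images of all representatives bound.
\<close>

lemma in_kernel_smooth_hom_induced:
  assumes M: "smooth_manifold M" and N: "smooth_manifold N" and F: "smooth_map M N F"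
    and z: "z \<in> smooth_cycles k M" and b: "chain_map k F z \<in> smooth_boundaries k N"
  shows "smooth_boundaries k M #>\<^bsub>smooth_cycle_group k M\<^esub> z
     \<in> kernel (smooth_homology_group k M) (smooth_homology_group k N) (smooth_hom_induced k N F)"
proof -
  let ?X = "smooth_boundaries k M #>\<^bsub>smooth_cycle_group k M\<^esub> z"
  interpret Z: comm_group "smooth_cycle_group k N" by (rule comm_group_smooth_cycle_group[OF N])
  interpret B: normal "smooth_boundaries k N" "smooth_cycle_group k N" by (rule normal_smooth_boundaries[OF N])
  have "smooth_boundaries k N #>\<^bsub>smooth_cycle_group k N\<^esub> chain_map k F x = smooth_boundaries k N" if x: "x \<in> ?X" for x
  proof -
    obtain y where y: "y \<in> smooth_boundaries k M" "x = y + z"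
      using x by (auto simp: mem_cls_iff[OF M])
    have "chain_map k F y + chain_map k F z \<in> smooth_boundaries k N"
      using B.m_closed[OF chain_map_smooth_boundaries[OF M N F y(1)] b]
      by (simp only: mult_smooth_cycle_group[OF N])
    then have Fx: "chain_map k F x \<in> smooth_boundaries k N"
      unfolding y(2) chain_map_add .
    show ?thesis
      by (rule Z.coset_join2[OF B.mem_carrier[OF Fx] normal_imp_subgroup[OF B.normal_axioms] Fx])
  qed
  then have "(\<lambda>c. smooth_boundaries k N #>\<^bsub>smooth_cycle_group k N\<^esub> chain_map k F c) ` ?X = {smooth_boundaries k N}"
    using cls_self[OF M z] by (auto simp: image_iff)
  then have "smooth_hom_induced k N F ?X = smooth_boundaries k N"
    by (simp add: smooth_hom_induced_def)
  then show ?thesis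
    using z by (simp add: kernel_def carrier_smooth_homology[OF M] smooth_homology_group_def[of k N])
qed

section \<open>Subgroups of the reals and common denominators\<close>

lemma group_closure_subset:
  assumes "A \<subseteq> B" "0 \<in> B" "\<And>x y. x \<in> B \<Longrightarrow> y \<in> B \<Longrightarrow> x - y \<in> B"
  shows "group_closure A \<subseteq> B"
proof
  fix x assume "x \<in> group_closure A"
  then show "x \<in> B" by induction (use assms in auto)
qed

lemma group_closure_mono: "A \<subseteq> B \<Longrightarrow> group_closure A \<subseteq> group_closure B"
  by (rule group_closure_subset) (auto intro: group_closure.intros)

lemma group_closure_real_cmul_Ints:
  "(\<forall>x\<in>group_closure A. a * x \<in> \<int>) \<longleftrightarrow> (\<forall>x\<in>A. (a::real) * x \<in> \<int>)"
proof
  assume "\<forall>x\<in>A. a * x \<in> \<int>"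
  then have "group_closure A \<subseteq> {x. a * x \<in> \<int>}"
    by (intro group_closure_subset) (auto simp: right_diff_distrib)
  then show "\<forall>x\<in>group_closure A. a * x \<in> \<int>" by blast
qed (auto intro: group_closure.base)

lemma range_int_mult: "range ((*) k) = {m::int. k dvd m}"
  by (auto simp: dvd_def)

lemma int_subgroup_cyclic:
  fixes L :: "int set"
  assumes "0 \<in> L" "\<And>x y. x \<in> L \<Longrightarrow> y \<in> L \<Longrightarrow> x - y \<in> L"
  shows "\<exists>!k. k \<ge> 0 \<and> L = range ((*) k)"
proof -
  have cl: "group_closure L = L"
    using group_closure_subset[OF order_refl assms] by (auto intro: group_closure.base)
  show ?thesis
  proof (rule ex1I[of _ "Gcd L"])
    show "0 \<le> Gcd L \<and> L = range ((*) (Gcd L))"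
      using group_closure_eq[of L] unfolding cl by (intro conjI Gcd_int_greater_eq_0)
    fix k assume k: "k \<ge> 0 \<and> L = range ((*) k)"
    have "k \<in> range ((*) k)" by (rule range_eqI[of _ _ 1]) simp
    then have "Gcd L dvd k" using k by (intro Gcd_dvd) simp
    moreover have "Gcd L \<in> L" using Gcd_in_group_closure[of L] unfolding cl .
    then have "k dvd Gcd L" using k by (auto simp only: range_int_mult mem_Collect_eq)
    ultimately show "k = Gcd L" using k by (intro zdvd_antisym_nonneg) auto
  qed
qed

lemma real_cmul_Ints_imp_Rats:
  assumes "of_int m * (x::real) \<in> \<int>" "m \<noteq> 0" shows "x \<in> \<rat>"
proof -
  obtain l where "of_int m * x = of_int l" using assms(1) by (auto elim: Ints_cases)
  then have "x = of_int l / of_int m" using assms(2) by (simp add: field_simps)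
  then show ?thesis by simp
qed

lemma common_denominator:
  assumes "finite I" "\<And>i. i \<in> I \<Longrightarrow> (r i :: real) \<in> \<rat>"
  shows "\<exists>m::int. m > 0 \<and> (\<forall>i\<in>I. of_int m * r i \<in> \<int>)"
  using assms
proof (induction I rule: finite_induct)
  case (insert i I)
  then obtain m :: int where m: "m > 0" "\<forall>i\<in>I. of_int m * r i \<in> \<int>" by auto
  obtain p q :: int where pq: "q > 0" "r i = of_int p / of_int q"
    using insert.prems[of i] by (auto elim: Rats_cases')
  have "of_int (m * q) * r i = of_int (m * p)" using pq by simp
  moreover have "of_int (m * q) * r j \<in> \<int>" if "j \<in> I" for j
  proof -
    have "of_int (m * q) * r j = of_int q * (of_int m * r j)" by simp
    then show ?thesis using m(2) that by (simp only: Ints_mult Ints_of_int)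
  qed
  ultimately have "m * q > 0 \<and> (\<forall>i\<in>insert i I. of_int (m * q) * r i \<in> \<int>)"
    using m(1) pq(1) Ints_of_int by (metis insert_iff mult_pos_pos)
  then show ?case by blast
qed (auto intro: exI[of _ 1])

lemma int_cmul_fraction_Ints_iff:
  assumes "coprime p q" "q \<ge> (1::int)"
  shows "of_int m * (of_int p / of_int q :: real) \<in> \<int> \<longleftrightarrow> q dvd m"
proof
  assume "of_int m * (of_int p / of_int q :: real) \<in> \<int>"
  then obtain l where "of_int m * (of_int p / of_int q :: real) = of_int l" by (auto elim: Ints_cases)
  then have "of_int (m * p) = (of_int (l * q) :: real)" using assms(2) by (simp add: field_simps)
  then have "m * p = l * q" by (simp only: of_int_eq_iff)
  then have "q dvd m * p" by simp
  then show "q dvd m" using assms(1) by (simp add: coprime_dvd_mult_left_iff coprime_commute)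
next
  assume "q dvd m"
  then obtain l where "m = q * l" by blast
  then have "of_int m * (of_int p / of_int q :: real) = of_int (l * p)" using assms(2) by simp
  then show "of_int m * (of_int p / of_int q :: real) \<in> \<int>" by (simp only: Ints_of_int)
qed

text \<open>
  An integer \<open>m\<close> clears the denominators of all \<open>r i\<close> iff it is a common multiple of them. A nonzero
  such \<open>m\<close> exists iff all \<open>r i\<close> are rational, and the common multiples are the multiples of the least
  one; vanishing \<open>r i\<close> impose no condition, whence \<open>Lcm {} = 1\<close>.
\<close>

lemma denominators_level:
  fixes r :: "nat \<Rightarrow> real" and I :: "nat set"
  assumes fin: "finite I"
  defines "L \<equiv> {m::int. \<forall>i\<in>I. of_int m * r i \<in> \<int>}"
  shows "\<exists>!k. k \<ge> 0 \<and> L = range ((*) k)"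
    and "L = range ((*) k) \<Longrightarrow> k = 0 \<longleftrightarrow> (\<exists>i\<in>I. r i \<notin> \<rat>)"
    and "k \<ge> 0 \<Longrightarrow> L = range ((*) k) \<Longrightarrow>
      (\<And>i. i \<in> I \<Longrightarrow> r i \<noteq> 0 \<Longrightarrow> r i = of_int (p i) / of_int (q i) \<and> coprime (p i) (q i) \<and> q i \<ge> (1::int)) \<Longrightarrow>
      k = Lcm (q ` {i \<in> I. r i \<noteq> 0})"
proof -
  show ex: "\<exists>!k. k \<ge> 0 \<and> L = range ((*) k)"
    by (rule int_subgroup_cyclic) (auto simp: L_def left_diff_distrib)
  show "k = 0 \<longleftrightarrow> (\<exists>i\<in>I. r i \<notin> \<rat>)" if L: "L = range ((*) k)" for k
  proof
    assume "k = 0"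
    then have L0: "L = {0}" using L by auto
    show "\<exists>i\<in>I. r i \<notin> \<rat>"
    proof (rule ccontr)
      assume "\<not> (\<exists>i\<in>I. r i \<notin> \<rat>)"
      then obtain m :: int where m: "m > 0" "\<forall>i\<in>I. of_int m * r i \<in> \<int>"
        using common_denominator[OF fin, of r] by blast
      then have "m \<in> L" by (simp add: L_def)
      with L0 m(1) show False by simp
    qed
  next
    assume "\<exists>i\<in>I. r i \<notin> \<rat>"
    then obtain i where i: "i \<in> I" "r i \<notin> \<rat>" by blast
    have "k \<in> L" using L by (metis mult.right_neutral rangeI)
    then show "k = 0" using i real_cmul_Ints_imp_Rats[of k "r i"] by (auto simp: L_def)
  qed
  show "k = Lcm (q ` {i \<in> I. r i \<noteq> 0})" if k: "k \<ge> 0" "L = range ((*) k)"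
    and pq: "\<And>i. i \<in> I \<Longrightarrow> r i \<noteq> 0 \<Longrightarrow> r i = of_int (p i) / of_int (q i) \<and> coprime (p i) (q i) \<and> q i \<ge> (1::int)" for k p q
  proof -
    have "of_int m * r i \<in> \<int> \<longleftrightarrow> (r i \<noteq> 0 \<longrightarrow> q i dvd m)" if "i \<in> I" for i m
      using pq[OF that] int_cmul_fraction_Ints_iff[of "p i" "q i" m] by (cases "r i = 0") auto
    then have "m \<in> L \<longleftrightarrow> Lcm (q ` {i \<in> I. r i \<noteq> 0}) dvd m" for m
      by (auto simp: L_def Lcm_dvd_iff)
    then have "L = range ((*) (Lcm (q ` {i \<in> I. r i \<noteq> 0})))"
      by (auto simp: range_int_mult)
    then show ?thesis using ex k by (metis Lcm_int_greater_eq_0)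
  qed
qed

section \<open>Relative periods and the level group\<close>

theorem theorem3p15:
  fixes M :: "'m mfd" and N :: "'n mfd" and F :: "'m \<Rightarrow> 'n"
    and \<omega> :: "'n form" and \<eta> :: "'m form"
    and n a b :: nat
    and S :: "nat \<Rightarrow> 'n chain set" and T :: "nat \<Rightarrow> 'm chain set"
    and s c :: "nat \<Rightarrow> 'n chain" and t :: "nat \<Rightarrow> 'm chain"
    and r :: "nat \<Rightarrow> real"
  defines "HN \<equiv> smooth_homology_group (n + 1) N"
    and "HM \<equiv> smooth_homology_group n M"
  defines "K \<equiv> kernel HM (smooth_homology_group n N) (smooth_hom_induced n N F)"
    and "Tor \<equiv> torsion_subgroup HN"
    and "P \<equiv> rel_periods (n + 1) M N F (\<omega>, \<eta>)"
    and "L \<equiv> level_group (n + 1) M N F (\<omega>, \<eta>)"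
  assumes "n \<ge> 1"
    and "smooth_manifold M" and "smooth_manifold N" and "smooth_map M N F"
    and "(\<omega>, \<eta>) \<in> rel_forms (n + 1) M N"
    and "rel_closed (n + 1) M N F (\<omega>, \<eta>)"
    and "fin_gen_group HN"
    and "fin_gen_group (HM\<lparr>carrier := K\<rparr>)"
    \<comment> \<open>the classes \<open>S\<^sub>1, \<dots>, S\<^sub>a\<close> and \<open>T\<^sub>1, \<dots>, T\<^sub>b\<close>\<close>
    and "\<And>i. i \<in> {1..a} \<Longrightarrow> S i \<in> carrier HN"
    and "generate (HN Mod Tor) ((\<lambda>i. Tor #>\<^bsub>HN\<^esub> S i) ` {1..a}) = carrier (HN Mod Tor)"
    and "\<And>j. j \<in> {1..b} \<Longrightarrow> T j \<in> K"
    and "generate HM (T ` {1..b}) = K"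
    \<comment> \<open>arbitrary representing cycles, arbitrary bounding chains, and the resulting integrals\<close>
    and "\<And>i. i \<in> {1..a} \<Longrightarrow> s i \<in> S i"
    and "\<And>i. i \<in> {1..a} \<Longrightarrow> r i = chain_integral (n + 1) N \<omega> (s i)"
    and "\<And>j. j \<in> {1..b} \<Longrightarrow> t j \<in> T j"
    and "\<And>j. j \<in> {1..b} \<Longrightarrow> c j \<in> smooth_chains (n + 1) N"
    and "\<And>j. j \<in> {1..b} \<Longrightarrow> chain_boundary (n + 1) (c j) = chain_map n F (t j)"
    and "\<And>j. j \<in> {1..b} \<Longrightarrow>
           r (a + j) = chain_integral (n + 1) N \<omega> (c j) - chain_integral n M \<eta> (t j)"
  shows
    \<comment> \<open>(i), then existence and uniqueness of \<open>k\<^sub>0\<close>, then (ii), then (iii)\<close>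
    "P = group_closure (r ` {1..a + b}) \<and>
     (\<forall>j\<in>{1..b}. \<forall>c'\<in>smooth_chains (n + 1) N.
       chain_boundary (n + 1) c' = chain_map n F (t j) \<longrightarrow>
       (chain_integral (n + 1) N \<omega> c' - chain_integral n M \<eta> (t j)) - r (a + j)
         \<in> group_closure (r ` {1..a})) \<and>
     (\<forall>c'. (\<forall>j\<in>{1..b}. c' j \<in> smooth_chains (n + 1) N \<and>
              chain_boundary (n + 1) (c' j) = chain_map n F (t j)) \<longrightarrow>
       group_closure (r ` {1..a} \<union>
         (\<lambda>j. chain_integral (n + 1) N \<omega> (c' j) - chain_integral n M \<eta> (t j)) ` {1..b})
       = group_closure (r ` {1..a + b})) \<and>
     (\<exists>!k0::int. k0 \<ge> 0 \<and> L = range ((*) k0)) \<and>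
     (\<forall>k0::int. k0 \<ge> 0 \<and> L = range ((*) k0) \<longrightarrow>
       (k0 = 0 \<longleftrightarrow> (\<exists>i\<in>{1..a + b}. r i \<notin> \<rat>)) \<and>
       (k0 = 0 \<longrightarrow> (\<forall>k::int. k \<noteq> 0 \<longrightarrow> k \<notin> L)) \<and>
       ((\<forall>i\<in>{1..a + b}. r i \<in> \<rat>) \<longrightarrow>
         (\<forall>p q :: nat \<Rightarrow> int.
           (\<forall>i\<in>{1..a + b}. r i \<noteq> 0 \<longrightarrow>
              r i = of_int (p i) / of_int (q i) \<and> coprime (p i) (q i) \<and> q i \<ge> 1) \<longrightarrow>
           k0 = Lcm (q ` {i \<in> {1..a + b}. r i \<noteq> 0})) \<and>
         ((\<forall>i\<in>{1..a + b}. r i = 0) \<longrightarrow> k0 = 1)))"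
proof -
  note S = \<open>\<And>i. i \<in> {1..a} \<Longrightarrow> S i \<in> carrier HN\<close>
  note T = \<open>\<And>j. j \<in> {1..b} \<Longrightarrow> T j \<in> K\<close>
  note gens_S = \<open>generate (HN Mod Tor) ((\<lambda>i. Tor #>\<^bsub>HN\<^esub> S i) ` {1..a}) = carrier (HN Mod Tor)\<close>
  note gens_T = \<open>generate HM (T ` {1..b}) = K\<close>
  note s = \<open>\<And>i. i \<in> {1..a} \<Longrightarrow> s i \<in> S i\<close>
  note t = \<open>\<And>j. j \<in> {1..b} \<Longrightarrow> t j \<in> T j\<close>
  note M = \<open>smooth_manifold M\<close> and N = \<open>smooth_manifold N\<close> and F = \<open>smooth_map M N F\<close>
  define IN where "IN = chain_integral (Suc n) N \<omega>"
  define IM where "IM = chain_integral n M \<eta>"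
  have IN_simps: "IN 0 = 0" "IN (x - y) = IN x - IN y" "IN (x + y) = IN x + IN y" "IN (- x) = - IN x"
      "IN (frag_cmul m x) = of_int m * IN x" for x y m
    by (simp_all add: IN_def)
  have IM_simps: "IM 0 = 0" "IM (x - y) = IM x - IM y" "IM (x + y) = IM x + IM y" "IM (- x) = - IM x" for x y
    by (simp_all add: IM_def)
  have rs: "r i = IN (s i)" if "i \<in> {1..a}" for i
    using \<open>\<And>i. i \<in> {1..a} \<Longrightarrow> r i = chain_integral (n + 1) N \<omega> (s i)\<close>[OF that] by (simp add: IN_def)
  have c: "c j \<in> smooth_chains (Suc n) N" "chain_boundary (Suc n) (c j) = chain_map n F (t j)"
      "r (a + j) = IN (c j) - IM (t j)" if "j \<in> {1..b}" for j
    using \<open>\<And>j. j \<in> {1..b} \<Longrightarrow> c j \<in> smooth_chains (n + 1) N\<close>[OF that]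
      \<open>\<And>j. j \<in> {1..b} \<Longrightarrow> chain_boundary (n + 1) (c j) = chain_map n F (t j)\<close>[OF that]
      \<open>\<And>j. j \<in> {1..b} \<Longrightarrow> r (a + j) = chain_integral (n + 1) N \<omega> (c j) - chain_integral n M \<eta> (t j)\<close>[OF that]
    by (simp_all add: IN_def IM_def)
  have \<omega>: "\<omega> \<in> smooth_forms (Suc n) N" and \<eta>: "\<eta> \<in> smooth_forms n M"
    using \<open>(\<omega>, \<eta>) \<in> rel_forms (n + 1) M N\<close> by (simp_all add: rel_forms_def)
  have d\<omega>: "form_vanishes (Suc (Suc n)) N (ext_deriv (Suc n) N \<omega>)"
    and d\<eta>: "form_vanishes (Suc n) M (\<lambda>c x v. pullback M N F \<omega> c x v - ext_deriv n M \<eta> c x v)"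
    using \<open>rel_closed (n + 1) M N F (\<omega>, \<eta>)\<close> by (simp_all add: rel_closed_def rel_ext_deriv_def)

  \<comment> \<open>the two consequences of Stokes' theorem\<close>
  have IN_boundary: "IN x = 0" if x: "x \<in> smooth_boundaries (Suc n) N" for x
  proof -
    obtain V where V: "V \<in> smooth_chains (Suc (Suc n)) N" "x = chain_boundary (Suc (Suc n)) V"
      using x by (auto simp: smooth_boundaries_def)
    then show ?thesis
      using stokes[OF N \<omega> V(1)] chain_integral_vanish[OF N V(1) d\<omega>] by (simp add: IN_def)
  qed
  have IN_push: "IN (chain_map (Suc n) F U) = IM (chain_boundary (Suc n) U)" if U: "U \<in> smooth_chains (Suc n) M" for U
    using chain_integral_chain_map[OF M N F U, of \<omega>] chain_integral_cong[OF M U d\<eta>] stokes[OF M \<eta> U]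
    by (simp add: IN_def IM_def)
  have push: "chain_map (Suc n) F U \<in> smooth_chains (Suc n) N"
      "chain_boundary (Suc n) (chain_map (Suc n) F U) = chain_map n F (chain_boundary (Suc n) U)"
    if U: "U \<in> smooth_chains (Suc n) M" for U
    using smooth_chains_map[OF M N F U] chain_boundary_chain_map[OF smooth_chains_singular[OF U], of F] by simp_all

  let ?\<Gamma>a = "group_closure (r ` {1..a})" and ?\<Gamma> = "group_closure (r ` {1..a + b})"
  have \<Gamma>a_sub: "?\<Gamma>a \<subseteq> ?\<Gamma>" by (rule group_closure_mono) auto
  have S': "S i \<in> carrier (smooth_homology_group (Suc n) N)" if "i \<in> {1..a}" for i
    using S[OF that] by (simp add: HN_def)
  have T': "T j \<in> carrier (smooth_homology_group n M)" if "j \<in> {1..b}" for j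
    using T[OF that] by (simp add: K_def HM_def kernel_def)
  have s_cycle: "s i \<in> smooth_cycles (Suc n) N" if "i \<in> {1..a}" for i
    by (rule homology_class_subset[OF N S'[OF that] s[OF that]])
  have t_cycle: "t j \<in> smooth_cycles n M" if "j \<in> {1..b}" for j
    by (rule homology_class_subset[OF M T'[OF that] t[OF that]])

  have cycle_period: "IN z \<in> ?\<Gamma>a" if z: "z \<in> smooth_cycles (Suc n) N" for z
  proof (rule homology_mod_torsion_generate_induct[where P = "\<lambda>z. IN z \<in> ?\<Gamma>a", OF N _ _ _ _ _ _ z])
    show "generate (smooth_homology_group (Suc n) N Mod torsion_subgroup (smooth_homology_group (Suc n) N))
        ((\<lambda>i. torsion_subgroup (smooth_homology_group (Suc n) N) #>\<^bsub>smooth_homology_group (Suc n) N\<^esub> S i) ` {1..a})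
      = carrier (smooth_homology_group (Suc n) N Mod torsion_subgroup (smooth_homology_group (Suc n) N))"
      using gens_S unfolding HN_def Tor_def by simp
    show "IN x \<in> ?\<Gamma>a" if "m > 0" "frag_cmul (int m) x \<in> smooth_boundaries (Suc n) N" for x m
      using IN_boundary[OF that(2)] that(1) by (simp add: IN_simps)
    show "IN x \<in> ?\<Gamma>a" if i: "i \<in> {1..a}" and x: "x \<in> S i" for i x
    proof -
      have "IN x = r i"
        using IN_boundary[OF homology_class_diff[OF N S'[OF i] x s[OF i]]] rs[OF i] by (simp add: IN_simps)
      then show ?thesis using i by (auto intro: group_closure.base)
    qed
  qed (auto simp: S' IN_simps intro: group_closure_add)

  \<comment> \<open>A cycle of \<open>M\<close> with \<open>Q\<close> is the second component of a relative cycle whose period is in the group.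
    Any other first component differs by a cycle of \<open>N\<close>, so one good choice is enough.\<close>
  define Q where "Q z \<longleftrightarrow> (\<exists>x\<in>smooth_chains (Suc n) N. chain_boundary (Suc n) x = chain_map n F z \<and> IN x - IM z \<in> ?\<Gamma>)" for z
  have kernel_period: "Q z"
    if z: "z \<in> smooth_cycles n M" and bz: "chain_map n F z \<in> smooth_boundaries n N" for z
  proof (rule homology_generate_induct[OF M, where A = "T ` {1..b}" and P = Q])
    show "smooth_boundaries n M #>\<^bsub>smooth_cycle_group n M\<^esub> z \<in> generate (smooth_homology_group n M) (T ` {1..b})"
      using in_kernel_smooth_hom_induced[OF M N F z bz] gens_T by (simp add: HM_def K_def)
    show "z \<in> smooth_boundaries n M #>\<^bsub>smooth_cycle_group n M\<^esub> z"
      by (rule cls_self[OF M z])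
    show "T ` {1..b} \<subseteq> carrier (smooth_homology_group n M)" using T' by blast
  next
    fix y assume "y \<in> smooth_boundaries n M"
    then obtain U where U: "U \<in> smooth_chains (Suc n) M" "y = chain_boundary (Suc n) U"
      by (auto simp: smooth_boundaries_def)
    then show "Q y"
      unfolding Q_def using push[OF U(1)] IN_push[OF U(1)] by (intro bexI[of _ "chain_map (Suc n) F U"]) auto
  next
    fix Y y assume "Y \<in> T ` {1..b}" and y: "y \<in> Y"
    then obtain j where j: "j \<in> {1..b}" "Y = T j" by blast
    have "y - t j \<in> smooth_boundaries n M"
      by (rule homology_class_diff[OF M T'[OF j(1)] _ t[OF j(1)]]) (use y j in simp)
    then obtain U where U: "U \<in> smooth_chains (Suc n) M" "y - t j = chain_boundary (Suc n) U"
      by (auto simp: smooth_boundaries_def)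
    \<comment> \<open>a different representative of \<open>T\<^sub>j\<close> is compensated by pushing forward the homology\<close>
    then have y_eq: "y = t j + chain_boundary (Suc n) U" by (simp add: algebra_simps)
    show "Q y"
      unfolding Q_def
    proof (intro bexI[of _ "c j + chain_map (Suc n) F U"] conjI)
      show "chain_boundary (Suc n) (c j + chain_map (Suc n) F U) = chain_map n F y"
        using c(2)[OF j(1)] push(2)[OF U(1)] by (simp add: y_eq chain_boundary_add chain_map_add)
      have "IN (c j + chain_map (Suc n) F U) - IM y = r (a + j)"
        using c(3)[OF j(1)] IN_push[OF U(1)] by (simp add: y_eq IN_simps IM_simps)
      then show "IN (c j + chain_map (Suc n) F U) - IM y \<in> ?\<Gamma>"
        using j(1) by (auto intro!: group_closure.base)
      show "c j + chain_map (Suc n) F U \<in> smooth_chains (Suc n) N"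
        using c(1)[OF j(1)] push(1)[OF U(1)] by (rule smooth_chains_add)
    qed
  next
    fix y assume "Q y"
    then obtain x where x: "x \<in> smooth_chains (Suc n) N" "chain_boundary (Suc n) x = chain_map n F y" "IN x - IM y \<in> ?\<Gamma>"
      unfolding Q_def by blast
    then have "IN (- x) - IM (- y) \<in> ?\<Gamma>"
      using group_closure_minus_iff[of "IN x - IM y"] by (simp add: IN_simps IM_simps)
    then show "Q (- y)"
      unfolding Q_def using x by (intro bexI[of _ "- x"]) (auto simp: chain_boundary_minus chain_map_minus smooth_chains_uminus)
  next
    fix y y' assume "Q y" "Q y'"
    then obtain x x' where
      x: "x \<in> smooth_chains (Suc n) N" "chain_boundary (Suc n) x = chain_map n F y" "IN x - IM y \<in> ?\<Gamma>" and
      x': "x' \<in> smooth_chains (Suc n) N" "chain_boundary (Suc n) x' = chain_map n F y'" "IN x' - IM y' \<in> ?\<Gamma>"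
      unfolding Q_def by blast
    have "IN (x + x') - IM (y + y') \<in> ?\<Gamma>"
      using group_closure_add[OF x(3) x'(3)] by (simp add: IN_simps IM_simps algebra_simps)
    then show "Q (y + y')"
      unfolding Q_def using x x' by (intro bexI[of _ "x + x'"]) (auto simp: chain_boundary_add chain_map_add smooth_chains_add)
  qed

  have bounding_chain: "IN x - IM (t j) - r (a + j) \<in> ?\<Gamma>a"
    if j: "j \<in> {1..b}" and x: "x \<in> smooth_chains (Suc n) N" "chain_boundary (Suc n) x = chain_map n F (t j)" for j x
  proof -
    have "x - c j \<in> smooth_cycles (Suc n) N"
      using x c[OF j] by (simp add: smooth_cycles_iff smooth_chains_diff chain_boundary_diff)
    from cycle_period[OF this] show ?thesis by (simp add: c(3)[OF j] IN_simps)
  qed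

  have rel_cyclesI: "IN x - IM z \<in> P"
    if "x \<in> smooth_chains (Suc n) N" "z \<in> smooth_chains n M" "chain_boundary (Suc n) x = chain_map n F z" "chain_boundary n z = 0" for x z
    unfolding P_def rel_periods_def
    by (rule image_eqI[of _ _ "(x, z)"]) (use that in \<open>simp_all add: rel_pairing_def rel_cycles_def IN_def IM_def\<close>)
  have PE: "\<exists>x z. p = IN x - IM z \<and> x \<in> smooth_chains (Suc n) N \<and> z \<in> smooth_chains n M \<and>
      chain_boundary (Suc n) x = chain_map n F z \<and> chain_boundary n z = 0" if "p \<in> P" for p
    using that unfolding P_def rel_periods_def by (auto simp: rel_pairing_def rel_cycles_def IN_def IM_def)
  have P: "P = ?\<Gamma>"
  proof
    show "?\<Gamma> \<subseteq> P"
    proof (rule group_closure_subset)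
      show "r ` {1..a + b} \<subseteq> P"
      proof
        fix p assume "p \<in> r ` {1..a + b}"
        then obtain i where i: "i \<in> {1..a + b}" "p = r i" by blast
        show "p \<in> P"
        proof (cases "i \<le> a")
          case True
          then have "i \<in> {1..a}" using i by simp
          then show ?thesis
            using rel_cyclesI[of "s i" 0] s_cycle[of i] rs[of i] i(2) by (simp add: smooth_cycles_iff IM_simps)
        next
          case False
          then have j: "i - a \<in> {1..b}" "i = a + (i - a)" using i by auto
          then show ?thesis
            using rel_cyclesI[of "c (i - a)" "t (i - a)"] c[OF j(1)] t_cycle[OF j(1)] i(2) by (simp add: smooth_cycles_iff)
        qed
      qed
      show "0 \<in> P" using rel_cyclesI[of 0 0] by (simp add: IN_simps IM_simps)
      fix p q assume "p \<in> P" "q \<in> P"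
      from PE[OF this(1)] PE[OF this(2)] obtain x z x' z' where
        p: "p = IN x - IM z" and x: "x \<in> smooth_chains (Suc n) N" "z \<in> smooth_chains n M"
        "chain_boundary (Suc n) x = chain_map n F z" "chain_boundary n z = 0"
        and q: "q = IN x' - IM z'" and x': "x' \<in> smooth_chains (Suc n) N" "z' \<in> smooth_chains n M"
        "chain_boundary (Suc n) x' = chain_map n F z'" "chain_boundary n z' = 0"
        by blast
      have "p - q = IN (x - x') - IM (z - z')"
        by (simp add: p q IN_simps IM_simps)
      also have "\<dots> \<in> P"
        using x x' by (intro rel_cyclesI) (simp_all add: smooth_chains_diff chain_boundary_diff chain_map_diff)
      finally show "p - q \<in> P" .
    qed
    show "P \<subseteq> ?\<Gamma>"
    proof
      fix p assume "p \<in> P"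
      from PE[OF this] obtain x z where p: "p = IN x - IM z" and x: "x \<in> smooth_chains (Suc n) N" "chain_boundary (Suc n) x = chain_map n F z"
        and z: "z \<in> smooth_chains n M" "chain_boundary n z = 0" by blast
      have "z \<in> smooth_cycles n M" using z by (simp add: smooth_cycles_iff)
      moreover have "chain_map n F z \<in> smooth_boundaries n N"
        using x unfolding smooth_boundaries_def by (metis image_eqI)
      ultimately obtain y where y: "y \<in> smooth_chains (Suc n) N" "chain_boundary (Suc n) y = chain_map n F z" "IN y - IM z \<in> ?\<Gamma>"
        using kernel_period unfolding Q_def by blast
      have "x - y \<in> smooth_cycles (Suc n) N"
        using x y by (simp add: smooth_cycles_iff smooth_chains_diff chain_boundary_diff)
      then have "IN (x - y) \<in> ?\<Gamma>" using cycle_period \<Gamma>a_sub by blast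
      from group_closure_add[OF this y(3)] show "p \<in> ?\<Gamma>" by (simp add: p IN_simps)
    qed
  qed

  have split: "r ` {1..a + b} = r ` {1..a} \<union> (\<lambda>j. r (a + j)) ` {1..b}"
  proof -
    have "{1..a + b} = {1..a} \<union> (\<lambda>j. a + j) ` {1..b}" by auto
    then show ?thesis by (simp only: image_Un image_image)
  qed
  have other_chains: "group_closure (r ` {1..a} \<union> (\<lambda>j. IN (c' j) - IM (t j)) ` {1..b}) = ?\<Gamma>"
    if c': "\<And>j. j \<in> {1..b} \<Longrightarrow> c' j \<in> smooth_chains (Suc n) N"
      "\<And>j. j \<in> {1..b} \<Longrightarrow> chain_boundary (Suc n) (c' j) = chain_map n F (t j)" for c'
  proof -
    let ?G = "group_closure (r ` {1..a} \<union> (\<lambda>j. IN (c' j) - IM (t j)) ` {1..b})"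
    have a_sub: "?\<Gamma>a \<subseteq> ?G" by (rule group_closure_mono) auto
    have d: "IN (c' j) - IM (t j) - r (a + j) \<in> ?\<Gamma>a" if "j \<in> {1..b}" for j
      by (rule bounding_chain[OF that c'[OF that]])
    have 1: "IN (c' j) - IM (t j) \<in> ?\<Gamma>" if j: "j \<in> {1..b}" for j
    proof -
      have "r (a + j) \<in> ?\<Gamma>" using j by (auto intro!: group_closure.base)
      from group_closure_add[OF subsetD[OF \<Gamma>a_sub d[OF j]] this] show ?thesis by simp
    qed
    have 2: "r (a + j) \<in> ?G" if j: "j \<in> {1..b}" for j
    proof -
      have "IN (c' j) - IM (t j) \<in> ?G" using j by (auto intro!: group_closure.base)
      from group_closure.diff[OF this subsetD[OF a_sub d[OF j]]] show ?thesis by simp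
    qed
    show ?thesis
    proof
      show "?G \<subseteq> ?\<Gamma>"
        using 1 by (intro group_closure_subset) (auto intro: group_closure.base group_closure.diff)
      show "?\<Gamma> \<subseteq> ?G"
        unfolding split using 2 by (intro group_closure_subset) (auto intro: group_closure.base group_closure.diff)
    qed
  qed

  have L: "L = {m::int. \<forall>i\<in>{1..a + b}. of_int m * r i \<in> \<int>}"
  proof -
    have "rel_periods (n + 1) M N F (rel_scale (of_int m) (\<omega>, \<eta>)) = (*) (of_int m) ` P" for m :: int
      unfolding P_def rel_periods_def image_image
      by (intro image_cong refl) (auto simp: rel_pairing_def rel_scale_def chain_integral_scale right_diff_distrib)
    then have "m \<in> L \<longleftrightarrow> (\<forall>x\<in>P. of_int m * x \<in> \<int>)" for m
      unfolding L_def level_group_def rel_integral_def mem_Collect_eq by auto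
    then show ?thesis
      unfolding P group_closure_real_cmul_Ints by auto
  qed
  note level = denominators_level[where I = "{1..a + b}" and r = r, OF finite_atLeastAtMost, folded L]
  show ?thesis
  proof (intro conjI allI ballI impI)
    show "P = ?\<Gamma>" by (rule P)
    show "(chain_integral (n + 1) N \<omega> c' - chain_integral n M \<eta> (t j)) - r (a + j) \<in> ?\<Gamma>a"
      if "j \<in> {1..b}" "c' \<in> smooth_chains (n + 1) N" "chain_boundary (n + 1) c' = chain_map n F (t j)" for j c'
      using bounding_chain[of j c'] that by (simp add: IN_def IM_def)
    show "group_closure (r ` {1..a} \<union> (\<lambda>j. chain_integral (n + 1) N \<omega> (c' j) - chain_integral n M \<eta> (t j)) ` {1..b}) = ?\<Gamma>"
      if "\<forall>j\<in>{1..b}. c' j \<in> smooth_chains (n + 1) N \<and> chain_boundary (n + 1) (c' j) = chain_map n F (t j)" for c'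
      using other_chains[of c'] that by (simp add: IN_def IM_def)
    show "\<exists>!k0::int. k0 \<ge> 0 \<and> L = range ((*) k0)" by (rule level(1))
    fix k0 :: int assume k0: "k0 \<ge> 0 \<and> L = range ((*) k0)"
    show "k0 = 0 \<longleftrightarrow> (\<exists>i\<in>{1..a + b}. r i \<notin> \<rat>)"
      using k0 by (intro level(2)) simp
    show "k \<notin> L" if "k0 = 0" "k \<noteq> 0" for k
      using k0 that by auto
    show "k0 = Lcm (q ` {i \<in> {1..a + b}. r i \<noteq> 0})"
      if "\<forall>i\<in>{1..a + b}. r i \<noteq> 0 \<longrightarrow> r i = of_int (p i) / of_int (q i) \<and> coprime (p i) (q i) \<and> q i \<ge> 1" for p q :: "nat \<Rightarrow> int"
      by (rule level(3)[where p = p]) (use k0 that in auto)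
    show "k0 = 1" if "\<forall>i\<in>{1..a + b}. r i = 0"
    proof -
      \<comment> \<open>no index is left, so the numerators and denominators may be any constants\<close>
      have "k0 = Lcm ((\<lambda>_. 1) ` {i \<in> {1..a + b}. r i \<noteq> 0})"
        by (rule level(3)[where p = "\<lambda>_. 0"]) (use k0 that in auto)
      moreover have "{i \<in> {1..a + b}. r i \<noteq> 0} = {}" using that by auto
      ultimately show ?thesis by (simp only: image_empty Lcm_empty)
    qed
  qed
qed

end
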